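(* Assume that $\mu,\nu$ are probability measures on $\mathbb{R}$ with finite first moments, that $\mu\preceq_C\nu$ (convex order), and that $c:\mathbb{R}^2\to\mathbb{R}$ is a continuous bounded cost function. Let $\pi\in\Pi_M(\mu,\nu)$. If there exists a Borel set $\Gamma\subseteq\mathbb{R}^2$ which is finitely optimal for $c$ and satisfies $\pi(\Gamma)=1$, then $\pi$ is an optimal martingale transport plan, i.e. it minimizes $\pi'\mapsto\iint c\,d\pi'$ over $\Pi_M(\mu,\nu)$.
   Context: Convex order: two finite Borel measures $\mu,\nu$ on $\mathbb{R}$ with finite first moments satisfy $\mu\preceq_C\nu$ if $\int\varphi\,d\mu\le\int\varphi\,d\nu$ for every convex $\varphi:\mathbb{R}\to\mathbb{R}$. $\Pi_M(\mu,\nu)$ (martingale transport plans) is the set of Borel measures $\pi$ on $\mathbb{R}\times\mathbb{R}$ with first marginal $\mu$, second marginal $\nu$, whose disintegration $(\pi_x)_{x\in\mathbb{R}}$ into probability measures with respect to $\mu$ satisfies $\int y\,d\pi_x(y)=x$ for $\mu$-a.e. $x$. Competitor: let $\alpha$ be a measure on $\mathbb{R}\times\mathbb{R}$ with finite first moment in the second variable. A measure $\alpha'$ on $\mathbb{R}\times\mathbb{R}$ is a competitor of $\alpha$ if $\alpha'$ has the same two marginals as $\alpha$ and for $(\mathrm{proj}^x_\#\alpha)$-a.e. $x$ one has $\int y\,d\alpha_x(y)=\int y\,d\alpha'_x(y)$, where $(\alpha_x)$, $(\alpha'_x)$ are the disintegrations of $\alpha,\alpha'$ with respect to $\mathrm{proj}^x_\#\alpha$.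 A Borel set $\Gamma\subseteq\mathbb{R}^2$ is finitely optimal for $c$ if for every (finite, nonnegative) measure $\alpha$ on $\mathbb{R}\times\mathbb{R}$ with finite support $\operatorname{spt}(\alpha)\subseteq\Gamma$ and every competitor $\alpha'$ of $\alpha$, $\int c\,d\alpha\le\int c\,d\alpha'$. *)

theory Defs
  imports "HOL-Probability.Probability"
begin

text \<open>
  Borel measures on the line and on the plane are terms \<open>M\<close> of type \<open>real measure\<close> and
  \<open>(real \<times> real) measure\<close> with \<open>sets M = sets borel\<close>.
\<close>

text \<open>
  The integral with values in the extended reals, \<open>\<integral>f\<^sup>+ - \<integral>f\<^sup>-\<close>; \<open>ennreal\<close> sends negative
  numbers to 0. The Bochner integral would be 0 for a convex function whose integral is infinite.
  A convex function lies above an affine one, so its negative part has a finite integral with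
  respect to a finite measure with finite first moment, and the case \<open>\<infinity> - \<infinity>\<close> does not occur in
  the convex order.
\<close>

definition extended_integral :: "'a measure \<Rightarrow> ('a \<Rightarrow> real) \<Rightarrow> ereal" where
  "extended_integral M f =
     enn2ereal (\<integral>\<^sup>+ x. ennreal (f x) \<partial>M) - enn2ereal (\<integral>\<^sup>+ x. ennreal (- f x) \<partial>M)"

definition convex_order :: "real measure \<Rightarrow> real measure \<Rightarrow> bool" where
  "convex_order \<mu> \<nu> \<longleftrightarrow>
     (\<forall>\<phi>. convex_on UNIV \<phi> \<longrightarrow> extended_integral \<mu> \<phi> \<le> extended_integral \<nu> \<phi>)"

text \<open>
  \<open>K\<close> is a disintegration of \<open>\<pi>\<close> with respect to \<open>\<mu>\<close>, that is \<open>\<pi>(dx, dy) = \<mu>(dx) K x (dy)\<close>.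
  Disintegrations are unique up to \<open>\<mu>\<close>-null sets, and on the plane every finite measure has one
  with respect to its first marginal. Statements about "the" disintegration are therefore
  rendered below by an existential quantifier.
\<close>

definition disintegration ::
    "(real \<times> real) measure \<Rightarrow> real measure \<Rightarrow> (real \<Rightarrow> real measure) \<Rightarrow> bool" where
  "disintegration \<pi> \<mu> K \<longleftrightarrow>
     K \<in> borel \<rightarrow>\<^sub>M prob_algebra borel \<and>
     (\<forall>A \<in> sets borel. \<forall>B \<in> sets borel.
        emeasure \<pi> (A \<times> B) = (\<integral>\<^sup>+ x \<in> A. emeasure (K x) B \<partial>\<mu>))"

definition martingale_plans :: "real measure \<Rightarrow> real measure \<Rightarrow> (real \<times> real) measure set" where
  "martingale_plans \<mu> \<nu> =
     {\<pi>. sets \<pi> = sets borel \<and> distr \<pi> borel fst = \<mu> \<and> distr \<pi> borel snd = \<nu> \<and>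
         (\<exists>K. disintegration \<pi> \<mu> K \<and> (AE x in \<mu>. has_bochner_integral (K x) (\<lambda>y. y) x))}"

text \<open>
  The two integrability conditions under the almost-everywhere quantifier follow from the moment
  condition on \<open>\<alpha>\<close> and the equality of the second marginals. They are stated so that the equation
  between the barycentres does not depend on the value of the integral of a non-integrable function.
\<close>

definition competitor :: "(real \<times> real) measure \<Rightarrow> (real \<times> real) measure \<Rightarrow> bool" where
  "competitor \<alpha> \<alpha>' \<longleftrightarrow>
     sets \<alpha> = sets borel \<and> integrable \<alpha> snd \<and> sets \<alpha>' = sets borel \<and>
     distr \<alpha>' borel fst = distr \<alpha> borel fst \<and> distr \<alpha>' borel snd = distr \<alpha> borel snd \<and>
     (\<exists>K K'. disintegration \<alpha> (distr \<alpha> borel fst) K \<and>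
        disintegration \<alpha>' (distr \<alpha> borel fst) K' \<and>
        (AE x in distr \<alpha> borel fst.
           integrable (K x) (\<lambda>y. y) \<and> integrable (K' x) (\<lambda>y. y) \<and>
           (\<integral>y. y \<partial>K x) = (\<integral>y. y \<partial>K' x)))"

definition spt :: "'a::topological_space measure \<Rightarrow> 'a set" where
  "spt M = {x. \<forall>U. open U \<longrightarrow> x \<in> U \<longrightarrow> emeasure M U > 0}"

definition finitely_optimal :: "(real \<times> real \<Rightarrow> real) \<Rightarrow> (real \<times> real) set \<Rightarrow> bool" where
  "finitely_optimal c \<Gamma> \<longleftrightarrow>
     (\<forall>\<alpha> \<alpha>'. finite_measure \<alpha> \<longrightarrow> sets \<alpha> = sets borel \<longrightarrow>
        finite (spt \<alpha>) \<longrightarrow> spt \<alpha> \<subseteq> \<Gamma> \<longrightarrow> competitor \<alpha> \<alpha>' \<longrightarrow>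
        (\<integral>z. c z \<partial>\<alpha>) \<le> (\<integral>z. c z \<partial>\<alpha>'))"

definition optimal_martingale_plan ::
    "(real \<times> real \<Rightarrow> real) \<Rightarrow> real measure \<Rightarrow> real measure \<Rightarrow> (real \<times> real) measure \<Rightarrow> bool" where
  "optimal_martingale_plan c \<mu> \<nu> \<pi> \<longleftrightarrow>
     \<pi> \<in> martingale_plans \<mu> \<nu> \<and>
     (\<forall>\<pi>' \<in> martingale_plans \<mu> \<nu>. (\<integral>z. c z \<partial>\<pi>) \<le> (\<integral>z. c z \<partial>\<pi>'))"

end

theory Submission
  imports Defs
begin

text \<open>
  Write \<open>|c| \<le> C\<close>. By linear programming duality, finite optimality gives every finite \<open>G \<subseteq> \<Gamma>\<close>
  potentials with \<open>\<phi> x + \<psi> y + \<Delta> x * y \<le> c (x, y)\<close> on the grid spanned by \<open>G\<close> and equality on \<open>G\<close>.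
  For two points \<open>x, x'\<close> whose contact sets \<open>\<Gamma>\<^sub>x, \<Gamma>\<^sub>x\<^sub>'\<close> overlap, boundedness of \<open>c\<close> bounds the
  difference of the affine functions \<open>l\<^sub>x(y) = \<phi> x + \<Delta> x * y\<close>, so the potentials of finite sets pass to a
  limit by Tychonoff on each component \<open>U\<close> of the union of the open intervals spanned by
  the contact sets. No martingale plan with the same marginals as \<open>\<pi>\<close> crosses a point outside this union
  (compare the integrals of \<open>|y - t|\<close>), so both plans split along the components and have the same second
  marginal over each of them.

  On a component \<open>\<psi>\<close> need not be integrable. However the concave function \<open>u = inf\<^sub>x (C - l\<^sub>x)\<close> satisfies
  \<open>u - 2C \<le> \<psi> \<le> u\<close>, the Jensen gap of \<open>u\<close> under \<open>\<pi>\<^sub>x\<close> is at most \<open>2C\<close>, and the integral of the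
  Jensen gap under another plan is no larger, because truncating \<open>u\<close> along tangents gives gaps that are
  smaller, converge, and have integrals depending only on the marginals. Integrating
  \<open>l\<^sub>x + \<psi> \<le> c\<close>, an equality for \<open>\<pi>\<close>, with \<open>\<psi> = u + (\<psi> - u)\<close> proves the claim.
\<close>

section \<open>Duality for finite sets\<close>

text \<open>The limit potentials come from compactness and carry no measurability.
  \<open>\<phi>\<close> and \<open>\<Delta>\<close> enter only at a fixed \<open>x\<close>:
  integrated over one fibre the slope term vanishes by the martingale property, so plans are
  compared fibre by fibre and neither function is ever integrated. \<open>\<psi>\<close> is replaced
  by the infimum over \<open>x\<close> of \<open>c (x, y) - l x y\<close>, which agrees with it at
  contact points, makes sense on the whole hull of their second coordinates, and is Borel as an
  infimum of continuous functions.

  Shifting the cost by \<open>C\<close> turns every comparison into one between nonnegative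
  integrals, and only finite terms are cancelled.

  Endpoints of components are delicate. A kernel may charge an endpoint, and two neighbouring
  components may share one; the mass each of them sends there is fixed by mass balance. A concave
  function may have infinite slope at an endpoint, so supporting lines are used at interior points
  only.\<close>

definition linear_functional :: "(('a \<Rightarrow> real) \<Rightarrow> real) \<Rightarrow> bool" where
  "linear_functional a \<longleftrightarrow> (\<forall>u v t. a (\<lambda>p. u p + t * v p) = a u + t * a v)"

lemma linear_functionalD: "linear_functional a \<Longrightarrow> a (\<lambda>p. u p + t * v p) = a u + t * a v"
  by (simp add: linear_functional_def)

lemma linear_functional_zero: "linear_functional a \<Longrightarrow> a (\<lambda>p. 0) = 0"
  using linear_functionalD[of a "\<lambda>p. 0" 1 "\<lambda>p. 0"] by simp

lemma linear_functional_scale: "linear_functional a \<Longrightarrow> a (\<lambda>p. t * v p) = t * a v"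
  using linear_functionalD[of a "\<lambda>p. 0" t v] by (simp add: linear_functional_zero)

text \<open>Induction on the number of constraints. If \<open>0 \<le> b u\<close> fails without the
  new constraint \<open>a m\<close>, some vector satisfies all the others but makes
  \<open>b\<close>, and hence \<open>a m\<close>, negative. Projecting along it onto the kernel of
  \<open>a m\<close> removes this constraint, and the weight of \<open>a m\<close> is what the
  projection leaves over.\<close>

lemma farkas:
  fixes a :: "'i \<Rightarrow> ('a \<Rightarrow> real) \<Rightarrow> real"
  assumes "finite I" "\<And>i. i \<in> I \<Longrightarrow> linear_functional (a i)" "linear_functional b"
    and "\<And>u. (\<forall>i\<in>I. 0 \<le> a i u) \<Longrightarrow> 0 \<le> b u"
  shows "\<exists>w. (\<forall>i\<in>I. 0 \<le> w i) \<and> (\<forall>u. b u = (\<Sum>i\<in>I. w i * a i u))"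
  using assms
proof (induction I arbitrary: a b rule: finite_induct)
  case empty
  \<comment> \<open>Without constraints \<open>b\<close> is nonnegative both at \<open>u\<close> and
    at \<open>- u\<close>.\<close>
  have "b u = 0" for u
    using empty(3)[of u] empty(3)[of "\<lambda>p. -1 * u p"] linear_functional_scale[OF empty(2), of "-1" u] by auto
  then show ?case by auto
next
  case (insert m I)
  show ?case
  proof (cases "\<forall>u. (\<forall>i\<in>I. 0 \<le> a i u) \<longrightarrow> 0 \<le> b u")
    case True
    then obtain w where w: "\<forall>i\<in>I. 0 \<le> w i" "\<forall>u. b u = (\<Sum>i\<in>I. w i * a i u)"
      using insert.IH[of a b] insert.prems by auto
    have "(\<Sum>i\<in>insert m I. (w(m := 0)) i * a i u) = (\<Sum>i\<in>I. w i * a i u)" for u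
      using insert.hyps by (auto intro!: sum.cong)
    with w show ?thesis by (intro exI[of _ "w(m := 0)"]) auto
  next
    case False
    then obtain v where "\<forall>i\<in>I. 0 \<le> a i v" "\<not> 0 \<le> b v" by blast
    then have v: "\<And>i. i \<in> I \<Longrightarrow> 0 \<le> a i v" "b v < 0" by auto
    have lm: "linear_functional (a m)" and li: "\<And>i. i \<in> I \<Longrightarrow> linear_functional (a i)"
      and lb: "linear_functional b"
      using insert.prems by auto
    have amv: "a m v < 0"
      using insert.prems(3)[of v] v by (force simp: not_le)
    define z where "z = (\<lambda>p. (- 1 / a m v) * v p)"
    have z_eq: "f z = (- 1 / a m v) * f v" if "linear_functional f" for f
      unfolding z_def by (rule linear_functional_scale[OF that])
    have "0 < - 1 / a m v" using amv by (simp add: divide_neg_neg)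
    then have z: "\<And>i. i \<in> I \<Longrightarrow> 0 \<le> a i z" "b z < 0" "a m z = -1"
      unfolding z_eq[OF lm] z_eq[OF li] z_eq[OF lb] using v amv
      by (simp_all only: mult_nonneg_nonneg less_imp_le mult_pos_neg) simp
    \<comment> \<open>\<open>P u\<close> lies in the kernel of \<open>a m\<close> because
      \<open>a m z = -1\<close>, so the hypothesis on \<open>b\<close> applies to it with only the
      constraints in \<open>I\<close>.\<close>
    define P where "P = (\<lambda>u p. u p + a m u * z p)"
    have P_eq: "f (P u) = f u + a m u * f z" if "linear_functional f" for f u
      using linear_functionalD[OF that] by (simp add: P_def)
    have lin': "linear_functional (\<lambda>u. f (P u))" if "linear_functional f" for f
      using linear_functionalD[OF that] linear_functionalD[OF lm]
      by (simp add: P_eq[OF that] linear_functional_def algebra_simps)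
    have "0 \<le> b (P u)" if "\<forall>i\<in>I. 0 \<le> a i (P u)" for u
      using insert.prems(3)[of "P u"] that P_eq[OF lm, of u] z by auto
    then obtain w where w: "\<forall>i\<in>I. 0 \<le> w i" "\<And>u. b (P u) = (\<Sum>i\<in>I. w i * a i (P u))"
      using insert.IH[of "\<lambda>i u. a i (P u)" "\<lambda>u. b (P u)"] lin' li lb by auto
    \<comment> \<open>The coefficient of \<open>a m u\<close> left over after expanding
      \<open>b (P u)\<close>; it is nonnegative because \<open>b z < 0\<close> and
      \<open>a i z \<ge> 0\<close>.\<close>
    define w' where "w' = w(m := (\<Sum>i\<in>I. w i * a i z) - b z)"
    have "b u = (\<Sum>i\<in>insert m I. w' i * a i u)" for u
    proof -
      have "b u + a m u * b z = (\<Sum>i\<in>I. w i * (a i u + a m u * a i z))"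
        using w(2)[of u] P_eq li lb by (simp cong: sum.cong)
      also have "\<dots> = (\<Sum>i\<in>I. w i * a i u) + a m u * (\<Sum>i\<in>I. w i * a i z)"
        by (simp add: sum.distrib sum_distrib_left algebra_simps)
      also have "(\<Sum>i\<in>I. w i * a i u) = (\<Sum>i\<in>I. w' i * a i u)"
        using insert.hyps by (intro sum.cong) (auto simp: w'_def)
      finally show ?thesis using insert.hyps by (simp add: w'_def algebra_simps)
    qed
    moreover have "0 \<le> w' i" if "i \<in> insert m I" for i
      using w(1) z that sum_nonneg[of I "\<lambda>i. w i * a i z"] by (auto simp: w'_def)
    ultimately show ?thesis by blast
  qed
qed

text \<open>An equality is a pair of opposite inequalities, told apart by a Boolean tag. Weights on
  \<open>E\<close> become differences and lose their sign; disjointness keeps those on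
  \<open>I\<close> nonnegative.\<close>

lemma farkas_equalities:
  fixes a :: "'i \<Rightarrow> ('a \<Rightarrow> real) \<Rightarrow> real"
  assumes "finite E" "finite I" "E \<inter> I = {}"
    and lin: "\<And>i. i \<in> E \<union> I \<Longrightarrow> linear_functional (a i)" "linear_functional b"
    and nonneg: "\<And>u. (\<forall>i\<in>E. a i u = 0) \<Longrightarrow> (\<forall>i\<in>I. 0 \<le> a i u) \<Longrightarrow> 0 \<le> b u"
  shows "\<exists>w. (\<forall>i\<in>I. 0 \<le> w i) \<and> (\<forall>u. b u = (\<Sum>i\<in>E \<union> I. w i * a i u))"
proof -
  let ?J = "(E \<union> I) \<times> {True} \<union> E \<times> {False}"
  let ?a = "\<lambda>(i, s) u. (if s then 1 else -1 :: real) * a i u"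
  have "linear_functional (?a j)" if "j \<in> ?J" for j
    using that lin(1) by (cases j) (auto simp: linear_functional_def algebra_simps)
  moreover have "0 \<le> b u" if "\<forall>j\<in>?J. 0 \<le> ?a j u" for u
  proof (rule nonneg)
    show "\<forall>i\<in>E. a i u = 0"
    proof
      fix i assume "i \<in> E"
      then have "0 \<le> ?a (i, True) u" "0 \<le> ?a (i, False) u" using that by blast+
      then show "a i u = 0" by simp
    qed
    show "\<forall>i\<in>I. 0 \<le> a i u"
    proof
      fix i assume "i \<in> I"
      then have "0 \<le> ?a (i, True) u" using that by blast
      then show "0 \<le> a i u" by simp
    qed
  qed
  ultimately obtain w where w: "\<forall>j\<in>?J. 0 \<le> w j" "\<And>u. b u = (\<Sum>j\<in>?J. w j * ?a j u)"
    using farkas[of ?J ?a b] assms(1,2) lin(2) by blast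
  define w' where "w' i = w (i, True) - (if i \<in> E then w (i, False) else 0)" for i
  have "b u = (\<Sum>i\<in>E \<union> I. w' i * a i u)" for u
  proof -
    have "b u = (\<Sum>j\<in>(E \<union> I) \<times> {True}. w j * ?a j u) + (\<Sum>j\<in>E \<times> {False}. w j * ?a j u)"
      unfolding w(2)[of u] using assms(1,2) by (intro sum.union_disjoint) auto
    also have "(\<Sum>j\<in>(E \<union> I) \<times> {True}. w j * ?a j u) = (\<Sum>i\<in>E \<union> I. w (i, True) * a i u)"
      by (rule sum.reindex_bij_witness[of _ "\<lambda>i. (i, True)" fst]) auto
    also have "(\<Sum>j\<in>E \<times> {False}. w j * ?a j u) = (\<Sum>i\<in>E. - w (i, False) * a i u)"
      by (rule sum.reindex_bij_witness[of _ "\<lambda>i. (i, False)" fst]) auto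
    also have "\<dots> = (\<Sum>i\<in>E \<union> I. (if i \<in> E then - w (i, False) * a i u else 0))"
      using assms(1,2) by (subst sum.If_cases) (auto simp: Int_absorb1)
    finally show ?thesis
      by (simp add: w'_def sum.distrib[symmetric] algebra_simps if_distrib cong: if_cong) 
         (auto intro!: sum.cong simp: algebra_simps)
  qed
  moreover have "0 \<le> w' i" if "i \<in> I" for i
    using w(1) that assms(3) by (auto simp: w'_def)
  ultimately show ?thesis by blast
qed

text \<open>Dual solutions of the martingale transport problem on the grid, with complementary
  slackness on \<open>G\<close>; \<open>\<Delta>\<close> is the multiplier of the barycentre
  constraint. Asking the inequality on the grid only makes the condition pass to subsets.\<close>

definition potentials :: "(real \<times> real \<Rightarrow> real) \<Rightarrow> (real \<times> real) set \<Rightarrow>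
    (real \<Rightarrow> real) \<Rightarrow> (real \<Rightarrow> real) \<Rightarrow> (real \<Rightarrow> real) \<Rightarrow> bool" where
  "potentials c G \<phi> \<psi> \<Delta> \<longleftrightarrow>
     (\<forall>(x, y)\<in>G. \<phi> x + \<psi> y + \<Delta> x * y = c (x, y)) \<and>
     (\<forall>x\<in>fst ` G. \<forall>y\<in>snd ` G. \<phi> x + \<psi> y + \<Delta> x * y \<le> c (x, y))"

lemma potentials_subset: "potentials c G \<phi> \<psi> \<Delta> \<Longrightarrow> H \<subseteq> G \<Longrightarrow> potentials c H \<phi> \<psi> \<Delta>"
  unfolding potentials_def by (smt (verit) image_mono subset_iff)

text \<open>The directions \<open>h\<close> preserve both marginals and the first moment of every
  row, and take mass only from \<open>G\<close>. The cost is nonnegative on this cone, so Farkas'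
  lemma writes it as a combination of the constraints: the weights of row sums, column sums and row
  moments are \<open>\<phi>\<close>, \<open>\<psi>\<close> and \<open>\<Delta>\<close>, those of the
  points off \<open>G\<close> are the slack.\<close>

lemma potentials_exist_finite:
  fixes c :: "real \<times> real \<Rightarrow> real"
  assumes "finite G"
    and opt: "\<And>h :: real \<times> real \<Rightarrow> real.
      (\<And>p. p \<in> fst ` G \<times> snd ` G - G \<Longrightarrow> 0 \<le> h p) \<Longrightarrow>
      (\<And>x. x \<in> fst ` G \<Longrightarrow> (\<Sum>y\<in>snd ` G. h (x, y)) = 0) \<Longrightarrow>
      (\<And>y. y \<in> snd ` G \<Longrightarrow> (\<Sum>x\<in>fst ` G. h (x, y)) = 0) \<Longrightarrow>
      (\<And>x. x \<in> fst ` G \<Longrightarrow> (\<Sum>y\<in>snd ` G. h (x, y) * y) = 0) \<Longrightarrow>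
      0 \<le> (\<Sum>p\<in>fst ` G \<times> snd ` G. c p * h p)"
  shows "\<exists>\<phi> \<psi> \<Delta>. potentials c G \<phi> \<psi> \<Delta>"
proof -
  define X Y where "X = fst ` G" and "Y = snd ` G"
  have fin: "finite X" "finite Y" using assms(1) by (auto simp: X_def Y_def)
  have GXY: "G \<subseteq> X \<times> Y" by (force simp: X_def Y_def)
  \<comment> \<open>All constraints share one index type. The tag \<open>k\<close> is 0 for a row
    sum, 1 for a column sum, 2 for a row moment, and otherwise selects a single coordinate of
    \<open>h\<close>; index components without meaning are 0.\<close>
  define a :: "nat \<times> real \<times> real \<Rightarrow> (real \<times> real \<Rightarrow> real) \<Rightarrow> real" where
    "a = (\<lambda>(k, x, y) h. if k = 0 then \<Sum>y\<in>Y. h (x, y) else if k = 1 then \<Sum>x\<in>X. h (x, y)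
        else if k = 2 then \<Sum>y\<in>Y. h (x, y) * y else h (x, y))"
  define E where "E = {0::nat} \<times> X \<times> {0} \<union> {1} \<times> {0} \<times> Y \<union> {2} \<times> X \<times> {0::real}"
  define I where "I = {3::nat} \<times> (X \<times> Y - G)"
  have "\<exists>w. (\<forall>i\<in>I. 0 \<le> w i) \<and> (\<forall>u. (\<Sum>p\<in>X \<times> Y. c p * u p) = (\<Sum>i\<in>E \<union> I. w i * a i u))"
  proof (rule farkas_equalities)
    show "finite E" "finite I" "E \<inter> I = {}" using fin by (auto simp: E_def I_def)
    show "linear_functional (a i)" for i
      by (cases i) (auto simp: a_def linear_functional_def sum.distrib sum_distrib_left algebra_simps)
    show "linear_functional (\<lambda>u. \<Sum>p\<in>X \<times> Y. c p * u p)"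
      by (auto simp: linear_functional_def sum.distrib sum_distrib_left algebra_simps)
    fix u assume u: "\<forall>i\<in>E. a i u = 0" "\<forall>i\<in>I. 0 \<le> a i u"
    have "(\<Sum>y\<in>Y. u (x, y)) = 0" "(\<Sum>y\<in>Y. u (x, y) * y) = 0" if "x \<in> X" for x
      using u(1)[rule_format, of "(0, x, 0)"] u(1)[rule_format, of "(2, x, 0)"] that
      by (auto simp: E_def a_def)
    moreover have "(\<Sum>x\<in>X. u (x, y)) = 0" if "y \<in> Y" for y
      using u(1)[rule_format, of "(1, 0, y)"] that by (auto simp: E_def a_def)
    moreover have "0 \<le> u p" if "p \<in> X \<times> Y - G" for p
      using u(2)[rule_format, of "(3, p)"] that by (auto simp: I_def a_def)
    ultimately show "0 \<le> (\<Sum>p\<in>X \<times> Y. c p * u p)"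
      unfolding X_def Y_def by (intro opt) auto
  qed
  then obtain w where w: "\<And>i. i \<in> I \<Longrightarrow> 0 \<le> w i"
    and eq: "\<And>u. (\<Sum>p\<in>X \<times> Y. c p * u p) = (\<Sum>i\<in>E \<union> I. w i * a i u)" by blast
  define \<phi> where "\<phi> x = w (0, x, 0)" for x
  define \<psi> where "\<psi> y = w (1, 0, y)" for y
  define \<Delta> where "\<Delta> x = w (2, x, 0)" for x
  \<comment> \<open>Evaluating the Farkas identity at the indicator of one point picks at most one
    weight from each family.\<close>
  have main: "c (x, y) = \<phi> x + \<psi> y + \<Delta> x * y + (if (x, y) \<in> G then 0 else w (3, x, y))"
    if "x \<in> X" "y \<in> Y" for x y
  proof -
    let ?u = "\<lambda>p. if p = (x, y) then 1 else 0 :: real"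
    have "(\<Sum>y'\<in>Y. ?u (x', y') * y') = (\<Sum>y'\<in>Y. if y' = y then (if x' = x then y else 0) else 0)" for x'
      by (intro sum.cong) auto
    then have a2: "a (2, x', 0) ?u = (if x' = x then y else 0)" for x'
      using that fin by (simp add: a_def)
    have "c (x, y) = (\<Sum>p\<in>X \<times> Y. c p * ?u p)"
      using that fin by (simp add: if_distrib sum.delta cong: if_cong)
    also have "\<dots> = (\<Sum>i\<in>{0} \<times> X \<times> {0} \<union> {1} \<times> {0} \<times> Y \<union> {2} \<times> X \<times> {0}. w i * a i ?u) +
        (\<Sum>i\<in>I. w i * a i ?u)"
      unfolding eq E_def using fin by (intro sum.union_disjoint) (auto simp: I_def)
    also have "(\<Sum>i\<in>{0} \<times> X \<times> {0} \<union> {1} \<times> {0} \<times> Y \<union> {2} \<times> X \<times> {0}. w i * a i ?u) =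
        (\<Sum>i\<in>{0} \<times> X \<times> {0} \<union> {1} \<times> {0} \<times> Y. w i * a i ?u) + (\<Sum>i\<in>{2} \<times> X \<times> {0}. w i * a i ?u)"
      using fin by (intro sum.union_disjoint) auto
    also have "(\<Sum>i\<in>{0} \<times> X \<times> {0} \<union> {1} \<times> {0} \<times> Y. w i * a i ?u) =
        (\<Sum>i\<in>{0} \<times> X \<times> {0}. w i * a i ?u) + (\<Sum>i\<in>{1} \<times> {0} \<times> Y. w i * a i ?u)"
      using fin by (intro sum.union_disjoint) auto
    also have "(\<Sum>i\<in>{0} \<times> X \<times> {0}. w i * a i ?u) = (\<Sum>x'\<in>X. if x' = x then w (0, x', 0) else 0)"
      by (rule sum.reindex_bij_witness[of _ "\<lambda>x. (0, x, 0)" "\<lambda>i. fst (snd i)"])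
         (use that fin in \<open>auto simp: a_def\<close>)
    also have "\<dots> = \<phi> x" using that fin by (simp add: \<phi>_def)
    also have "(\<Sum>i\<in>{1} \<times> {0} \<times> Y. w i * a i ?u) = (\<Sum>y'\<in>Y. if y' = y then w (1, 0, y') else 0)"
      by (rule sum.reindex_bij_witness[of _ "\<lambda>y. (1, 0, y)" "\<lambda>i. snd (snd i)"])
         (use that fin in \<open>auto simp: a_def\<close>)
    also have "\<dots> = \<psi> y" using that fin by (simp add: \<psi>_def)
    also have "(\<Sum>i\<in>{2} \<times> X \<times> {0}. w i * a i ?u) = (\<Sum>x'\<in>X. if x' = x then w (2, x', 0) * y else 0)"
      by (rule sum.reindex_bij_witness[of _ "\<lambda>x. (2, x, 0)" "\<lambda>i. fst (snd i)"])
         (auto simp: a2)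
    also have "\<dots> = \<Delta> x * y" using that fin by (simp add: \<Delta>_def)
    also have "(\<Sum>i\<in>I. w i * a i ?u) = (\<Sum>p\<in>X \<times> Y - G. if p = (x, y) then w (3, x, y) else 0)"
      unfolding I_def by (rule sum.reindex_bij_witness[of _ "\<lambda>p. (3, p)" snd]) (auto simp: a_def)
    also have "\<dots> = (if (x, y) \<in> G then 0 else w (3, x, y))"
      using that fin assms(1) by (auto simp: sum.delta)
    finally show ?thesis by simp
  qed
  have "potentials c G \<phi> \<psi> \<Delta>"
    unfolding potentials_def X_def[symmetric] Y_def[symmetric]
  proof (intro conjI ballI)
    show "case p of (x, y) \<Rightarrow> \<phi> x + \<psi> y + \<Delta> x * y = c (x, y)" if "p \<in> G" for p
      using that GXY main by (cases p) auto
    show "\<phi> x + \<psi> y + \<Delta> x * y \<le> c (x, y)" if "x \<in> X" "y \<in> Y" for x y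
      using main[OF that] w[of "(3, x, y)"] that by (auto simp: I_def split: if_splits)
  qed
  then show ?thesis by blast
qed

section \<open>Potentials on infinite sets\<close>

text \<open>One finite \<open>H\<close> and one bound \<open>B\<close> serve for all potentials on
  \<open>H\<close>, hence for the potentials on every larger set. This uniformity is what the
  compactness argument needs.\<close>

definition linked :: "(real \<times> real \<Rightarrow> real) \<Rightarrow> (real \<times> real) set \<Rightarrow> real \<Rightarrow> real \<Rightarrow> bool" where
  "linked c G x x' \<longleftrightarrow>
     (\<exists>H B. finite H \<and> H \<subseteq> G \<and> (\<forall>\<phi> \<psi> \<Delta>. potentials c H \<phi> \<psi> \<Delta> \<longrightarrow>
        \<bar>\<phi> x - \<phi> x'\<bar> \<le> B \<and> \<bar>\<Delta> x - \<Delta> x'\<bar> \<le> B))"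

lemma linked_refl: "linked c G x x"
  unfolding linked_def by (rule exI[of _ "{}"]) auto

lemma linked_trans:
  assumes "linked c G x y" "linked c G y z"
  shows "linked c G x z"
proof -
  obtain H B where H: "finite H" "H \<subseteq> G"
    "\<And>\<phi> \<psi> \<Delta>. potentials c H \<phi> \<psi> \<Delta> \<Longrightarrow> \<bar>\<phi> x - \<phi> y\<bar> \<le> B \<and> \<bar>\<Delta> x - \<Delta> y\<bar> \<le> B"
    using assms(1) unfolding linked_def by blast
  obtain H' B' where H': "finite H'" "H' \<subseteq> G"
    "\<And>\<phi> \<psi> \<Delta>. potentials c H' \<phi> \<psi> \<Delta> \<Longrightarrow> \<bar>\<phi> y - \<phi> z\<bar> \<le> B' \<and> \<bar>\<Delta> y - \<Delta> z\<bar> \<le> B'"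
    using assms(2) unfolding linked_def by blast
  have "\<bar>\<phi> x - \<phi> z\<bar> \<le> B + B' \<and> \<bar>\<Delta> x - \<Delta> z\<bar> \<le> B + B'" if "potentials c (H \<union> H') \<phi> \<psi> \<Delta>" for \<phi> \<psi> \<Delta>
    using H(3)[of \<phi> \<psi> \<Delta>] H'(3)[of \<phi> \<psi> \<Delta>] potentials_subset[OF that, of H] potentials_subset[OF that, of H']
    by auto
  then show ?thesis
    unfolding linked_def using H H' by (intro exI[of _ "H \<union> H'"] exI[of _ "B + B'"]) auto
qed

text \<open>The difference of the affine functions \<open>\<phi> x + \<Delta> x * t\<close> and \<open>\<phi> x' + \<Delta> x' * t\<close> is at least
  \<open>-2C\<close> where \<open>x\<close> has contact and at most \<open>2C\<close> where \<open>x'\<close> has contact.\<close>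

lemma linked_overlap:
  assumes c: "\<And>p. \<bar>c p\<bar> \<le> C"
    and G: "(x, y1) \<in> G" "(x, y2) \<in> G" "(x', z1) \<in> G" "(x', z2) \<in> G"
    and less: "y1 < z2" "z1 < y2"
  shows "linked c G x x'"
proof -
  \<comment> \<open>The difference of the two affine functions is at least \<open>-2C\<close> at
    \<open>y1\<close>, \<open>y2\<close> and at most \<open>2C\<close> at \<open>z1\<close>,
    \<open>z2\<close>. Comparing \<open>y1\<close> with \<open>z2\<close> bounds its slope above,
    comparing \<open>z1\<close> with \<open>y2\<close> bounds it below; \<open>B\<close> then bounds
    the intercept through the values at \<open>z2\<close> and \<open>y1\<close>.\<close>
  define S where "S = 4 * C / (z2 - y1) + 4 * C / (y2 - z1)"
  define B where "B = 2 * C + S * \<bar>z2\<bar> + S * \<bar>y1\<bar>"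
  have C: "0 \<le> C" using c[of undefined] by linarith
  then have S: "0 \<le> S" using less by (simp add: S_def)
  have "\<bar>\<phi> x - \<phi> x'\<bar> \<le> S + B \<and> \<bar>\<Delta> x - \<Delta> x'\<bar> \<le> S + B"
    if pot: "potentials c {(x, y1), (x, y2), (x', z1), (x', z2)} \<phi> \<psi> \<Delta>" for \<phi> \<psi> \<Delta>
  proof -
    let ?d = "\<phi> x - \<phi> x'" and ?s = "\<Delta> x - \<Delta> x'"
    have eq: "\<phi> x + \<psi> y1 + \<Delta> x * y1 = c (x, y1)" "\<phi> x + \<psi> y2 + \<Delta> x * y2 = c (x, y2)"
      "\<phi> x' + \<psi> z1 + \<Delta> x' * z1 = c (x', z1)" "\<phi> x' + \<psi> z2 + \<Delta> x' * z2 = c (x', z2)"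
      and le: "\<phi> x + \<psi> z1 + \<Delta> x * z1 \<le> c (x, z1)" "\<phi> x + \<psi> z2 + \<Delta> x * z2 \<le> c (x, z2)"
      "\<phi> x' + \<psi> y1 + \<Delta> x' * y1 \<le> c (x', y1)" "\<phi> x' + \<psi> y2 + \<Delta> x' * y2 \<le> c (x', y2)"
      using pot by (auto simp: potentials_def)
    have d: "- 2 * C \<le> ?d + ?s * y1" "- 2 * C \<le> ?d + ?s * y2" "?d + ?s * z1 \<le> 2 * C" "?d + ?s * z2 \<le> 2 * C"
      using eq le c[of "(x, y1)"] c[of "(x, y2)"] c[of "(x', z1)"] c[of "(x', z2)"]
        c[of "(x, z1)"] c[of "(x, z2)"] c[of "(x', y1)"] c[of "(x', y2)"]
      by (auto simp: algebra_simps abs_le_iff)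
    have "?s * (z2 - y1) \<le> 4 * C" using d(1,4) by (simp add: algebra_simps)
    then have s1: "?s \<le> 4 * C / (z2 - y1)" using less by (simp add: field_simps)
    have "- ?s * (y2 - z1) \<le> 4 * C" using d(2,3) by (simp add: algebra_simps)
    then have s2: "- ?s \<le> 4 * C / (y2 - z1)" using less by (simp add: pos_le_divide_eq)
    have "0 \<le> 4 * C / (z2 - y1)" "0 \<le> 4 * C / (y2 - z1)" using C less by auto
    then have s: "\<bar>?s\<bar> \<le> S" using s1 s2 unfolding S_def by linarith
    have "\<bar>?s * z2\<bar> \<le> S * \<bar>z2\<bar>" "\<bar>?s * y1\<bar> \<le> S * \<bar>y1\<bar>"
      unfolding abs_mult using s by (auto intro!: mult_right_mono)
    moreover have "0 \<le> S * \<bar>z2\<bar>" "0 \<le> S * \<bar>y1\<bar>" using S by auto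
    ultimately have "\<bar>?d\<bar> \<le> B" using d(1,4) unfolding B_def by linarith
    moreover have "0 \<le> B" using C S by (simp add: B_def)
    ultimately show ?thesis using s S by linarith
  qed
  then show ?thesis
    unfolding linked_def using G
    by (intro exI[of _ "{(x, y1), (x, y2), (x', z1), (x', z2)}"] exI[of _ "S + B"]) auto
qed

text \<open>Gauge freedom: an affine function of \<open>y\<close> can be moved from all the
  \<open>\<phi> x + \<Delta> x * y\<close> into \<open>\<psi>\<close>. Here it is chosen so that the
  affine function of \<open>x0\<close> vanishes.\<close>

lemma potentials_normalize:
  assumes "potentials c H \<phi> \<psi> \<Delta>"
  shows "potentials c H (\<lambda>x. \<phi> x - \<phi> x0) (\<lambda>y. \<psi> y + \<phi> x0 + \<Delta> x0 * y) (\<lambda>x. \<Delta> x - \<Delta> x0)"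
  using assms unfolding potentials_def by (simp add: algebra_simps split: prod.splits)

lemma compact_box: "compact {p :: 'a \<Rightarrow> real. \<forall>i. \<bar>p i\<bar> \<le> b i}"
proof -
  have "compactin (product_topology (\<lambda>i. euclidean) UNIV) (PiE UNIV (\<lambda>i::'a. {- b i .. b i}))"
    unfolding compactin_PiE by simp
  moreover have "PiE UNIV (\<lambda>i. {- b i .. b i}) = {p. \<forall>i. \<bar>p i\<bar> \<le> b i}"
    by (simp add: PiE_UNIV_domain Pi_def abs_le_iff minus_le_iff conj_commute)
  ultimately show ?thesis by (simp only: euclidean_product_topology compactin_euclidean_iff)
qed

text \<open>Finite intersection property in a product of intervals. After normalization at
  \<open>x0\<close>, linkedness bounds \<open>\<phi>\<close> and \<open>\<Delta>\<close>
  independently of the finite subset, and equality at a contact point \<open>(w y, y)\<close> then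
  bounds \<open>\<psi> y\<close>. Each condition on the potentials is closed and involves finitely
  many coordinates.\<close>

lemma potentials_exist:
  assumes fin: "\<And>H. finite H \<Longrightarrow> H \<subseteq> G \<Longrightarrow> \<exists>\<phi> \<psi> \<Delta>. potentials c H \<phi> \<psi> \<Delta>"
    and linked: "\<And>x. x \<in> fst ` G \<Longrightarrow> linked c G x x0"
  shows "\<exists>\<phi> \<psi> \<Delta>. potentials c G \<phi> \<psi> \<Delta>"
proof -
  obtain H B where HB: "\<And>x. x \<in> fst ` G \<Longrightarrow> finite (H x) \<and> H x \<subseteq> G \<and>
     (\<forall>\<phi> \<psi> \<Delta>. potentials c (H x) \<phi> \<psi> \<Delta> \<longrightarrow> \<bar>\<phi> x - \<phi> x0\<bar> \<le> B x \<and> \<bar>\<Delta> x - \<Delta> x0\<bar> \<le> B x)"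
    using linked unfolding linked_def by metis
  have "\<forall>y\<in>snd ` G. \<exists>x. (x, y) \<in> G" by force
  then obtain w where w: "\<And>y. y \<in> snd ` G \<Longrightarrow> (w y, y) \<in> G" by metis
  \<comment> \<open>A triple of potentials is stored as one function, with \<open>\<phi>\<close>,
    \<open>\<Delta>\<close>, \<open>\<psi>\<close> under the tags 0, 1, 2. The absolute values
    around \<open>B\<close> keep the box nonempty where \<open>B\<close> is arbitrary.\<close>
  define b :: "real \<times> nat \<Rightarrow> real" where
    "b = (\<lambda>(t, k). if k = 2 then \<bar>c (w t, t)\<bar> + \<bar>B (w t)\<bar> + \<bar>B (w t)\<bar> * \<bar>t\<bar> else \<bar>B t\<bar>)"
  have b0: "0 \<le> b i" for i by (cases i) (auto simp: b_def)
  \<comment> \<open>A pair of contact points contributes the equality at the first one and the grid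
    inequality at the mixed point \<open>(x, y')\<close>.\<close>
  define F :: "(real \<times> real) \<times> (real \<times> real) \<Rightarrow> (real \<times> nat \<Rightarrow> real) set" where
    "F = (\<lambda>((x, y), (x', y')).
      {p. p (x, 0) + p (y', 2) + p (x, 1) * y' \<le> c (x, y')} \<inter>
      {p. p (x, 0) + p (y, 2) + p (x, 1) * y = c (x, y)})"
  have "{p. \<forall>i. \<bar>p i\<bar> \<le> b i} \<inter> (\<Inter>g\<in>G \<times> G. F g) \<noteq> {}"
  proof (rule compact_imp_fip_image[OF compact_box])
    show "closed (F g)" for g
      by (cases g) (auto simp: F_def intro!: closed_Int closed_Collect_le closed_Collect_eq continuous_intros)
    fix I assume I: "finite I" "I \<subseteq> G \<times> G"
    define A where "A = fst ` I \<union> snd ` I"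
    have A: "finite A" "A \<subseteq> G" using I by (auto simp: A_def)
    \<comment> \<open>\<open>A\<close> alone does not force the bounds of the box. \<open>Q\<close>
      adds the finite sets responsible for them and, for each second coordinate, the chosen contact
      point.\<close>
    define Q where "Q = A \<union> (\<Union>g\<in>A. H (fst g)) \<union> (\<Union>g\<in>A. insert (w (snd g), snd g) (H (w (snd g))))"
    have wA: "(w (snd g), snd g) \<in> G" if "g \<in> A" for g
      using w A that by blast
    have wA': "w (snd g) \<in> fst ` G" if "g \<in> A" for g
      using wA[OF that] by force
    have "finite Q"
      unfolding Q_def using A HB wA' by (auto intro!: finite_UN_I)
    moreover have "Q \<subseteq> G"
      unfolding Q_def using A HB wA wA' by blast
    ultimately obtain \<phi>0 \<psi>0 \<Delta>0 where "potentials c Q \<phi>0 \<psi>0 \<Delta>0" using fin by blast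
    from potentials_normalize[OF this, of x0]
    obtain \<phi> \<psi> \<Delta> where pot: "potentials c Q \<phi> \<psi> \<Delta>" and norm: "\<phi> x0 = 0" "\<Delta> x0 = 0"
      by force
    have bnd: "\<bar>\<phi> x\<bar> \<le> B x \<and> \<bar>\<Delta> x\<bar> \<le> B x" if "x \<in> fst ` G" "H x \<subseteq> Q" for x
      using HB[OF that(1)] potentials_subset[OF pot that(2)] norm by fastforce
    have bnd1: "\<bar>\<phi> (fst g)\<bar> \<le> B (fst g) \<and> \<bar>\<Delta> (fst g)\<bar> \<le> B (fst g)" if "g \<in> A" for g
      using that A by (intro bnd) (auto simp: Q_def)
    have bnd2: "\<bar>\<psi> (snd g)\<bar> \<le> b (snd g, 2)" if "g \<in> A" for g
    proof -
      let ?y = "snd g" let ?x = "w ?y"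
      have 1: "\<bar>\<phi> ?x\<bar> \<le> B ?x \<and> \<bar>\<Delta> ?x\<bar> \<le> B ?x"
        using that wA' by (intro bnd) (auto simp: Q_def)
      have "(?x, ?y) \<in> Q" using that by (auto simp: Q_def)
      then have "\<phi> ?x + \<psi> ?y + \<Delta> ?x * ?y = c (?x, ?y)" using pot by (auto simp: potentials_def)
      moreover have "\<bar>\<Delta> ?x * ?y\<bar> \<le> \<bar>B ?x\<bar> * \<bar>?y\<bar>"
        unfolding abs_mult using 1 by (intro mult_right_mono) auto
      ultimately show ?thesis using 1 unfolding b_def by simp linarith
    qed
    \<comment> \<open>Coordinates that \<open>A\<close> does not involve are set to 0, as nothing
      bounds the potentials there.\<close>
    define p :: "real \<times> nat \<Rightarrow> real" where
      "p = (\<lambda>(t, k). if k = 2 then (if t \<in> snd ` A then \<psi> t else 0)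
         else if k = 0 then (if t \<in> fst ` A then \<phi> t else 0)
         else (if t \<in> fst ` A then \<Delta> t else 0))"
    have "\<bar>p i\<bar> \<le> b i" for i
    proof (cases i)
      case (Pair t k)
      then show ?thesis
        using bnd1 bnd2 b0[of i] by (fastforce simp: p_def b_def)
    qed
    moreover have "p \<in> F g" if "g \<in> I" for g
    proof -
      obtain x y x' y' where g: "g = ((x, y), (x', y'))" by (metis surj_pair)
      have "(x, y) \<in> A" "(x', y') \<in> A" using that g by (force simp: A_def)+
      then have A': "x \<in> fst ` A" "y \<in> snd ` A" "y' \<in> snd ` A"
        and Q: "(x, y) \<in> Q" "x \<in> fst ` Q" "y' \<in> snd ` Q"
        by (force simp: Q_def)+
      have "\<phi> x + \<psi> y + \<Delta> x * y = c (x, y)" "\<phi> x + \<psi> y' + \<Delta> x * y' \<le> c (x, y')"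
        using pot Q unfolding potentials_def by blast+
      then show ?thesis
        using A' by (simp add: g F_def p_def)
    qed
    ultimately show "{p. \<forall>i. \<bar>p i\<bar> \<le> b i} \<inter> (\<Inter>g\<in>I. F g) \<noteq> {}" by blast
  qed
  then obtain p where p: "\<And>g. g \<in> G \<times> G \<Longrightarrow> p \<in> F g" by blast
  have "potentials c G (\<lambda>x. p (x, 0)) (\<lambda>y. p (y, 2)) (\<lambda>x. p (x, 1))"
    unfolding potentials_def using p by (fastforce simp: F_def)
  then show ?thesis by blast
qed

section \<open>Finitely supported competitors\<close>

lemma borel_measurable_fst_snd [measurable]:
  "(fst :: real \<times> real \<Rightarrow> real) \<in> borel_measurable borel"
  "(snd :: real \<times> real \<Rightarrow> real) \<in> borel_measurable borel"
  by (simp_all flip: borel_prod)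

text \<open>The locations \<open>X i\<close> need not be distinct and may live in another space than
  the indices, so points of the plane can index both a measure on the plane and, with
  \<open>X = snd\<close>, a kernel on the line.\<close>

definition discrete_measure :: "'i set \<Rightarrow> ('i \<Rightarrow> real) \<Rightarrow> ('i \<Rightarrow> 'b::topological_space) \<Rightarrow> 'b measure" where
  "discrete_measure S f X = distr (point_measure S (\<lambda>i. ennreal (f i))) borel X"

lemma sets_discrete_measure [simp, measurable_cong]: "sets (discrete_measure S f X) = sets borel"
  by (simp add: discrete_measure_def)

lemma space_discrete_measure [simp]: "space (discrete_measure S f X) = UNIV"
  by (simp add: discrete_measure_def)

lemma nn_integral_discrete_measure:
  assumes "finite S" "h \<in> borel_measurable borel"
  shows "(\<integral>\<^sup>+ x. h x \<partial>discrete_measure S f X) = (\<Sum>i\<in>S. ennreal (f i) * h (X i))"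
  unfolding discrete_measure_def using assms
  by (subst nn_integral_distr)
     (auto simp: nn_integral_point_measure_finite mult.commute intro!: measurable_point_measure_eq1[THEN iffD2])

lemma emeasure_discrete_measure:
  assumes "finite S" "A \<in> sets borel"
  shows "emeasure (discrete_measure S f X) A = (\<Sum>i\<in>S. ennreal (f i) * indicator A (X i))"
  using nn_integral_discrete_measure[OF assms(1), of "indicator A" f X] assms(2) by simp

lemma finite_measure_discrete_measure:
  "finite S \<Longrightarrow> finite_measure (discrete_measure S f X)"
  by (rule finite_measureI) (simp add: emeasure_discrete_measure)

lemma has_bochner_integral_discrete_measure:
  fixes h :: "'b::topological_space \<Rightarrow> real"
  assumes "finite S" "\<And>i. i \<in> S \<Longrightarrow> 0 \<le> f i" "h \<in> borel_measurable borel"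
  shows "has_bochner_integral (discrete_measure S f X) h (\<Sum>i\<in>S. f i * h (X i))"
proof -
  have "integrable (point_measure S (\<lambda>i. ennreal (f i))) (\<lambda>i. h (X i))"
    using assms(1) by (rule integrable_point_measure_finite)
  moreover have "(\<integral>i. h (X i) \<partial>point_measure S (\<lambda>i. ennreal (f i))) = (\<Sum>i\<in>S. f i * h (X i))"
    using assms(1,2) by (subst lebesgue_integral_point_measure_finite) auto
  ultimately show ?thesis
    unfolding discrete_measure_def has_bochner_integral_iff using assms(3)
    by (simp add: integrable_distr_eq integral_distr measurable_point_measure_eq1)
qed

lemma sum_fibers:
  "finite S \<Longrightarrow> (\<Sum>p\<in>S. h p) = (\<Sum>x\<in>fst ` S. \<Sum>p\<in>{p \<in> S. fst p = x}. h p)"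
  for h :: "'a \<times> 'b \<Rightarrow> 'c::comm_monoid_add"
  by (rule sum.image_gen)

text \<open>Fibres without mass get the point mass at 0, so that every value is a probability
  measure.\<close>

definition discrete_kernel :: "(real \<times> real) set \<Rightarrow> (real \<times> real \<Rightarrow> real) \<Rightarrow> real \<Rightarrow> real measure" where
  "discrete_kernel S f x =
     (let m = \<Sum>p\<in>{p \<in> S. fst p = x}. f p
      in if 0 < m then discrete_measure {p \<in> S. fst p = x} (\<lambda>p. f p / m) snd else return borel 0)"

text \<open>The kernel is measurable because it differs from the constant
  \<open>return borel 0\<close> only at finitely many \<open>x\<close>. In a fibre of total weight 0
  all weights vanish, so the default value does not affect the identity.\<close>

lemma disintegration_discrete_kernel:
  assumes S: "finite S" and f: "\<And>p. p \<in> S \<Longrightarrow> 0 \<le> f p"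
  shows "disintegration (discrete_measure S f (\<lambda>p. p)) (distr (discrete_measure S f (\<lambda>p. p)) borel fst)
           (discrete_kernel S f)"
proof -
  let ?T = "\<lambda>x. {p \<in> S. fst p = x}"
  let ?m = "\<lambda>x. \<Sum>p\<in>?T x. f p"
  have T: "finite (?T x)" for x using S by simp
  have m0: "0 \<le> ?m x" for x using f by (auto intro: sum_nonneg)
  have K: "discrete_kernel S f \<in> borel \<rightarrow>\<^sub>M prob_algebra borel"
  proof (rule measurable_discrete_difference[where f="\<lambda>x. return borel (0::real)" and X="fst ` S"])
    show "(\<lambda>x. return borel (0::real)) \<in> borel \<rightarrow>\<^sub>M prob_algebra borel"
      by (intro measurable_const) (simp add: space_prob_algebra prob_space_return)
    show "countable (fst ` S)" using S by (simp add: countable_finite)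
    show "discrete_kernel S f x \<in> space (prob_algebra borel)" if "x \<in> fst ` S" for x
    proof (cases "0 < ?m x")
      case True
      have "emeasure (discrete_measure (?T x) (\<lambda>p. f p / ?m x) snd) UNIV = (\<Sum>p\<in>?T x. ennreal (f p / ?m x))"
        using T by (simp add: emeasure_discrete_measure)
      also have "\<dots> = ennreal (\<Sum>p\<in>?T x. f p / ?m x)"
        using f True by (intro sum_ennreal) auto
      also have "(\<Sum>p\<in>?T x. f p / ?m x) = 1"
        using True by (simp flip: sum_divide_distrib)
      finally show ?thesis using True
        by (auto simp: space_prob_algebra discrete_kernel_def Let_def intro!: prob_spaceI)
    next
      case False
      then show ?thesis by (simp add: space_prob_algebra discrete_kernel_def Let_def prob_space_return)
    qed
    show "return borel 0 = discrete_kernel S f x" if "x \<in> space borel" "x \<notin> fst ` S" for x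
    proof -
      have "?T x = {}" using that by force
      then have "?m x = 0" by (simp only: sum.empty)
      then show ?thesis by (simp add: discrete_kernel_def Let_def)
    qed
  qed (auto)
  have "emeasure (discrete_measure S f (\<lambda>p. p)) (A \<times> B) =
      (\<integral>\<^sup>+ x \<in> A. emeasure (discrete_kernel S f x) B \<partial>distr (discrete_measure S f (\<lambda>p. p)) borel fst)"
    if A[measurable]: "A \<in> sets borel" and B[measurable]: "B \<in> sets borel" for A B
  proof -
    have [measurable]: "(\<lambda>x. emeasure (discrete_kernel S f x) B) \<in> borel_measurable borel"
      using measurable_prob_algebraD[OF K] by measurable
    have "(\<integral>\<^sup>+ x \<in> A. emeasure (discrete_kernel S f x) B \<partial>distr (discrete_measure S f (\<lambda>p. p)) borel fst) =
        (\<integral>\<^sup>+ p. emeasure (discrete_kernel S f (fst p)) B * indicator A (fst p) \<partial>discrete_measure S f (\<lambda>p. p))"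
      by (subst nn_integral_distr) (auto simp: measurable_cong_sets[OF sets_discrete_measure refl])
    also have "\<dots> = (\<Sum>p\<in>S. ennreal (f p) * (emeasure (discrete_kernel S f (fst p)) B * indicator A (fst p)))"
      using S by (subst nn_integral_discrete_measure) (auto simp: borel_prod[symmetric])
    also have "\<dots> = (\<Sum>x\<in>fst ` S. \<Sum>p\<in>?T x. ennreal (f p) * (emeasure (discrete_kernel S f x) B * indicator A x))"
      unfolding sum_fibers[OF S] by (intro sum.cong) auto
    also have "\<dots> = (\<Sum>x\<in>fst ` S. \<Sum>p\<in>?T x. ennreal (f p) * indicator (A \<times> B) p)"
    proof (rule sum.cong[OF refl])
      fix x
      have "(\<Sum>p\<in>?T x. ennreal (f p) * (emeasure (discrete_kernel S f x) B * indicator A x)) =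
          ennreal (?m x) * emeasure (discrete_kernel S f x) B * indicator A x"
        using f by (subst sum_ennreal[symmetric]) (auto simp: sum_distrib_right mult.assoc)
      also have "ennreal (?m x) * emeasure (discrete_kernel S f x) B = (\<Sum>p\<in>?T x. ennreal (f p) * indicator B (snd p))"
      proof (cases "0 < ?m x")
        case True
        have "ennreal (?m x) * emeasure (discrete_kernel S f x) B =
            (\<Sum>p\<in>?T x. ennreal (?m x) * (ennreal (f p / ?m x) * indicator B (snd p)))"
          unfolding discrete_kernel_def Let_def if_P[OF True] emeasure_discrete_measure[OF T B] sum_distrib_left ..
        also have "\<dots> = (\<Sum>p\<in>?T x. ennreal (f p) * indicator B (snd p))"
          using True f by (intro sum.cong refl) (simp add: mult.assoc[symmetric] ennreal_mult'[symmetric])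
        finally show ?thesis .
      next
        case False
        then have m: "?m x = 0" using m0[of x] by linarith
        then have "\<forall>p\<in>?T x. f p = 0" using f T by (subst (asm) sum_nonneg_eq_0_iff) auto
        then have "(\<Sum>p\<in>?T x. ennreal (f p) * indicator B (snd p)) = 0" by (intro sum.neutral) simp
        then show ?thesis by (simp only: m ennreal_0 mult_zero_left)
      qed
      also have "\<dots> * indicator A x = (\<Sum>p\<in>?T x. ennreal (f p) * indicator (A \<times> B) p)"
        unfolding sum_distrib_right by (intro sum.cong refl) (auto simp: indicator_def)
      finally show "(\<Sum>p\<in>?T x. ennreal (f p) * (emeasure (discrete_kernel S f x) B * indicator A x)) =
        (\<Sum>p\<in>?T x. ennreal (f p) * indicator (A \<times> B) p)" .
    qed
    also have "\<dots> = emeasure (discrete_measure S f (\<lambda>p. p)) (A \<times> B)"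
      using S by (subst emeasure_discrete_measure) (auto simp: sum_fibers[OF S] borel_prod[symmetric])
    finally show ?thesis ..
  qed
  with K show ?thesis by (simp add: disintegration_def)
qed

text \<open>In a fibre of weight 0 the quotient is 0 by the convention for division by 0, and this
  is the mean of the default \<open>return borel 0\<close>. Hence one formula holds for every
  \<open>x\<close>.\<close>

lemma has_bochner_integral_discrete_kernel:
  assumes "finite S" "\<And>p. p \<in> S \<Longrightarrow> 0 \<le> f p"
  shows "has_bochner_integral (discrete_kernel S f x) (\<lambda>y. y)
    ((\<Sum>p\<in>{p \<in> S. fst p = x}. f p * snd p) / (\<Sum>p\<in>{p \<in> S. fst p = x}. f p))"
proof (cases "0 < (\<Sum>p\<in>{p \<in> S. fst p = x}. f p)")
  case True
  then show ?thesis
    using has_bochner_integral_discrete_measure[of "{p \<in> S. fst p = x}"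
        "\<lambda>p. f p / (\<Sum>p\<in>{p \<in> S. fst p = x}. f p)" "\<lambda>y. y" snd] assms
    by (simp add: discrete_kernel_def Let_def sum_divide_distrib)
next
  case False
  then have "(\<Sum>p\<in>{p \<in> S. fst p = x}. f p) = 0"
    using assms by (intro antisym) (auto intro: sum_nonneg)
  then show ?thesis
    by (simp add: discrete_kernel_def has_bochner_integral_iff integral_return integrable_iff_bounded nn_integral_return)
qed

text \<open>Finite optimality restated for weights. \<open>S\<close> may leave
  \<open>\<Gamma>\<close>: only the atoms of positive \<open>f\<close>-weight must lie in it,
  because the support consists of such atoms.\<close>

lemma finitely_optimal_sum_le:
  assumes opt: "finitely_optimal c \<Gamma>" and c: "c \<in> borel_measurable borel" and S: "finite S"
    and f: "\<And>p. p \<in> S \<Longrightarrow> 0 \<le> f p" and g: "\<And>p. p \<in> S \<Longrightarrow> 0 \<le> g p"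
    and \<Gamma>: "\<And>p. p \<in> S \<Longrightarrow> 0 < f p \<Longrightarrow> p \<in> \<Gamma>"
    and fst_eq: "\<And>x. (\<Sum>p\<in>{p \<in> S. fst p = x}. f p) = (\<Sum>p\<in>{p \<in> S. fst p = x}. g p)"
    and snd_eq: "\<And>y. (\<Sum>p\<in>{p \<in> S. snd p = y}. f p) = (\<Sum>p\<in>{p \<in> S. snd p = y}. g p)"
    and bary_eq: "\<And>x. (\<Sum>p\<in>{p \<in> S. fst p = x}. f p * snd p) = (\<Sum>p\<in>{p \<in> S. fst p = x}. g p * snd p)"
  shows "(\<Sum>p\<in>S. f p * c p) \<le> (\<Sum>p\<in>S. g p * c p)"
proof -
  let ?\<alpha> = "discrete_measure S f (\<lambda>p. p)" and ?\<beta> = "discrete_measure S g (\<lambda>p. p)"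
  have distr: "distr ?\<beta> borel q = distr ?\<alpha> borel q"
    if q: "q \<in> borel \<rightarrow>\<^sub>M borel"
      and eq: "\<And>t. (\<Sum>p\<in>{p \<in> S. q p = t}. f p) = (\<Sum>p\<in>{p \<in> S. q p = t}. g p)"
    for q :: "real \<times> real \<Rightarrow> real"
  proof (rule measure_eqI)
    fix A assume "A \<in> sets (distr ?\<beta> borel q)"
    then have A: "A \<in> sets borel" by simp
    have *: "emeasure (distr (discrete_measure S h (\<lambda>p. p)) borel q) A =
        (\<Sum>t\<in>q ` S. ennreal (\<Sum>p\<in>{p \<in> S. q p = t}. h p) * indicator A t)"
      if "\<And>p. p \<in> S \<Longrightarrow> 0 \<le> h p" for h
    proof -
      have "emeasure (distr (discrete_measure S h (\<lambda>p. p)) borel q) A =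
          (\<Sum>p\<in>S. ennreal (h p) * indicator A (q p))"
        using A q S measurable_sets[OF q A]
        by (subst emeasure_distr) (auto simp: emeasure_discrete_measure measurable_def indicator_def intro!: sum.cong)
      also have "\<dots> = (\<Sum>t\<in>q ` S. \<Sum>p\<in>{p \<in> S. q p = t}. ennreal (h p) * indicator A (q p))"
        by (rule sum.image_gen[OF S])
      also have "\<dots> = (\<Sum>t\<in>q ` S. (\<Sum>p\<in>{p \<in> S. q p = t}. ennreal (h p)) * indicator A t)"
        unfolding sum_distrib_right by (intro sum.cong) auto
      also have "\<dots> = (\<Sum>t\<in>q ` S. ennreal (\<Sum>p\<in>{p \<in> S. q p = t}. h p) * indicator A t)"
        using that by (intro sum.cong refl arg_cong2[where f="(*)"] sum_ennreal) auto
      finally show ?thesis .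
    qed
    show "emeasure (distr ?\<beta> borel q) A = emeasure (distr ?\<alpha> borel q) A"
      by (simp only: *[OF f] *[OF g] eq)
  qed simp
  have fst: "distr ?\<beta> borel fst = distr ?\<alpha> borel fst" and snd: "distr ?\<beta> borel snd = distr ?\<alpha> borel snd"
    by (intro distr borel_measurable_fst_snd fst_eq snd_eq)+
  have "competitor ?\<alpha> ?\<beta>"
    unfolding competitor_def
  proof (intro conjI exI fst snd)
    show "integrable ?\<alpha> snd"
      using has_bochner_integral_discrete_measure[OF S f, where h=snd and X="\<lambda>p. p"]
      by (auto simp: has_bochner_integral_iff)
    show "disintegration ?\<alpha> (distr ?\<alpha> borel fst) (discrete_kernel S f)"
      by (rule disintegration_discrete_kernel[OF S f])
    show "disintegration ?\<beta> (distr ?\<alpha> borel fst) (discrete_kernel S g)"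
      using disintegration_discrete_kernel[where f=g, OF S g] unfolding fst .
    show "AE x in distr ?\<alpha> borel fst.
       integrable (discrete_kernel S f x) (\<lambda>y. y) \<and> integrable (discrete_kernel S g x) (\<lambda>y. y) \<and>
       (\<integral>y. y \<partial>discrete_kernel S f x) = (\<integral>y. y \<partial>discrete_kernel S g x)"
      using has_bochner_integral_discrete_kernel[where f=f, OF S f]
        has_bochner_integral_discrete_kernel[where f=g, OF S g]
      unfolding has_bochner_integral_iff by (simp add: fst_eq bary_eq)
  qed auto
  \<comment> \<open>A finite set is closed, so the complement of the atoms is an open null
    set.\<close>
  moreover have "spt ?\<alpha> \<subseteq> {p \<in> S. 0 < f p}"
  proof
    fix q assume q: "q \<in> spt ?\<alpha>"
    show "q \<in> {p \<in> S. 0 < f p}"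
    proof (rule ccontr)
      assume "q \<notin> {p \<in> S. 0 < f p}"
      moreover have op: "open (- {p \<in> S. 0 < f p})"
        using S by (intro open_Compl finite_imp_closed) auto
      moreover have "emeasure ?\<alpha> (- {p \<in> S. 0 < f p}) = 0"
        using S op by (subst emeasure_discrete_measure) (auto intro!: sum.neutral simp: indicator_def ennreal_neg)
      ultimately show False using q by (auto simp: spt_def)
    qed
  qed
  ultimately have "(\<integral>z. c z \<partial>?\<alpha>) \<le> (\<integral>z. c z \<partial>?\<beta>)"
    using opt S \<Gamma> finite_measure_discrete_measure[OF S, of f "\<lambda>p. p"] unfolding finitely_optimal_def
    by (metis (no_types, lifting) finite_subset mem_Collect_eq rev_finite_subset sets_discrete_measure subset_iff)
  then show ?thesis
    using has_bochner_integral_discrete_measure[OF S f c] has_bochner_integral_discrete_measure[OF S g c]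
    by (auto simp: has_bochner_integral_iff)
qed

text \<open>For a direction \<open>h\<close>, the negative part serves as \<alpha> and the positive
  part as its competitor. As \<open>h\<close> is nonnegative off \<open>G\<close>, the negative part
  lives on \<open>G\<close> and hence in \<open>\<Gamma>\<close>.\<close>

lemma finitely_optimal_potentials:
  assumes opt: "finitely_optimal c \<Gamma>" and c: "c \<in> borel_measurable borel" and G: "finite G" "G \<subseteq> \<Gamma>"
  shows "\<exists>\<phi> \<psi> \<Delta>. potentials c G \<phi> \<psi> \<Delta>"
proof (rule potentials_exist_finite[OF G(1)])
  fix h :: "real \<times> real \<Rightarrow> real"
  let ?X = "fst ` G" and ?Y = "snd ` G"
  assume h: "\<And>p. p \<in> ?X \<times> ?Y - G \<Longrightarrow> 0 \<le> h p"
    and fst0: "\<And>x. x \<in> ?X \<Longrightarrow> (\<Sum>y\<in>?Y. h (x, y)) = 0"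
    and snd0: "\<And>y. y \<in> ?Y \<Longrightarrow> (\<Sum>x\<in>?X. h (x, y)) = 0"
    and bary0: "\<And>x. x \<in> ?X \<Longrightarrow> (\<Sum>y\<in>?Y. h (x, y) * y) = 0"
  have fst_sum: "(\<Sum>p\<in>{p \<in> ?X \<times> ?Y. fst p = x}. k p) = (if x \<in> ?X then \<Sum>y\<in>?Y. k (x, y) else 0)" for x and k :: "real \<times> real \<Rightarrow> real"
  proof (cases "x \<in> ?X")
    case True
    then have "(\<Sum>p\<in>{p \<in> ?X \<times> ?Y. fst p = x}. k p) = (\<Sum>y\<in>?Y. k (x, y))"
      by (intro sum.reindex_bij_witness[of _ "\<lambda>y. (x, y)" snd]) (auto intro: rev_image_eqI)
    with True show ?thesis by simp
  next
    case False
    then have "{p \<in> ?X \<times> ?Y. fst p = x} = {}" by auto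
    with False show ?thesis by (simp only: sum.empty if_False)
  qed
  have snd_sum: "(\<Sum>p\<in>{p \<in> ?X \<times> ?Y. snd p = y}. k p) = (if y \<in> ?Y then \<Sum>x\<in>?X. k (x, y) else 0)" for y and k :: "real \<times> real \<Rightarrow> real"
  proof (cases "y \<in> ?Y")
    case True
    then have "(\<Sum>p\<in>{p \<in> ?X \<times> ?Y. snd p = y}. k p) = (\<Sum>x\<in>?X. k (x, y))"
      by (intro sum.reindex_bij_witness[of _ "\<lambda>x. (x, y)" fst]) (auto intro: rev_image_eqI)
    with True show ?thesis by simp
  next
    case False
    then have "{p \<in> ?X \<times> ?Y. snd p = y} = {}" by auto
    with False show ?thesis by (simp only: sum.empty if_False)
  qed
  let ?f = "\<lambda>p. max 0 (- h p)" and ?g = "\<lambda>p. max 0 (h p)"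
  have fg: "?f p = ?g p - h p" for p by (simp add: max_def)
  have "(\<Sum>p\<in>?X \<times> ?Y. ?f p * c p) \<le> (\<Sum>p\<in>?X \<times> ?Y. ?g p * c p)"
  proof (rule finitely_optimal_sum_le[OF opt c])
    show "finite (?X \<times> ?Y)" using G by simp
    show "p \<in> \<Gamma>" if "p \<in> ?X \<times> ?Y" "0 < ?f p" for p
      using h[of p] that G by (cases "p \<in> G") auto
    show "(\<Sum>p\<in>{p \<in> ?X \<times> ?Y. fst p = x}. ?f p) = (\<Sum>p\<in>{p \<in> ?X \<times> ?Y. fst p = x}. ?g p)" for x
      unfolding fst_sum fg using fst0 by (simp add: sum_subtractf)
    show "(\<Sum>p\<in>{p \<in> ?X \<times> ?Y. snd p = y}. ?f p) = (\<Sum>p\<in>{p \<in> ?X \<times> ?Y. snd p = y}. ?g p)" for y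
      unfolding snd_sum fg using snd0 by (simp add: sum_subtractf)
    show "(\<Sum>p\<in>{p \<in> ?X \<times> ?Y. fst p = x}. ?f p * snd p) = (\<Sum>p\<in>{p \<in> ?X \<times> ?Y. fst p = x}. ?g p * snd p)" for x
      unfolding fst_sum fg using bary0 by (simp add: sum_subtractf left_diff_distrib)
  qed auto
  then show "0 \<le> (\<Sum>p\<in>?X \<times> ?Y. c p * h p)"
    unfolding fg by (simp add: sum_subtractf algebra_simps)
qed

section \<open>Disintegration\<close>

locale disintegrated =
  fixes \<mu> :: "real measure" and \<pi> :: "(real \<times> real) measure" and K :: "real \<Rightarrow> real measure"
  assumes \<mu>: "prob_space \<mu>" "sets \<mu> = sets borel" and \<pi>: "sets \<pi> = sets borel"
    and dis: "disintegration \<pi> \<mu> K"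
begin

lemma measurable_kernel: "K \<in> borel \<rightarrow>\<^sub>M prob_algebra borel"
  using dis by (simp add: disintegration_def)

lemma prob_space_kernel: "prob_space (K x)" and sets_kernel: "sets (K x) = sets borel"
  and space_kernel: "space (K x) = UNIV"
proof -
  have "K x \<in> space (prob_algebra borel)"
    using measurable_space[OF measurable_kernel, of x] by simp
  then show "prob_space (K x)" "sets (K x) = sets borel" "space (K x) = UNIV"
    by (auto simp: space_prob_algebra dest: sets_eq_imp_space_eq)
qed

text \<open>The definition fixes the plan on rectangles only; these generate the Borel sets of the
  plane and are stable under intersection. As a monadic bind, the plan inherits the iterated
  integral for all nonnegative Borel functions.\<close>

lemma disintegration_eq_bind: "\<pi> = \<mu> \<bind> (\<lambda>x. distr (K x) borel (Pair x))"
proof -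
  have K[measurable]: "K \<in> \<mu> \<rightarrow>\<^sub>M prob_algebra borel"
    using measurable_kernel by (simp add: measurable_cong_sets[OF \<mu>(2) refl])
  have k: "(\<lambda>x. distr (K x) borel (Pair x)) \<in> \<mu> \<rightarrow>\<^sub>M prob_algebra borel"
    by (rule measurable_distr_prob_space2[OF K])
       (simp add: borel_prod[symmetric] measurable_cong_sets[OF sets_pair_measure_cong[OF \<mu>(2) refl] refl])
  have space: "space \<mu> \<noteq> {}" using prob_space.not_empty[OF \<mu>(1)] .
  have rect: "emeasure (\<mu> \<bind> (\<lambda>x. distr (K x) borel (Pair x))) (A \<times> B) = emeasure \<pi> (A \<times> B)"
    if A[measurable]: "A \<in> sets borel" and B[measurable]: "B \<in> sets borel" for A B
  proof -
    have AB: "A \<times> B \<in> sets (borel :: (real \<times> real) measure)" by (simp flip: borel_prod)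
    have "emeasure (\<mu> \<bind> (\<lambda>x. distr (K x) borel (Pair x))) (A \<times> B) =
        (\<integral>\<^sup>+x. emeasure (distr (K x) borel (Pair x)) (A \<times> B) \<partial>\<mu>)"
      using AB space measurable_prob_algebraD[OF k] by (rule emeasure_bind[rotated -1])
    also have "\<dots> = (\<integral>\<^sup>+ x \<in> A. emeasure (K x) B \<partial>\<mu>)"
    proof (rule nn_integral_cong)
      fix x
      have P: "Pair x \<in> K x \<rightarrow>\<^sub>M borel"
        by (simp add: measurable_cong_sets[OF sets_kernel refl] flip: borel_prod)
      have "Pair x -` (A \<times> B) = (if x \<in> A then B else {})" by auto
      then show "emeasure (distr (K x) borel (Pair x)) (A \<times> B) = emeasure (K x) B * indicator A x"
        by (simp add: emeasure_distr[OF P AB] space_kernel)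
    qed
    finally show ?thesis using dis that by (simp add: disintegration_def)
  qed
  let ?E = "{A \<times> B | A B. A \<in> sets (borel :: real measure) \<and> B \<in> sets (borel :: real measure)}"
  have gen: "sets (borel :: (real \<times> real) measure) = sigma_sets UNIV ?E"
    by (simp add: borel_prod[symmetric] sets_pair_measure)
  show ?thesis
  proof (rule measure_eqI_generator_eq[where E="?E" and \<Omega>=UNIV and A="\<lambda>_. UNIV"])
    show "Int_stable ?E" by (rule Int_stable_pair_measure_generator)
    show "sets \<pi> = sigma_sets UNIV ?E" unfolding \<pi> by (rule gen)
    show "sets (\<mu> \<bind> (\<lambda>x. distr (K x) borel (Pair x))) = sigma_sets UNIV ?E"
      unfolding sets_bind[of \<mu> "\<lambda>x. distr (K x) borel (Pair x)" borel, OF sets_distr space] by (rule gen)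
    show "emeasure \<pi> X = emeasure (\<mu> \<bind> (\<lambda>x. distr (K x) borel (Pair x))) X" if "X \<in> ?E" for X
      using that rect by auto
    have "(UNIV :: (real \<times> real) set) \<in> ?E"
      by (intro CollectI exI[of _ UNIV]) simp
    then show "range (\<lambda>_. UNIV) \<subseteq> ?E" by (rule image_subsetI)
    have "emeasure \<pi> (UNIV \<times> UNIV) = (\<integral>\<^sup>+ x \<in> UNIV. emeasure (K x) UNIV \<partial>\<mu>)"
      by (rule dis[unfolded disintegration_def, THEN conjunct2, rule_format]) auto
    also have "\<dots> = 1"
      using prob_space.emeasure_space_1[OF prob_space_kernel] prob_space.emeasure_space_1[OF \<mu>(1)]
      by (simp add: space_kernel)
    finally show "emeasure \<pi> UNIV \<noteq> \<infinity>" by simp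
  qed auto
qed

lemma disintegration_nn_integral:
  assumes f: "f \<in> borel_measurable borel"
  shows "(\<integral>\<^sup>+ z. f z \<partial>\<pi>) = (\<integral>\<^sup>+ x. \<integral>\<^sup>+ y. f (x, y) \<partial>K x \<partial>\<mu>)"
proof -
  have K[measurable]: "K \<in> \<mu> \<rightarrow>\<^sub>M prob_algebra borel"
    using measurable_kernel by (simp add: measurable_cong_sets[OF \<mu>(2) refl])
  have k: "(\<lambda>x. distr (K x) borel (Pair x)) \<in> \<mu> \<rightarrow>\<^sub>M prob_algebra borel"
    by (rule measurable_distr_prob_space2[OF K])
       (simp add: borel_prod[symmetric] measurable_cong_sets[OF sets_pair_measure_cong[OF \<mu>(2) refl] refl])
  have P: "Pair x \<in> K x \<rightarrow>\<^sub>M borel" for x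
    by (simp add: measurable_cong_sets[OF sets_kernel refl] flip: borel_prod)
  show ?thesis
    unfolding arg_cong[OF disintegration_eq_bind, of "\<lambda>M. nn_integral M f"]
    by (simp add: nn_integral_bind[OF f measurable_prob_algebraD[OF k]] nn_integral_distr[OF P] f)
qed

lemma measurable_kernel_nn_integral:
  assumes f: "f \<in> borel_measurable (borel :: (real \<times> real) measure)"
  shows "(\<lambda>x. \<integral>\<^sup>+ y. f (x, y) \<partial>K x) \<in> borel_measurable borel"
  by (rule nn_integral_measurable_subprob_algebra2[OF _ measurable_prob_algebraD[OF measurable_kernel]])
     (use f in \<open>simp add: borel_prod\<close>)

lemma measurable_kernel_integral:
  assumes f: "f \<in> borel_measurable (borel :: (real \<times> real) measure)"
  shows "(\<lambda>x. \<integral>y. f (x, y) \<partial>K x :: real) \<in> borel_measurable borel"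
proof -
  have P: "Pair x \<in> K x \<rightarrow>\<^sub>M borel" for x
    by (simp add: measurable_cong_sets[OF sets_kernel refl] flip: borel_prod)
  have "(\<lambda>x. distr (K x) borel (Pair x)) \<in> borel \<rightarrow>\<^sub>M prob_algebra borel"
    by (rule measurable_distr_prob_space2[OF measurable_kernel]) (simp flip: borel_prod)
  from measurable_compose[OF measurable_prob_algebraD[OF this] integral_measurable_subprob_algebra[OF f]]
  show ?thesis by (simp add: integral_distr[OF P] f)
qed

lemma measurable_fiber:
  assumes f: "f \<in> borel_measurable (borel :: (real \<times> real) measure)"
  shows "(\<lambda>y. f (x, y)) \<in> borel_measurable (K x')"
  using measurable_compose[OF measurable_Pair1'[of x borel borel] f[folded borel_prod]]
  by (simp add: measurable_cong_sets[OF sets_kernel refl])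

lemma disintegration_AE:
  assumes P: "{z. P z} \<in> sets borel" and AE: "AE z in \<pi>. P z"
  shows "AE x in \<mu>. AE y in K x. P (x, y)"
proof -
  let ?f = "indicator {z. \<not> P z} :: real \<times> real \<Rightarrow> ennreal"
  have "{z. \<not> P z} = - {z. P z}" by auto
  then have N: "{z. \<not> P z} \<in> sets borel" using P by (metis sets.compl_sets space_borel Compl_eq_Diff_UNIV)
  then have f: "?f \<in> borel_measurable borel" by simp
  have "(\<integral>\<^sup>+ z. ?f z \<partial>\<pi>) = 0"
    using AE f by (subst nn_integral_0_iff_AE) (auto simp: measurable_cong_sets[OF \<pi> refl] elim!: eventually_mono)
  then have "AE x in \<mu>. (\<integral>\<^sup>+ y. ?f (x, y) \<partial>K x) = 0"
    unfolding disintegration_nn_integral[OF f] using measurable_kernel_nn_integral[OF f]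
    by (subst (asm) nn_integral_0_iff_AE) (auto simp: measurable_cong_sets[OF \<mu>(2) refl])
  then show ?thesis
  proof eventually_elim
    case (elim x)
    then have "AE y in K x. ?f (x, y) = 0"
      by (subst (asm) nn_integral_0_iff_AE) (rule measurable_fiber[OF f])
    then show ?case by eventually_elim (auto split: split_indicator_asm)
  qed
qed

lemma disintegration_AE_I:
  assumes P: "{z. P z} \<in> sets borel" and AE: "AE x in \<mu>. AE y in K x. P (x, y)"
  shows "AE z in \<pi>. P z"
proof -
  let ?f = "indicator {z. \<not> P z} :: real \<times> real \<Rightarrow> ennreal"
  have "{z. \<not> P z} = - {z. P z}" by auto
  then have N: "{z. \<not> P z} \<in> sets borel" using P by (metis sets.compl_sets space_borel Compl_eq_Diff_UNIV)
  then have f: "?f \<in> borel_measurable borel" by simp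
  have "AE x in \<mu>. (\<integral>\<^sup>+ y. ?f (x, y) \<partial>K x) = 0"
    using AE by eventually_elim (subst nn_integral_0_iff_AE, use measurable_fiber[OF f] in auto)
  then have "(\<integral>\<^sup>+ z. ?f z \<partial>\<pi>) = 0"
    unfolding disintegration_nn_integral[OF f] using measurable_kernel_nn_integral[OF f]
    by (subst nn_integral_0_iff_AE) (auto simp: measurable_cong_sets[OF \<mu>(2) refl])
  then show ?thesis
    using f by (subst (asm) nn_integral_0_iff_AE)
      (auto simp: measurable_cong_sets[OF \<pi> refl] elim!: eventually_mono split: split_indicator_asm)
qed

text \<open>Positive and negative parts are disintegrated separately. Both fibre integrals are
  finite for almost every \<open>x\<close>, and there their difference is the Bochner integral over
  the fibre.\<close>

lemma disintegration_integral:
  fixes f :: "real \<times> real \<Rightarrow> real"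
  assumes f: "f \<in> borel_measurable borel" "integrable \<pi> f"
  shows "AE x in \<mu>. integrable (K x) (\<lambda>y. f (x, y))"
    and "has_bochner_integral \<mu> (\<lambda>x. \<integral>y. f (x, y) \<partial>K x) (\<integral>z. f z \<partial>\<pi>)"
proof -
  have pm: "(\<lambda>z. ennreal (f z)) \<in> borel_measurable borel" "(\<lambda>z. ennreal (- f z)) \<in> borel_measurable borel"
    "(\<lambda>z. ennreal (norm (f z))) \<in> borel_measurable borel"
    using f(1) by measurable
  let ?P = "\<lambda>x. \<integral>\<^sup>+ y. ennreal (f (x, y)) \<partial>K x" and ?N = "\<lambda>x. \<integral>\<^sup>+ y. ennreal (- f (x, y)) \<partial>K x"
  have fin: "(\<integral>\<^sup>+ x. ?P x \<partial>\<mu>) = (\<integral>\<^sup>+ z. ennreal (f z) \<partial>\<pi>)" "(\<integral>\<^sup>+ x. ?N x \<partial>\<mu>) = (\<integral>\<^sup>+ z. ennreal (- f z) \<partial>\<pi>)"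
    using disintegration_nn_integral pm by auto
  have fin': "(\<integral>\<^sup>+ x. ?P x \<partial>\<mu>) < \<infinity>" "(\<integral>\<^sup>+ x. ?N x \<partial>\<mu>) < \<infinity>"
    using f(2) unfolding fin real_integrable_def by (auto simp: less_top)
  have meas[measurable]: "?P \<in> borel_measurable \<mu>" "?N \<in> borel_measurable \<mu>"
    using measurable_kernel_nn_integral[OF pm(1)] measurable_kernel_nn_integral[OF pm(2)]
    by (auto simp: measurable_cong_sets[OF \<mu>(2) refl])
  have AE: "AE x in \<mu>. ?P x \<noteq> \<infinity>" "AE x in \<mu>. ?N x \<noteq> \<infinity>"
    using nn_integral_PInf_AE[OF meas(1)] nn_integral_PInf_AE[OF meas(2)] fin' by (auto simp: less_top)
  then show 1: "AE x in \<mu>. integrable (K x) (\<lambda>y. f (x, y))"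
    by eventually_elim (use measurable_fiber[OF f(1)] in \<open>simp add: real_integrable_def\<close>)
  have eq: "AE x in \<mu>. (\<integral>y. f (x, y) \<partial>K x) = enn2real (?P x) - enn2real (?N x)"
    using 1 by eventually_elim (rule real_lebesgue_integral_def)
  have int: "integrable \<mu> (\<lambda>x. enn2real (?P x))" "integrable \<mu> (\<lambda>x. enn2real (?N x))"
    "(\<integral>x. enn2real (?P x) \<partial>\<mu>) = enn2real (\<integral>\<^sup>+ x. ?P x \<partial>\<mu>)"
    "(\<integral>x. enn2real (?N x) \<partial>\<mu>) = enn2real (\<integral>\<^sup>+ x. ?N x \<partial>\<mu>)"
  proof -
    have "(\<integral>\<^sup>+ x. ennreal (enn2real (?P x)) \<partial>\<mu>) = (\<integral>\<^sup>+ x. ?P x \<partial>\<mu>)"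
      by (rule nn_integral_cong_AE) (use AE(1) in \<open>eventually_elim, simp add: less_top\<close>)
    moreover have "(\<integral>\<^sup>+ x. ennreal (enn2real (?N x)) \<partial>\<mu>) = (\<integral>\<^sup>+ x. ?N x \<partial>\<mu>)"
      by (rule nn_integral_cong_AE) (use AE(2) in \<open>eventually_elim, simp add: less_top\<close>)
    ultimately show "integrable \<mu> (\<lambda>x. enn2real (?P x))" "integrable \<mu> (\<lambda>x. enn2real (?N x))"
      "(\<integral>x. enn2real (?P x) \<partial>\<mu>) = enn2real (\<integral>\<^sup>+ x. ?P x \<partial>\<mu>)"
      "(\<integral>x. enn2real (?N x) \<partial>\<mu>) = enn2real (\<integral>\<^sup>+ x. ?N x \<partial>\<mu>)"
      using fin' by (auto simp: integrable_iff_bounded integral_eq_nn_integral)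
  qed
  have m1: "(\<lambda>x. enn2real (?P x) - enn2real (?N x)) \<in> borel_measurable \<mu>"
    by measurable
  have m2: "(\<lambda>x. \<integral>y. f (x, y) \<partial>K x) \<in> borel_measurable \<mu>"
    using measurable_kernel_integral[OF f(1)] by (simp add: measurable_cong_sets[OF \<mu>(2) refl])
  have "has_bochner_integral \<mu> (\<lambda>x. enn2real (?P x) - enn2real (?N x)) (\<integral>z. f z \<partial>\<pi>)"
    using int unfolding fin real_lebesgue_integral_def[OF f(2)] by (simp add: has_bochner_integral_iff)
  then show "has_bochner_integral \<mu> (\<lambda>x. \<integral>y. f (x, y) \<partial>K x) (\<integral>z. f z \<partial>\<pi>)"
    using has_bochner_integral_cong_AE[OF m2 m1 eq] by simp
qed

end

section \<open>Concave functions truncated along tangents\<close>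

lemma Times_borel: "A \<in> sets borel \<Longrightarrow> B \<in> sets borel \<Longrightarrow> A \<times> B \<in> sets (borel :: (real \<times> real) measure)"
  by (simp flip: borel_prod)

definition second_marginal_on :: "real set \<Rightarrow> (real \<times> real) measure \<Rightarrow> real measure" where
  "second_marginal_on U \<pi> = distr (density \<pi> (\<lambda>z. ennreal (indicator U (fst z)))) borel snd"

lemma emeasure_second_marginal_on:
  assumes "sets \<pi> = sets borel" "U \<in> sets borel" "B \<in> sets borel"
  shows "emeasure (second_marginal_on U \<pi>) B = emeasure \<pi> (U \<times> B)"
proof -
  have [measurable]: "fst \<in> borel_measurable \<pi>" "snd \<in> borel_measurable \<pi>"
    using borel_measurable_fst_snd by (simp_all add: measurable_cong_sets[OF assms(1) refl])
  have [measurable]: "U \<in> sets borel" "B \<in> sets borel" using assms by auto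
  have UB: "U \<times> B \<in> sets \<pi>" using Times_borel assms by simp
  have "emeasure (second_marginal_on U \<pi>) B = (\<integral>\<^sup>+ z. ennreal (indicator U (fst z)) * indicator (snd -` B \<inter> space \<pi>) z \<partial>\<pi>)"
    unfolding second_marginal_on_def by (simp add: emeasure_distr emeasure_density)
  also have "\<dots> = (\<integral>\<^sup>+ z. indicator (U \<times> B) z \<partial>\<pi>)"
    by (intro nn_integral_cong) (auto simp: indicator_def)
  also have "\<dots> = emeasure \<pi> (U \<times> B)" using UB by simp
  finally show ?thesis .
qed

lemma second_marginal_on_eqI:
  assumes "sets \<pi> = sets borel" "sets \<pi>' = sets borel" "U \<in> sets borel"
    and "\<And>B. B \<in> sets borel \<Longrightarrow> emeasure \<pi> (U \<times> B) = emeasure \<pi>' (U \<times> B)"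
  shows "second_marginal_on U \<pi> = second_marginal_on U \<pi>'"
  by (rule measure_eqI) (use assms in \<open>simp_all add: emeasure_second_marginal_on second_marginal_on_def[of _ \<pi>] second_marginal_on_def[of _ \<pi>']\<close>,
    metis assms emeasure_second_marginal_on second_marginal_on_def)

lemma integral_second_marginal_on:
  fixes h :: "real \<Rightarrow> real"
  assumes "sets \<pi> = sets borel" "U \<in> sets borel" "h \<in> borel_measurable borel"
  shows "(\<integral>y. h y \<partial>second_marginal_on U \<pi>) = (\<integral>z. indicator U (fst z) * h (snd z) \<partial>\<pi>)"
proof -
  have [measurable]: "fst \<in> borel_measurable \<pi>" "snd \<in> borel_measurable \<pi>"
    using borel_measurable_fst_snd by (simp_all add: measurable_cong_sets[OF assms(1) refl])
  have [measurable]: "U \<in> sets borel" "h \<in> borel_measurable borel" using assms by auto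
  show ?thesis
    unfolding second_marginal_on_def by (simp add: integral_distr integral_real_density)
qed

lemma nn_integral_second_marginal_on:
  assumes "sets \<pi> = sets borel" "U \<in> sets borel" "h \<in> borel_measurable borel"
  shows "(\<integral>\<^sup>+ y. h y \<partial>second_marginal_on U \<pi>) = (\<integral>\<^sup>+ z. indicator U (fst z) * h (snd z) \<partial>\<pi>)"
proof -
  have [measurable]: "fst \<in> borel_measurable \<pi>" "snd \<in> borel_measurable \<pi>"
    using borel_measurable_fst_snd by (simp_all add: measurable_cong_sets[OF assms(1) refl])
  have [measurable]: "U \<in> sets borel" "h \<in> borel_measurable borel" using assms by auto
  show ?thesis
    unfolding second_marginal_on_def by (simp add: nn_integral_distr nn_integral_density ennreal_indicator)
qed

section \<open>Concave functions with chosen supporting slopes\<close>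

definition strictly_between :: "real set \<Rightarrow> real set" where
  "strictly_between D = {x. \<exists>y\<in>D. \<exists>z\<in>D. y < x \<and> x < z}"

definition clamp_to :: "real \<Rightarrow> real \<Rightarrow> real \<Rightarrow> real" where
  "clamp_to a b t = max a (min b t)"

lemma clamp_to_measurable [measurable]: "clamp_to a b \<in> borel_measurable borel"
  unfolding clamp_to_def[abs_def] by measurable

text \<open>Concavity expressed by supporting lines. They are required only at interior points of
  the interval \<open>D\<close>: at an endpoint that belongs to \<open>D\<close>, a concave function
  may jump or have infinite slope.\<close>

locale concave_support =
  fixes D :: "real set" and u s :: "real \<Rightarrow> real"
  assumes convex: "\<And>x y t. x \<in> D \<Longrightarrow> y \<in> D \<Longrightarrow> x \<le> t \<Longrightarrow> t \<le> y \<Longrightarrow> t \<in> D"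
    and support: "\<And>x y. x \<in> strictly_between D \<Longrightarrow> y \<in> D \<Longrightarrow> u y \<le> u x + s x * (y - x)"
begin

lemma strictly_between_subset: "x \<in> strictly_between D \<Longrightarrow> x \<in> D"
  by (auto simp: strictly_between_def intro: convex less_imp_le)

lemma slope_antimono:
  assumes "x \<in> strictly_between D" "y \<in> strictly_between D" "x \<le> y"
  shows "s y \<le> s x"
proof (cases "x = y")
  case False
  have "u y \<le> u x + s x * (y - x)" "u x \<le> u y + s y * (x - y)"
    using assms by (auto intro: support strictly_between_subset)
  then have "0 \<le> (s x - s y) * (y - x)" by (simp add: algebra_simps)
  then show ?thesis using False assms(3) by (simp add: zero_le_mult_iff)
qed auto

text \<open>\<open>trunc a b\<close> agrees with \<open>u\<close> on \<open>{a..b}\<close> and continues along tangents outside.\<close>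

definition gap :: "real \<times> real \<Rightarrow> real" where
  "gap = (\<lambda>(x, y). u x + s x * (y - x) - u y)"

definition trunc :: "real \<Rightarrow> real \<Rightarrow> real \<Rightarrow> real" where
  "trunc a b y = u (clamp_to a b y) + s (clamp_to a b y) * (y - clamp_to a b y)"

text \<open>The gap of \<open>trunc a b\<close>, whose slope at \<open>x\<close> is the slope of
  \<open>u\<close> at the clamped point.\<close>

definition trunc_gap :: "real \<Rightarrow> real \<Rightarrow> real \<times> real \<Rightarrow> real" where
  "trunc_gap a b = (\<lambda>(x, y). trunc a b x + s (clamp_to a b x) * (y - x) - trunc a b y)"

text \<open>Either the endpoint is interior to \<open>D\<close> and has a supporting slope, or it is
  extremal in \<open>D\<close>, and then no point of \<open>D\<close> lies beyond it where the
  tangent would matter.\<close>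

definition admissible :: "real \<Rightarrow> real \<Rightarrow> bool" where
  "admissible a b \<longleftrightarrow> a < b \<and> a \<in> D \<and> b \<in> D \<and>
     (a \<in> strictly_between D \<or> (\<forall>y\<in>D. a \<le> y)) \<and> (b \<in> strictly_between D \<or> (\<forall>y\<in>D. y \<le> b))"

lemma gap_nonneg: "x \<in> strictly_between D \<Longrightarrow> y \<in> D \<Longrightarrow> 0 \<le> gap (x, y)"
  using support[of x y] by (simp add: gap_def)

lemma clamp_cases:
  assumes "a < b"
  obtains "t < a" "clamp_to a b t = a" | "a \<le> t" "t \<le> b" "clamp_to a b t = t" | "b < t" "clamp_to a b t = b"
  using assms unfolding clamp_to_def by linarith

lemma clamp_strictly_between:
  assumes ab: "admissible a b" and x: "x \<in> strictly_between D"
  shows "clamp_to a b x \<in> strictly_between D"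
proof -
  have xD: "x \<in> D" using x by (rule strictly_between_subset)
  have "a < b" using ab by (simp add: admissible_def)
  then show ?thesis
    by (cases rule: clamp_cases[of a b x]) (use ab x xD in \<open>force simp: admissible_def\<close>)+
qed

text \<open>With \<open>p\<close> the clamping map, the gap is the sum of the support inequality
  between \<open>p x\<close> and \<open>p y\<close> and of
  \<open>(s (p x) - s (p y)) * (y - p y)\<close>, which is nonnegative because slopes
  decrease.\<close>

lemma trunc_gap_nonneg:
  assumes ab: "admissible a b" and x: "x \<in> strictly_between D" and y: "y \<in> D"
  shows "0 \<le> trunc_gap a b (x, y)"
proof -
  define p where "p = clamp_to a b"
  have ab': "a < b" "a \<in> D" "b \<in> D" using ab by (auto simp: admissible_def)
  have px: "p x \<in> strictly_between D" unfolding p_def by (rule clamp_strictly_between[OF ab x])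
  have px': "a \<le> p x" "p x \<le> b" using ab' by (auto simp: p_def clamp_to_def)
  have py: "p y \<in> D" using ab' y by (cases rule: clamp_cases[OF ab'(1), of y]) (auto simp: p_def)
  have 1: "u (p y) \<le> u (p x) + s (p x) * (p y - p x)" by (rule support[OF px py])
  have 2: "0 \<le> (s (p x) - s (p y)) * (y - p y)"
  proof (cases rule: clamp_cases[OF ab'(1), of y])
    case 1
    then have "a \<in> strictly_between D" using ab y by (force simp: admissible_def)
    then have "s (p x) \<le> s a" using slope_antimono[of a "p x"] px px' by simp
    then show ?thesis using 1 by (simp add: p_def mult_nonpos_nonpos)
  next
    case 3
    then have "b \<in> strictly_between D" using ab y by (force simp: admissible_def)
    then have "s b \<le> s (p x)" using slope_antimono[of "p x" b] px px' by simp
    then show ?thesis using 3 by (simp add: p_def)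
  qed (simp add: p_def)
  show ?thesis using 1 2 unfolding trunc_gap_def trunc_def p_def[symmetric] by (simp add: algebra_simps)
qed

text \<open>The claim is a support inequality from below for \<open>d\<close>, the excess of
  \<open>trunc a b\<close> over \<open>u\<close>, which is nonnegative on \<open>D\<close> and zero
  on \<open>{a..b}\<close>. If \<open>x\<close> is outside, the line at \<open>x\<close> lies below
  \<open>d\<close> on the same side, where \<open>trunc a b\<close> is affine and the support
  inequality of \<open>u\<close> applies. At the endpoint the line is at most 0, and it does not
  rise from there on.\<close>

lemma trunc_gap_le_gap:
  assumes ab: "admissible a b" and x: "x \<in> strictly_between D" and y: "y \<in> D"
  shows "trunc_gap a b (x, y) \<le> gap (x, y)"
proof -
  define d where "d t = trunc a b t - u t" for t
  have ab': "a < b" "a \<in> D" "b \<in> D" using ab by (auto simp: admissible_def)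
  have a: "a \<in> strictly_between D" if "t < a" "t \<in> D" for t using ab that by (force simp: admissible_def)
  have b: "b \<in> strictly_between D" if "b < t" "t \<in> D" for t using ab that by (force simp: admissible_def)
  have d0: "0 \<le> d y"
    using support[of a y] support[of b y] a[of y] b[of y] y
    by (cases rule: clamp_cases[OF ab'(1), of y]) (auto simp: d_def trunc_def)
  have xD: "x \<in> D" using x by (rule strictly_between_subset)
  have xy: "u y \<le> u x + s x * (y - x)" by (rule support[OF x y])
  have "d x + (s (clamp_to a b x) - s x) * (y - x) \<le> d y"
  proof (cases rule: clamp_cases[OF ab'(1), of x])
    case 1
    have abt: "a \<in> strictly_between D" using a 1 xD by blast
    have sa: "s a \<le> s x" using slope_antimono[OF x abt] 1 by simp
    have xa: "u a \<le> u x + s x * (a - x)" by (rule support[OF x ab'(2)])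
    show ?thesis
    proof (cases "y \<le> a")
      case True
      then have "clamp_to a b y = a" using ab' by (simp add: clamp_to_def)
      then show ?thesis using xy 1 by (simp add: d_def trunc_def algebra_simps)
    next
      case False
      have "(s a - s x) * (y - x) \<le> (s a - s x) * (a - x)"
        using False sa by (intro mult_left_mono_neg) auto
      then have "d x + (s a - s x) * (y - x) \<le> 0"
        using xa 1 by (simp add: d_def trunc_def algebra_simps)
      then show ?thesis using d0 1 by simp
    qed
  next
    case 2
    then show ?thesis using d0 by (simp add: d_def trunc_def)
  next
    case 3
    have bbt: "b \<in> strictly_between D" using b 3 xD by blast
    have sb: "s x \<le> s b" using slope_antimono[OF bbt x] 3 by simp
    have xb: "u b \<le> u x + s x * (b - x)" by (rule support[OF x ab'(3)])
    show ?thesis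
    proof (cases "b \<le> y")
      case True
      then have "clamp_to a b y = b" using ab' by (simp add: clamp_to_def)
      then show ?thesis using xy 3 by (simp add: d_def trunc_def algebra_simps)
    next
      case False
      have "(s b - s x) * (y - x) \<le> (s b - s x) * (b - x)"
        using False sb by (intro mult_left_mono) auto
      then have "d x + (s b - s x) * (y - x) \<le> 0"
        using xb 3 by (simp add: d_def trunc_def algebra_simps)
      then show ?thesis using d0 3 by simp
    qed
  qed
  then show ?thesis unfolding gap_def trunc_gap_def d_def by (simp add: algebra_simps)
qed

lemma trunc_gap_eq: "a \<le> x \<Longrightarrow> x \<le> b \<Longrightarrow> a \<le> y \<Longrightarrow> y \<le> b \<Longrightarrow> trunc_gap a b (x, y) = gap (x, y)"
  by (simp add: trunc_gap_def gap_def trunc_def clamp_to_def)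

text \<open>Linear growth is what makes \<open>trunc a b\<close> integrable for measures with a
  finite first moment. Outside \<open>{a..b}\<close> it is affine; inside, \<open>u\<close> has to
  be bounded without any continuity at the endpoints.\<close>

lemma trunc_growth:
  assumes ab: "admissible a b"
  obtains M where "0 \<le> M" "\<And>y. \<bar>trunc a b y\<bar> \<le> M + M * \<bar>y\<bar>"
proof -
  have ab': "a < b" "a \<in> D" "b \<in> D" using ab by (auto simp: admissible_def)
  \<comment> \<open>The midpoint is interior to \<open>D\<close>, so a supporting line exists there
    and bounds \<open>u\<close> above.\<close>
  define q where "q = (a + b) / 2"
  have q: "q \<in> strictly_between D" using ab' by (force simp: q_def strictly_between_def)
  define L where "L = \<bar>u a\<bar> + \<bar>u b\<bar> + \<bar>u q\<bar> + \<bar>s q\<bar> * (b - a)"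
  have L: "\<bar>u y\<bar> \<le> L" if "a \<le> y" "y \<le> b" for y
  proof -
    have yD: "y \<in> D" using convex ab' that by blast
    have "\<bar>s q * (y - q)\<bar> \<le> \<bar>s q\<bar> * (b - a)"
      unfolding abs_mult using that ab' by (intro mult_left_mono) (auto simp: q_def abs_le_iff field_simps)
    then have 1: "u y \<le> u q + \<bar>s q\<bar> * (b - a)" using support[OF q yD] by linarith
    \<comment> \<open>The supporting line at \<open>y\<close> is at most \<open>u y\<close> at one
      of the two endpoints, according to the sign of its slope.\<close>
    have 2: "u y \<ge> min (u a) (u b)"
    proof (cases "y = a \<or> y = b")
      case False
      then have y: "y \<in> strictly_between D" using that ab' by (force simp: strictly_between_def)
      show ?thesis
      proof (cases "0 \<le> s y")
        case True
        then have "s y * (a - y) \<le> 0" using that by (simp add: mult_nonneg_nonpos)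
        then show ?thesis using support[OF y ab'(2)] by linarith
      next
        case False
        then have "s y * (b - y) \<le> 0" using that by (simp add: mult_nonpos_nonneg)
        then show ?thesis using support[OF y ab'(3)] by linarith
      qed
    qed auto
    have "0 \<le> \<bar>s q\<bar> * (b - a)" using ab' by simp
    then show ?thesis using 1 2 unfolding L_def by linarith
  qed
  define M where "M = L + (\<bar>s a\<bar> + \<bar>s b\<bar>) * (1 + \<bar>a\<bar> + \<bar>b\<bar>)"
  have L0: "0 \<le> L" using L[of a] ab' by auto
  have M: "L \<le> M" "\<bar>s a\<bar> + \<bar>s b\<bar> \<le> M" "L + (\<bar>s a\<bar> + \<bar>s b\<bar>) * (\<bar>a\<bar> + \<bar>b\<bar>) \<le> M"
    using L0 mult_left_mono[of 1 "1 + \<bar>a\<bar> + \<bar>b\<bar>" "\<bar>s a\<bar> + \<bar>s b\<bar>"] unfolding M_def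
    by (auto simp: algebra_simps intro!: add_nonneg_nonneg mult_nonneg_nonneg)
  have tail: "\<bar>u e + s e * (y - e)\<bar> \<le> M + M * \<bar>y\<bar>" if e: "e = a \<or> e = b" for e y
  proof -
    have "\<bar>s e * (y - e)\<bar> \<le> (\<bar>s a\<bar> + \<bar>s b\<bar>) * (\<bar>y\<bar> + (\<bar>a\<bar> + \<bar>b\<bar>))"
      unfolding abs_mult using e by (intro mult_mono) auto
    also have "\<dots> = (\<bar>s a\<bar> + \<bar>s b\<bar>) * \<bar>y\<bar> + (\<bar>s a\<bar> + \<bar>s b\<bar>) * (\<bar>a\<bar> + \<bar>b\<bar>)" by (rule distrib_left)
    also have "(\<bar>s a\<bar> + \<bar>s b\<bar>) * \<bar>y\<bar> \<le> M * \<bar>y\<bar>" using M by (intro mult_right_mono) auto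
    finally have "\<bar>s e * (y - e)\<bar> \<le> M * \<bar>y\<bar> + (\<bar>s a\<bar> + \<bar>s b\<bar>) * (\<bar>a\<bar> + \<bar>b\<bar>)" by simp
    moreover have "\<bar>u e\<bar> \<le> L" using L[of e] e ab' by auto
    ultimately show ?thesis using M by linarith
  qed
  have "\<bar>trunc a b y\<bar> \<le> M + M * \<bar>y\<bar>" for y
  proof (cases rule: clamp_cases[OF ab'(1), of y])
    case 2
    have "0 \<le> M * \<bar>y\<bar>" using M L0 by simp
    moreover have "trunc a b y = u y" using 2 by (simp add: trunc_def)
    ultimately show ?thesis using 2 L[of y] M by linarith
  qed (use tail in \<open>auto simp: trunc_def\<close>)
  then show thesis using that M L0 by (meson order_trans)
qed

text \<open>An endpoint that belongs to \<open>D\<close> may carry mass and must be reached exactly,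
  so there the sequence is constant. Otherwise the endpoint is approached by maxima or minima of
  finitely many rationals in \<open>D\<close>, which are interior points.\<close>

lemma exhaustion:
  assumes "strictly_between D \<noteq> {}"
  obtains a b :: "nat \<Rightarrow> real" where "\<And>n. admissible (a n) (b n)"
    "\<And>y. y \<in> D \<Longrightarrow> eventually (\<lambda>n. a n \<le> y \<and> y \<le> b n) sequentially"
proof -
  obtain p y1 y2 where p: "y1 \<in> D" "y2 \<in> D" "y1 < p" "p < y2"
    using assms by (auto simp: strictly_between_def)
  \<comment> \<open>These two points separate the sequences:
    \<open>a n \<le> p1 < p2 \<le> b n\<close>.\<close>
  define p1 where "p1 = (y1 + p) / 2"
  define p2 where "p2 = (y2 + p) / 2"
  have pp: "y1 < p1" "p1 < p" "p < p2" "p2 < y2" using p by (auto simp: p1_def p2_def)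
  have p1: "p1 \<in> D" "p2 \<in> D" using p pp by (auto intro: convex[of y1 y2])
  define r :: "nat \<Rightarrow> real" where "r n = real_of_rat (from_nat n)" for n
  have dense: "\<exists>n. v < r n \<and> r n < w" if "v < w" for v w
  proof -
    obtain q where "v < real_of_rat q" "real_of_rat q < w" using of_rat_dense \<open>v < w\<close> by blast
    then show ?thesis unfolding r_def by (intro exI[of _ "to_nat q"]) simp
  qed
  have "\<exists>b. (\<forall>n. p2 \<le> b n \<and> b n \<in> D \<and> (b n \<in> strictly_between D \<or> (\<forall>y\<in>D. y \<le> b n))) \<and>
      (\<forall>y\<in>D. eventually (\<lambda>n. y \<le> b n) sequentially)"
  proof (cases "\<exists>m\<in>D. \<forall>y\<in>D. y \<le> m")
    case True
    then obtain m where m: "m \<in> D" "\<forall>y\<in>D. y \<le> m" by blast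
    then show ?thesis using p1 by (intro exI[of _ "\<lambda>_. m"]) auto
  next
    case False
    define b where "b n = Max (insert p2 (r ` {k. k \<le> n \<and> r k \<in> D}))" for n
    have b_in: "b n \<in> insert p2 (r ` {k. k \<le> n \<and> r k \<in> D})" for n
      unfolding b_def by (rule Max_in) auto
    have bD: "b n \<in> D" for n using b_in[of n] p1 by auto
    have bp: "p2 \<le> b n" for n unfolding b_def by (rule Max_ge) auto
    have "b n \<in> strictly_between D" for n
    proof -
      obtain y where "y \<in> D" "b n < y" using False bD by (meson not_le)
      then show ?thesis using bp[of n] pp p by (force simp: strictly_between_def)
    qed
    moreover have "eventually (\<lambda>n. y \<le> b n) sequentially" if y: "y \<in> D" for y
    proof -
      obtain z where z: "z \<in> D" "y < z" using False y by (meson not_le)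
      obtain k where k: "y < r k" "r k < z" using dense[OF z(2)] by blast
      then have "r k \<in> D" using convex y z by (meson less_imp_le)
      then have "r k \<le> b n" if "k \<le> n" for n unfolding b_def using that by (intro Max_ge) auto
      then show ?thesis using k by (auto simp: eventually_sequentially intro!: exI[of _ k]) (meson less_imp_le order_trans)
    qed
    ultimately show ?thesis using bD bp by blast
  qed
  then obtain b where b: "\<And>n. p2 \<le> b n \<and> b n \<in> D \<and> (b n \<in> strictly_between D \<or> (\<forall>y\<in>D. y \<le> b n))"
    "\<And>y. y \<in> D \<Longrightarrow> eventually (\<lambda>n. y \<le> b n) sequentially" by blast
  have "\<exists>a. (\<forall>n. a n \<le> p1 \<and> a n \<in> D \<and> (a n \<in> strictly_between D \<or> (\<forall>y\<in>D. a n \<le> y))) \<and>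
      (\<forall>y\<in>D. eventually (\<lambda>n. a n \<le> y) sequentially)"
  proof (cases "\<exists>m\<in>D. \<forall>y\<in>D. m \<le> y")
    case True
    then obtain m where m: "m \<in> D" "\<forall>y\<in>D. m \<le> y" by blast
    then show ?thesis using p1 by (intro exI[of _ "\<lambda>_. m"]) auto
  next
    case False
    define a where "a n = Min (insert p1 (r ` {k. k \<le> n \<and> r k \<in> D}))" for n
    have a_in: "a n \<in> insert p1 (r ` {k. k \<le> n \<and> r k \<in> D})" for n
      unfolding a_def by (rule Min_in) auto
    have aD: "a n \<in> D" for n using a_in[of n] p1 by auto
    have ap: "a n \<le> p1" for n unfolding a_def by (rule Min_le) auto
    have "a n \<in> strictly_between D" for n
    proof -
      obtain y where "y \<in> D" "y < a n" using False aD by (meson not_le)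
      then show ?thesis using ap[of n] pp p by (force simp: strictly_between_def)
    qed
    moreover have "eventually (\<lambda>n. a n \<le> y) sequentially" if y: "y \<in> D" for y
    proof -
      obtain z where z: "z \<in> D" "z < y" using False y by (meson not_le)
      obtain k where k: "z < r k" "r k < y" using dense[OF z(2)] by blast
      then have "r k \<in> D" using convex y z by (meson less_imp_le)
      then have "a n \<le> r k" if "k \<le> n" for n unfolding a_def using that by (intro Min_le) auto
      then show ?thesis using k by (auto simp: eventually_sequentially intro!: exI[of _ k]) (meson less_imp_le order_trans)
    qed
    ultimately show ?thesis using aD ap by blast
  qed
  then obtain a where a: "\<And>n. a n \<le> p1 \<and> a n \<in> D \<and> (a n \<in> strictly_between D \<or> (\<forall>y\<in>D. a n \<le> y))"
    "\<And>y. y \<in> D \<Longrightarrow> eventually (\<lambda>n. a n \<le> y) sequentially" by blast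
  show thesis
  proof
    show "admissible (a n) (b n)" for n
      using a(1)[of n] b(1)[of n] pp unfolding admissible_def by auto
    show "eventually (\<lambda>n. a n \<le> y \<and> y \<le> b n) sequentially" if "y \<in> D" for y
      using a(2)[OF that] b(2)[OF that] by (rule eventually_conj)
  qed
qed

end

section \<open>Integrals of gaps under martingale plans\<close>

locale martingale_plan = disintegrated +
  assumes fst_marginal: "distr \<pi> borel fst = \<mu>"
    and integrable_fst_marginal: "integrable \<mu> (\<lambda>x. x)"
    and integrable_snd: "integrable \<pi> snd"
    and mean: "AE x in \<mu>. has_bochner_integral (K x) (\<lambda>y. y) x"
begin

lemma prob_space_plan: "prob_space \<pi>"
proof
  have "emeasure \<mu> (space \<mu>) = 1" using \<mu>(1) by (rule prob_space.emeasure_space_1)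
  moreover have "fst \<in> \<pi> \<rightarrow>\<^sub>M borel"
    using borel_measurable_fst_snd by (simp add: measurable_cong_sets[OF \<pi> refl])
  ultimately show "emeasure \<pi> (space \<pi>) = 1"
    by (simp add: fst_marginal[symmetric] emeasure_distr)
qed

lemma measurable_plan: "f \<in> borel \<rightarrow>\<^sub>M N \<Longrightarrow> f \<in> \<pi> \<rightarrow>\<^sub>M N"
  by (simp add: measurable_cong_sets[OF \<pi> refl])

lemma integrable_fst: "integrable \<pi> fst"
proof -
  have "integrable (distr \<pi> borel fst) (\<lambda>x. x)" unfolding fst_marginal by (rule integrable_fst_marginal)
  then show ?thesis
    by (subst (asm) integrable_distr_eq) (auto intro!: measurable_plan)
qed

end

locale concave_support_borel = concave_support +
  assumes D_borel [measurable]: "D \<in> sets borel" and u_borel [measurable]: "u \<in> borel_measurable borel"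
    and s_borel [measurable]: "s \<in> borel_measurable borel"
begin

lemma trunc_measurable [measurable]: "trunc a b \<in> borel_measurable borel"
  unfolding trunc_def[abs_def] by measurable

lemma trunc_gap_measurable [measurable]: "trunc_gap a b \<in> borel_measurable borel"
  unfolding trunc_gap_def case_prod_beta' by measurable

lemma gap_measurable [measurable]: "gap \<in> borel_measurable borel"
  unfolding gap_def case_prod_beta' by measurable

lemma integrable_trunc:
  assumes "prob_space M" "integrable M f" "admissible a b"
  shows "integrable M (\<lambda>z. trunc a b (f z))"
proof -
  interpret prob_space M by fact
  obtain m where m: "0 \<le> m" "\<And>y. \<bar>trunc a b y\<bar> \<le> m + m * \<bar>y\<bar>" using trunc_growth[OF assms(3)] by blast
  have "f \<in> borel_measurable M" using assms(2) by simp
  then have "(\<lambda>z. trunc a b (f z)) \<in> borel_measurable M" by measurable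
  moreover have "integrable M (\<lambda>z. m + m * \<bar>f z\<bar>)" using assms(2) by simp
  ultimately show ?thesis
    using m by (intro Bochner_Integration.integrable_bound[where g="\<lambda>z. trunc a b (f z)"]) (auto intro!: AE_I2 order_trans[OF m(2)])
qed

text \<open>The slope term has integral 0 over each fibre by the martingale property. It is removed
  there, at fixed \<open>x\<close>, because the slopes may be unbounded near an extremal endpoint;
  the remaining terms are integrable by linear growth.\<close>

lemma nn_integral_trunc_gap:
  fixes \<mu> \<pi> K
  assumes plan: "martingale_plan \<mu> \<pi> K" and U: "U \<in> sets borel" "U \<subseteq> strictly_between D"
    and KD: "AE x in \<mu>. x \<in> U \<longrightarrow> (AE y in K x. y \<in> D)" and ab: "admissible a b"
  shows "(\<integral>\<^sup>+ z. ennreal (trunc_gap a b z) * indicator (U \<times> D) z \<partial>\<pi>) =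
    ennreal (\<integral>z. indicator U (fst z) * (trunc a b (fst z) - trunc a b (snd z)) \<partial>\<pi>)"
proof -
  interpret martingale_plan \<mu> \<pi> K by fact
  have [measurable]: "U \<in> sets borel" by fact
  let ?f = "\<lambda>z. indicator U (fst z) * (trunc a b (fst z) - trunc a b (snd z)) :: real"
  have f_borel: "?f \<in> borel_measurable borel" by measurable
  have UD: "U \<times> D \<in> sets (borel :: (real \<times> real) measure)" using Times_borel by measurable
  have f_int: "integrable \<pi> ?f"
  proof (rule Bochner_Integration.integrable_bound)
    show "integrable \<pi> (\<lambda>z. trunc a b (fst z) - trunc a b (snd z))"
      using integrable_trunc[OF prob_space_plan integrable_fst ab] integrable_trunc[OF prob_space_plan integrable_snd ab]
      by simp
    show "?f \<in> borel_measurable \<pi>" by (rule measurable_plan[OF f_borel])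
    show "AE z in \<pi>. norm (?f z) \<le> norm (trunc a b (fst z) - trunc a b (snd z))"
      by (auto simp: indicator_def)
  qed
  note int = disintegration_integral[OF f_borel f_int]
  have fiber: "AE x in \<mu>. (\<integral>\<^sup>+ y. ennreal (trunc_gap a b (x, y)) * indicator (U \<times> D) (x, y) \<partial>K x) =
      ennreal (\<integral>y. ?f (x, y) \<partial>K x) \<and> 0 \<le> (\<integral>y. ?f (x, y) \<partial>K x)"
    using int(1) KD mean
  proof eventually_elim
    case (elim x)
    show ?case
    proof (cases "x \<in> U")
      case True
      interpret K: prob_space "K x" by (rule prob_space_kernel)
      have AED: "AE y in K x. y \<in> D" using elim True by simp
      have xb: "x \<in> strictly_between D" using True U by auto
      have id: "integrable (K x) (\<lambda>y. y)" "(\<integral>y. y \<partial>K x) = x"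
        using elim(3) by (auto simp: has_bochner_integral_iff)
      let ?g = "\<lambda>y. ?f (x, y) + s (clamp_to a b x) * (y - x)"
      have g_eq: "trunc_gap a b (x, y) = ?g y" for y using True by (simp add: trunc_gap_def)
      have g_int: "integrable (K x) ?g" using elim(1) id by auto
      have "(\<integral>y. ?g y \<partial>K x) = (\<integral>y. ?f (x, y) \<partial>K x) + (\<integral>y. s (clamp_to a b x) * (y - x) \<partial>K x)"
        using elim(1) id by (intro Bochner_Integration.integral_add) auto
      also have "(\<integral>y. s (clamp_to a b x) * (y - x) \<partial>K x) = 0"
        using id K.prob_space by simp
      finally have g_val: "(\<integral>y. ?g y \<partial>K x) = (\<integral>y. ?f (x, y) \<partial>K x)" by simp
      have nonneg: "AE y in K x. 0 \<le> ?g y"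
        using AED trunc_gap_nonneg[OF ab xb] g_eq by (auto elim!: eventually_mono)
      have "(\<integral>\<^sup>+ y. ennreal (trunc_gap a b (x, y)) * indicator (U \<times> D) (x, y) \<partial>K x) =
          (\<integral>\<^sup>+ y. ennreal (?g y) \<partial>K x)"
        using AED True by (intro nn_integral_cong_AE) (auto simp: g_eq elim!: eventually_mono)
      also have "\<dots> = ennreal (\<integral>y. ?g y \<partial>K x)"
        by (rule nn_integral_eq_integral[OF g_int nonneg])
      finally show ?thesis using integral_nonneg_AE[OF nonneg] by (simp only: g_val)
    next
      case False
      then show ?thesis by simp
    qed
  qed
  have gm: "(\<lambda>z. ennreal (trunc_gap a b z) * indicator (U \<times> D) z) \<in> borel_measurable borel"
    using UD by measurable
  have "(\<integral>\<^sup>+ z. ennreal (trunc_gap a b z) * indicator (U \<times> D) z \<partial>\<pi>) =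
      (\<integral>\<^sup>+ x. ennreal (\<integral>y. ?f (x, y) \<partial>K x) \<partial>\<mu>)"
    unfolding disintegration_nn_integral[OF gm] using fiber
    by (intro nn_integral_cong_AE) (auto elim!: eventually_mono)
  also have "\<dots> = ennreal (\<integral>x. \<integral>y. ?f (x, y) \<partial>K x \<partial>\<mu>)"
    using int(2) fiber by (intro nn_integral_eq_integral) (auto simp: has_bochner_integral_iff elim!: eventually_mono)
  also have "(\<integral>x. \<integral>y. ?f (x, y) \<partial>K x \<partial>\<mu>) = (\<integral>z. ?f z \<partial>\<pi>)"
    using int(2) by (simp add: has_bochner_integral_iff)
  finally show ?thesis .
qed

text \<open>Fatou's lemma is applied under \<open>\<pi>'\<close> and the bound by the full gap under
  \<open>\<pi>\<close>; the truncated integrals in between coincide. This holds even if the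
  integrals are infinite.\<close>

lemma nn_integral_gap_le:
  fixes \<mu> \<pi> K \<pi>' K'
  assumes plan: "martingale_plan \<mu> \<pi> K" and plan': "martingale_plan \<mu> \<pi>' K'"
    and U: "U \<in> sets borel" "U \<subseteq> strictly_between D"
    and KD: "AE x in \<mu>. x \<in> U \<longrightarrow> (AE y in K x. y \<in> D)"
    and KD': "AE x in \<mu>. x \<in> U \<longrightarrow> (AE y in K' x. y \<in> D)"
    and snd_eq: "second_marginal_on U \<pi> = second_marginal_on U \<pi>'"
  shows "(\<integral>\<^sup>+ z. ennreal (gap z) * indicator (U \<times> D) z \<partial>\<pi>') \<le>
    (\<integral>\<^sup>+ z. ennreal (gap z) * indicator (U \<times> D) z \<partial>\<pi>)"
proof (cases "strictly_between D = {}")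
  case True
  then show ?thesis using U by simp
next
  case False
  interpret A: martingale_plan \<mu> \<pi> K by fact
  interpret B: martingale_plan \<mu> \<pi>' K' by fact
  have [measurable]: "U \<in> sets borel" by fact
  have UD: "U \<times> D \<in> sets (borel :: (real \<times> real) measure)" using Times_borel by measurable
  obtain a b where ab: "\<And>n::nat. admissible (a n) (b n)"
    and ex: "\<And>y. y \<in> D \<Longrightarrow> eventually (\<lambda>n. a n \<le> y \<and> y \<le> b n) sequentially"
    using exhaustion[OF False] by blast
  define E where "E n z = ennreal (trunc_gap (a n) (b n) z) * indicator (U \<times> D) z" for n z
  have E_borel: "E n \<in> borel_measurable borel" for n
    unfolding E_def[abs_def] using UD by measurable
  have eq: "(\<integral>\<^sup>+ z. E n z \<partial>\<pi>') = (\<integral>\<^sup>+ z. E n z \<partial>\<pi>)" for n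
  proof -
    let ?t = "trunc (a n) (b n)"
    have split: "(\<integral>z. indicator U (fst z) * (?t (fst z) - ?t (snd z)) \<partial>\<rho>) =
        (\<integral>x. indicator U x * ?t x \<partial>\<mu>) - (\<integral>y. ?t y \<partial>second_marginal_on U \<rho>)"
      if "martingale_plan \<mu> \<rho> L" for \<rho> L
    proof -
      interpret C: martingale_plan \<mu> \<rho> L by fact
      have "integrable \<rho> (\<lambda>z. indicator U (fst z) * ?t (fst z) :: real)"
        by (rule Bochner_Integration.integrable_bound[OF integrable_trunc[OF C.prob_space_plan C.integrable_fst ab[of n]]])
           (auto intro!: C.measurable_plan simp: indicator_def)
      moreover have "integrable \<rho> (\<lambda>z. indicator U (fst z) * ?t (snd z) :: real)"
        by (rule Bochner_Integration.integrable_bound[OF integrable_trunc[OF C.prob_space_plan C.integrable_snd ab[of n]]])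
           (auto intro!: C.measurable_plan simp: indicator_def)
      ultimately have "(\<integral>z. indicator U (fst z) * (?t (fst z) - ?t (snd z)) \<partial>\<rho>) =
          (\<integral>z. indicator U (fst z) * ?t (fst z) \<partial>\<rho>) - (\<integral>z. indicator U (fst z) * ?t (snd z) \<partial>\<rho>)"
        unfolding right_diff_distrib by (rule Bochner_Integration.integral_diff)
      also have "(\<integral>z. indicator U (fst z) * ?t (fst z) \<partial>\<rho>) = (\<integral>x. indicator U x * ?t x \<partial>\<mu>)"
        unfolding C.fst_marginal[symmetric] by (subst integral_distr) (auto intro!: C.measurable_plan)
      also have "(\<integral>z. indicator U (fst z) * ?t (snd z) \<partial>\<rho>) = (\<integral>y. ?t y \<partial>second_marginal_on U \<rho>)"
        by (rule integral_second_marginal_on[symmetric]) (auto simp: C.\<pi>)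
      finally show ?thesis .
    qed
    show ?thesis
      unfolding E_def nn_integral_trunc_gap[OF plan U KD ab] nn_integral_trunc_gap[OF plan' U KD' ab]
        split[OF plan] split[OF plan'] snd_eq ..
  qed
  have le: "E n z \<le> ennreal (gap z) * indicator (U \<times> D) z" for n z
    using trunc_gap_le_gap[OF ab[of n], of "fst z" "snd z"] U
    by (cases z) (auto simp: E_def indicator_def intro!: ennreal_leI)
  have "(\<integral>\<^sup>+ z. ennreal (gap z) * indicator (U \<times> D) z \<partial>\<pi>') \<le> (\<integral>\<^sup>+ z. liminf (\<lambda>n. E n z) \<partial>\<pi>')"
  proof (intro nn_integral_mono)
    fix z
    show "ennreal (gap z) * indicator (U \<times> D) z \<le> liminf (\<lambda>n. E n z)"
    proof (cases "z \<in> U \<times> D")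
      case True
      then obtain x y where z: "z = (x, y)" "x \<in> U" "y \<in> D" by auto
      then have "x \<in> D" using U strictly_between_subset by blast
      \<comment> \<open>Once both coordinates lie in \<open>{a n..b n}\<close>, truncation changes
        nothing, so the sequence is eventually constant.\<close>
      have "eventually (\<lambda>n. E n z = ennreal (gap z) * indicator (U \<times> D) z) sequentially"
        using ex[OF \<open>y \<in> D\<close>] ex[OF \<open>x \<in> D\<close>]
        by eventually_elim (simp add: E_def z trunc_gap_eq)
      then have "(\<lambda>n. E n z) \<longlonglongrightarrow> ennreal (gap z) * indicator (U \<times> D) z"
        by (rule tendsto_eventually)
      then show ?thesis by (simp add: lim_imp_Liminf)
    qed simp
  qed
  also have "\<dots> \<le> liminf (\<lambda>n. \<integral>\<^sup>+ z. E n z \<partial>\<pi>')"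
    by (rule nn_integral_liminf) (rule B.measurable_plan[OF E_borel])
  also have "\<dots> = liminf (\<lambda>n. \<integral>\<^sup>+ z. E n z \<partial>\<pi>)" unfolding eq ..
  also have "\<dots> \<le> liminf (\<lambda>n. \<integral>\<^sup>+ z. ennreal (gap z) * indicator (U \<times> D) z \<partial>\<pi>)"
    by (intro Liminf_mono always_eventually allI nn_integral_mono le)
  also have "\<dots> = (\<integral>\<^sup>+ z. ennreal (gap z) * indicator (U \<times> D) z \<partial>\<pi>)"
    by (simp add: Liminf_const)
  finally show ?thesis .
qed

end

section \<open>Comparison of plans on a component\<close>

text \<open>The family may be uncountable: the infimum is below \<open>a\<close> exactly where some
  member is, and this is a union of open sets.\<close>

lemma borel_measurable_cINF:
  fixes f :: "'i \<Rightarrow> real \<Rightarrow> real"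
  assumes D: "D \<in> sets borel" and I: "I \<noteq> {}"
    and cont: "\<And>i. i \<in> I \<Longrightarrow> continuous_on UNIV (f i)"
    and bdd: "\<And>y. y \<in> D \<Longrightarrow> bdd_below ((\<lambda>i. f i y) ` I)"
  shows "(\<lambda>y. if y \<in> D then INF i\<in>I. f i y else 0) \<in> borel_measurable borel"
proof (rule borel_measurableI_less)
  fix a :: real
  have "open (\<Union>i\<in>I. {y. f i y < a})"
    using cont by (intro open_UN ballI open_Collect_less) (auto intro: continuous_on_const)
  then have "(\<Union>i\<in>I. {y. f i y < a}) \<in> sets borel" by simp
  moreover have "{y \<in> space borel. (if y \<in> D then INF i\<in>I. f i y else 0) < a} =
      (D \<inter> (\<Union>i\<in>I. {y. f i y < a})) \<union> (if 0 < a then - D else {})"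
    using cINF_less_iff[OF I bdd] by auto
  ultimately show "{y \<in> space borel. (if y \<in> D then INF i\<in>I. f i y else 0) < a} \<in> sets borel"
    using D by auto
qed

lemma ennreal_integral_le_nn_integral:
  fixes f :: "'a \<Rightarrow> real"
  assumes "integrable M f"
  shows "ennreal (\<integral>x. f x \<partial>M) \<le> (\<integral>\<^sup>+ x. ennreal (f x) \<partial>M)"
proof -
  have int: "integrable M (\<lambda>x. max 0 (f x))" using assms by auto
  have "(\<integral>x. f x \<partial>M) \<le> (\<integral>x. max 0 (f x) \<partial>M)" by (intro integral_mono assms int) auto
  then have "ennreal (\<integral>x. f x \<partial>M) \<le> ennreal (\<integral>x. max 0 (f x) \<partial>M)" by (rule ennreal_leI)
  also have "\<dots> = (\<integral>\<^sup>+ x. ennreal (max 0 (f x)) \<partial>M)"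
    by (rule nn_integral_eq_integral[symmetric, OF int]) auto
  also have "\<dots> = (\<integral>\<^sup>+ x. ennreal (f x) \<partial>M)"
    by (intro nn_integral_cong) (auto simp: max_def ennreal_neg)
  finally show ?thesis .
qed

lemma (in martingale_plan) kernel_affine:
  assumes "has_bochner_integral (K x) (\<lambda>y. y) x"
  shows "integrable (K x) (\<lambda>y. a + k * (y - x))" "(\<integral>y. a + k * (y - x) \<partial>K x) = a"
proof -
  interpret K: prob_space "K x" by (rule prob_space_kernel)
  have "integrable (K x) (\<lambda>y. y)" "(\<integral>y. y \<partial>K x) = x" using assms by (auto simp: has_bochner_integral_iff)
  then show "integrable (K x) (\<lambda>y. a + k * (y - x))" "(\<integral>y. a + k * (y - x) \<partial>K x) = a"
    using K.prob_space by simp_all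
qed

section \<open>Convex hulls on the line and measurable supporting slopes\<close>

definition real_hull :: "real set \<Rightarrow> real set" where
  "real_hull Y = {t. \<exists>y\<in>Y. \<exists>z\<in>Y. y \<le> t \<and> t \<le> z}"

lemma real_hull_convex: "x \<in> real_hull Y \<Longrightarrow> y \<in> real_hull Y \<Longrightarrow> x \<le> t \<Longrightarrow> t \<le> y \<Longrightarrow> t \<in> real_hull Y"
  unfolding real_hull_def by (auto intro: order_trans)

lemma real_hull_borel: "real_hull Y \<in> sets borel"
  by (rule real_interval_borel_measurable) (auto simp: is_interval_1 intro: real_hull_convex)

lemma subset_real_hull: "Y \<subseteq> real_hull Y"
  by (auto simp: real_hull_def)

lemma open_strictly_between: "open (strictly_between D)"
proof -
  have "strictly_between D = (\<Union>y\<in>D. \<Union>z\<in>D. {y<..<z})"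
    by (auto simp: strictly_between_def)
  then show ?thesis by (simp only:) (intro open_UN ballI open_greaterThanLessThan)
qed

text \<open>Slopes picked by choice, independently at each interior point, are still Borel because
  supporting slopes of a concave function are antitone.\<close>

lemma slopes_exist:
  assumes D: "\<And>x y t. x \<in> D \<Longrightarrow> y \<in> D \<Longrightarrow> x \<le> t \<Longrightarrow> t \<le> y \<Longrightarrow> t \<in> D"
    and "D \<in> sets borel" "u \<in> borel_measurable borel" and conv: "convex_on D (\<lambda>y. - u y)"
  obtains s where "concave_support_borel D u s"
proof -
  have int: "x \<in> interior D" if "x \<in> strictly_between D" for x
  proof -
    have "strictly_between D \<subseteq> D" by (auto simp: strictly_between_def intro: D less_imp_le)
    then show ?thesis using that open_strictly_between interior_maximal by blast
  qed
  have ex: "\<exists>k. \<forall>y\<in>D. u y \<le> u x + k * (y - x)" if "x \<in> strictly_between D" for x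
  proof (intro exI ballI)
    fix y assume "y \<in> D"
    from convex_le_Inf_differential[OF conv int[OF that] this]
    show "u y \<le> u x + (- Inf ((\<lambda>t. (- u x - - u t) / (x - t)) ` ({x<..} \<inter> D))) * (y - x)"
      by simp
  qed
  define s0 where "s0 x = (SOME k. \<forall>y\<in>D. u y \<le> u x + k * (y - x))" for x
  have s0: "u y \<le> u x + s0 x * (y - x)" if "x \<in> strictly_between D" "y \<in> D" for x y
    unfolding s0_def by (rule bspec[OF someI_ex[OF ex[OF that(1)]] that(2)])
  interpret C: concave_support D u s0 by unfold_locales (fact D, fact s0)
  define s where "s x = (if x \<in> strictly_between D then s0 x else 0)" for x
  have "mono_on (strictly_between D) (\<lambda>x. - s0 x)"
    using C.slope_antimono by (auto simp: mono_on_def)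
  from borel_measurable_mono_on_fnc[OF this]
  have "(\<lambda>x. - s0 x) \<in> borel_measurable (restrict_space borel (strictly_between D))" .
  then have "(\<lambda>x. if x \<in> strictly_between D then - s0 x else 0) \<in> borel_measurable borel"
    using open_strictly_between by (subst (asm) measurable_restrict_space_iff[where c=0]) auto
  then have "(\<lambda>x. - (if x \<in> strictly_between D then - s0 x else 0)) \<in> borel_measurable borel"
    by (rule borel_measurable_uminus)
  also have "(\<lambda>x. - (if x \<in> strictly_between D then - s0 x else 0)) = s" by (auto simp: s_def)
  finally have s: "s \<in> borel_measurable borel" .
  have "concave_support_borel D u s"
  proof
    show "t \<in> D" if "x \<in> D" "y \<in> D" "x \<le> t" "t \<le> y" for x y t using that by (rule D)
    show "u y \<le> u x + s x * (y - x)" if "x \<in> strictly_between D" "y \<in> D" for x y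
      using s0[OF that] that by (simp add: s_def)
  qed fact+
  then show thesis by (rule that)
qed

text \<open>The auxiliary function \<open>H\<close> adds to the shifted cost two nonnegative terms,
  chosen so that in each fibre \<open>H\<close> is affine in \<open>y\<close> on the contact set and
  above that affine function on the rest of \<open>D\<close>. Since the kernels share their mean,
  \<open>H\<close> costs no more under \<open>\<pi>\<close> than under \<open>\<pi>'\<close>. The
  added terms have finite integral under \<open>\<pi>\<close> and no larger integral under
  \<open>\<pi>'\<close>, so they can be removed again.\<close>

lemma component_le:
  fixes c :: "real \<times> real \<Rightarrow> real"
  assumes plan: "martingale_plan \<mu> \<pi> K" and plan': "martingale_plan \<mu> \<pi>' K'"
    and c: "continuous_on UNIV c" "\<And>p. \<bar>c p\<bar> \<le> C"
    and pot: "potentials c G \<phi> \<psi> \<Delta>"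
    and U: "U \<in> sets borel" "U \<subseteq> strictly_between (real_hull (snd ` G))"
    and G: "AE x in \<mu>. x \<in> U \<longrightarrow> x \<in> fst ` G \<and> (AE y in K x. (x, y) \<in> G)"
    and snd_eq: "second_marginal_on U \<pi> = second_marginal_on U \<pi>'"
  shows "(\<integral>\<^sup>+ z. ennreal (c z + C) * indicator U (fst z) \<partial>\<pi>) \<le>
    (\<integral>\<^sup>+ z. ennreal (c z + C) * indicator U (fst z) \<partial>\<pi>')"
proof (cases "G = {}")
  case True
  then show ?thesis using U by (simp add: real_hull_def strictly_between_def)
next
  case False
  interpret A: martingale_plan \<mu> \<pi> K by fact
  interpret B: martingale_plan \<mu> \<pi>' K' by fact
  define X where "X = fst ` G"
  define D where "D = real_hull (snd ` G)"
  define l where "l x y = \<phi> x + \<Delta> x * y" for x y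
  have X: "X \<noteq> {}" using False by (auto simp: X_def)
  have D_borel: "D \<in> sets borel" unfolding D_def by (rule real_hull_borel)
  have D_conv: "\<And>x y t. x \<in> D \<Longrightarrow> y \<in> D \<Longrightarrow> x \<le> t \<Longrightarrow> t \<le> y \<Longrightarrow> t \<in> D"
    unfolding D_def by (rule real_hull_convex)
  have c_borel: "c \<in> borel_measurable borel" using c(1) by (rule borel_measurable_continuous_onI)
  have cC: "- C \<le> c p" "c p \<le> C" for p using c(2)[of p] by (auto simp: abs_le_iff)
  have C: "0 \<le> C" using c(2)[of undefined] by linarith
  have contact: "c (x, y) - l x y = \<psi> y" if "(x, y) \<in> G" for x y
    using pot that unfolding potentials_def l_def by auto
  have psi_le: "\<psi> y \<le> c (x, y) - l x y" if "x \<in> X" "y \<in> snd ` G" for x y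
    using pot that unfolding potentials_def l_def X_def by (auto simp: algebra_simps)
  \<comment> \<open>An affine function on an interval is at least its smaller endpoint value, and at
    second coordinates of contact points \<open>C - l x\<close> dominates \<open>\<psi>\<close> for
    every \<open>x\<close>. This makes both infima below finite on the whole of
    \<open>D\<close>.\<close>
  have lower: "\<exists>m. \<forall>x\<in>X. m \<le> C - l x y \<and> m - 2 * C \<le> c (x, y) - l x y" if "y \<in> D" for y
  proof -
    obtain y1 y2 where y12: "y1 \<in> snd ` G" "y2 \<in> snd ` G" "y1 \<le> y" "y \<le> y2"
      using \<open>y \<in> D\<close> by (auto simp: D_def real_hull_def)
    have "min (\<psi> y1) (\<psi> y2) \<le> C - l x y" if "x \<in> X" for x
    proof -
      have "\<psi> y1 \<le> C - l x y1" "\<psi> y2 \<le> C - l x y2"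
        using psi_le[OF that y12(1)] psi_le[OF that y12(2)] cC[of "(x, y1)"] cC[of "(x, y2)"] by linarith+
      moreover have "C - l x y1 \<le> C - l x y \<or> C - l x y2 \<le> C - l x y"
      proof (cases "0 \<le> \<Delta> x")
        case True
        then show ?thesis using y12 mult_left_mono[of y y2 "\<Delta> x"] by (simp add: l_def)
      next
        case False
        then show ?thesis using y12 mult_left_mono_neg[of y1 y "\<Delta> x"] by (simp add: l_def)
      qed
      ultimately show ?thesis by linarith
    qed
    then show ?thesis using cC by (intro exI[of _ "min (\<psi> y1) (\<psi> y2)"]) (smt (verit))
  qed
  have bdd: "bdd_below ((\<lambda>x. C - l x y) ` X)" "bdd_below ((\<lambda>x. c (x, y) - l x y) ` X)" if "y \<in> D" for y
    using lower[OF that] by (meson bdd_belowI2)+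
  define u where "u y = (if y \<in> D then INF x\<in>X. C - l x y else 0)" for y
  \<comment> \<open>The Borel substitute for \<open>\<psi>\<close>: it agrees with
    \<open>\<psi>\<close> at contact points by \<open>p_eq\<close> and stays within
    \<open>2 * C\<close> of the concave \<open>u\<close>.\<close>
  define p where "p y = (if y \<in> D then INF x\<in>X. c (x, y) - l x y else 0)" for y
  have u_borel [measurable]: "u \<in> borel_measurable borel"
    unfolding u_def[abs_def] by (rule borel_measurable_cINF[OF D_borel X _ bdd(1)])
      (auto simp: l_def intro!: continuous_intros)
  have p_borel [measurable]: "p \<in> borel_measurable borel"
    unfolding p_def[abs_def]
  proof (rule borel_measurable_cINF[OF D_borel X _ bdd(2)])
    show "continuous_on UNIV (\<lambda>y. c (x, y) - l x y)" for x
      unfolding l_def by (intro continuous_intros continuous_on_compose2[OF c(1)]) auto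
  qed
  have u_le: "u y \<le> C - l x y" and p_le: "p y \<le> c (x, y) - l x y" if "x \<in> X" "y \<in> D" for x y
    using that bdd by (auto simp: u_def p_def intro: cINF_lower)
  have p_le_u: "p y \<le> u y" and u_le_p: "u y - 2 * C \<le> p y" if "y \<in> D" for y
  proof -
    have "p y \<le> C - l x y" if "x \<in> X" for x
      using p_le[OF that \<open>y \<in> D\<close>] cC[of "(x, y)"] by linarith
    then show "p y \<le> u y" using that X by (simp add: u_def cINF_greatest)
    have "u y - 2 * C \<le> c (x, y) - l x y" if "x \<in> X" for x
      using u_le[OF that \<open>y \<in> D\<close>] cC[of "(x, y)"] by linarith
    then show "u y - 2 * C \<le> p y" using that X by (simp add: p_def cINF_greatest)
  qed
  have GD: "y \<in> D" if "(x, y) \<in> G" for x y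
    using that subset_real_hull[of "snd ` G"] by (force simp: D_def)
  have p_eq: "p y = c (x, y) - l x y" if "(x, y) \<in> G" for x y
  proof (rule antisym)
    have x: "x \<in> X" and y: "y \<in> snd ` G" using that by (force simp: X_def)+
    show "p y \<le> c (x, y) - l x y" using p_le[OF x GD[OF that]] .
    show "c (x, y) - l x y \<le> p y"
      unfolding contact[OF that] using GD[OF that] X psi_le[OF _ y] by (simp add: p_def cINF_greatest)
  qed
  have conv: "convex_on D (\<lambda>y. - u y)"
    unfolding convex_on_def
  proof (intro conjI ballI allI impI)
    show "convex D"
      by (rule is_interval_convex) (auto simp: is_interval_1 intro: D_conv)
    fix x y a b :: real
    assume xy: "x \<in> D" "y \<in> D" and ab: "0 \<le> a" "0 \<le> b" "a + b = 1"
    have in_D: "a *\<^sub>R x + b *\<^sub>R y \<in> D" using \<open>convex D\<close> xy ab by (rule convexD)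
    have "a * u x + b * u y \<le> C - l i (a *\<^sub>R x + b *\<^sub>R y)" if "i \<in> X" for i
    proof -
      have "a * u x + b * u y \<le> a * (C - l i x) + b * (C - l i y)"
        using u_le[OF that xy(1)] u_le[OF that xy(2)] ab by (intro add_mono mult_left_mono) auto
      also have "\<dots> = (a + b) * (C - \<phi> i) - \<Delta> i * (a * x + b * y)"
        by (simp add: l_def algebra_simps)
      also have "\<dots> = C - l i (a *\<^sub>R x + b *\<^sub>R y)" using ab by (simp add: l_def)
      finally show ?thesis .
    qed
    then have "a * u x + b * u y \<le> (INF i\<in>X. C - l i (a *\<^sub>R x + b *\<^sub>R y))"
      using X by (intro cINF_greatest)
    also have "\<dots> = u (a *\<^sub>R x + b *\<^sub>R y)" using in_D by (simp add: u_def)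
    finally show "- u (a *\<^sub>R x + b *\<^sub>R y) \<le> a * - u x + b * - u y" by simp
  qed
  have "\<exists>s. concave_support_borel D u s"
    by (rule slopes_exist[OF _ D_borel u_borel conv]) (erule (3) D_conv, blast)
  then obtain s where "concave_support_borel D u s" ..
  then interpret S: concave_support_borel D u s .
  have UD: "U \<subseteq> strictly_between D" using U by (simp add: D_def)
  have [measurable]: "U \<in> sets borel" by fact
  have UxD: "U \<times> D \<in> sets (borel :: (real \<times> real) measure)" using Times_borel U D_borel by blast
  have [measurable]: "c \<in> borel_measurable borel" by (rule c_borel)
  let ?I = "indicator (U \<times> D) :: real \<times> real \<Rightarrow> ennreal"
  \<comment> \<open>The term \<open>u (snd z)\<close> cancels against the one in the gap, leaving
    \<open>c - p\<close> plus an affine function of \<open>y\<close>. On contact points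
    \<open>c - p\<close> is the affine function \<open>l x\<close>, elsewhere it is at least
    \<open>l x\<close>.\<close>
  define H where "H z = c z + C + S.gap z + (u (snd z) - p (snd z))" for z
  have H_borel [measurable]: "H \<in> borel_measurable borel" unfolding H_def[abs_def] by measurable
  have fiber_eq: "H (x, y) = (C + u x + l x x) + (s x + \<Delta> x) * (y - x)" if "(x, y) \<in> G" for x y
    using p_eq[OF that] by (simp add: H_def S.gap_def l_def algebra_simps)
  have fiber_le: "(C + u x + l x x) + (s x + \<Delta> x) * (y - x) \<le> H (x, y)" if "x \<in> X" "y \<in> D" for x y
    using p_le[OF that] by (simp add: H_def S.gap_def l_def algebra_simps)
  have gap0: "0 \<le> S.gap (x, y)" if "x \<in> U" "y \<in> D" for x y
    using S.gap_nonneg UD that by blast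
  have H0: "0 \<le> H (x, y)" and gap_le: "S.gap (x, y) \<le> H (x, y)" if "x \<in> U" "y \<in> D" for x y
    using gap0[OF that] p_le_u[OF that(2)] cC[of "(x, y)"] by (auto simp: H_def)
  have H_split: "ennreal (H z) * ?I z = ennreal (c z + C) * ?I z + ennreal (S.gap z) * ?I z +
      ennreal (u (snd z) - p (snd z)) * ?I z" for z
  proof (cases "z \<in> U \<times> D")
    case True
    then have "0 \<le> c z + C" "0 \<le> S.gap z" "0 \<le> u (snd z) - p (snd z)"
      using gap0 p_le_u cC[of z] by (auto simp: le_diff_eq)
    then show ?thesis using True by (simp add: H_def ennreal_plus)
  qed simp
  have KD: "AE x in \<mu>. x \<in> U \<longrightarrow> (AE y in K x. y \<in> D)"
    using G
  proof eventually_elim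
    case (elim x)
    show ?case
    proof
      assume "x \<in> U"
      then have "AE y in K x. (x, y) \<in> G" using elim by blast
      then show "AE y in K x. y \<in> D" by eventually_elim (rule GD)
    qed
  qed
  have mD: "- D \<in> sets borel" using D_borel by (metis sets.compl_sets space_borel Compl_eq_Diff_UNIV)
  have P: "{z. fst z \<in> U \<longrightarrow> snd z \<in> D} \<in> sets (borel :: (real \<times> real) measure)"
  proof -
    have "{z. fst z \<in> U \<longrightarrow> snd z \<in> D} = - (U \<times> - D)" by auto
    then show ?thesis using Times_borel[OF U(1) mD] by (metis sets.compl_sets space_borel Compl_eq_Diff_UNIV)
  qed
  have AE_D: "AE z in \<pi>. fst z \<in> U \<longrightarrow> snd z \<in> D"
    by (rule A.disintegration_AE_I[OF P]) (use KD in \<open>auto elim!: eventually_mono\<close>)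
  \<comment> \<open>That nothing is sent from \<open>U\<close> outside \<open>D\<close> is a
    property of the second marginal over \<open>U\<close>, so it passes from \<open>\<pi>\<close> to
    \<open>\<pi>'\<close>.\<close>
  have KD': "AE x in \<mu>. x \<in> U \<longrightarrow> (AE y in K' x. y \<in> D)"
  proof -
    from AE_D have AE: "AE z in \<pi>. z \<notin> U \<times> - D" by eventually_elim auto
    have "U \<times> - D \<in> null_sets \<pi>"
      using AE Times_borel[OF U(1) mD] by (subst AE_iff_null_sets) (simp_all add: A.\<pi>)
    then have "emeasure \<pi> (U \<times> - D) = 0" by auto
    then have 0: "emeasure \<pi>' (U \<times> - D) = 0"
      using emeasure_second_marginal_on[OF A.\<pi> U(1) mD] emeasure_second_marginal_on[OF B.\<pi> U(1) mD] snd_eq by simp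
    have "U \<times> - D \<in> null_sets \<pi>'"
      using 0 Times_borel[OF U(1) mD] by (intro null_setsI) (simp_all add: B.\<pi>)
    then have "AE z in \<pi>'. z \<notin> U \<times> - D" by (rule AE_not_in)
    then have "AE z in \<pi>'. fst z \<in> U \<longrightarrow> snd z \<in> D" by eventually_elim auto
    from B.disintegration_AE[OF P this] show ?thesis
      by (auto elim!: eventually_mono)
  qed
  have HI_borel: "(\<lambda>z. ennreal (H z) * ?I z) \<in> borel_measurable borel"
    and gI_borel: "(\<lambda>z. ennreal (S.gap z) * ?I z) \<in> borel_measurable borel"
    and cI_borel: "(\<lambda>z. ennreal (c z + C) * ?I z) \<in> borel_measurable borel"
    and wI_borel: "(\<lambda>z. ennreal (u (snd z) - p (snd z)) * ?I z) \<in> borel_measurable borel"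
    using UxD by measurable
  have fiber: "AE x in \<mu>. (\<integral>\<^sup>+ y. ennreal (H (x, y)) * ?I (x, y) \<partial>K x) \<le> (\<integral>\<^sup>+ y. ennreal (H (x, y)) * ?I (x, y) \<partial>K' x)
      \<and> (\<integral>\<^sup>+ y. ennreal (S.gap (x, y)) * ?I (x, y) \<partial>K x) \<le> ennreal (2 * C)"
    using G KD' A.mean B.mean
  proof eventually_elim
    case (elim x)
    show ?case
    proof (cases "x \<in> U")
      case True
      then have x: "x \<in> X" and AEG: "AE y in K x. (x, y) \<in> G" and AED: "AE y in K' x. y \<in> D"
        using elim by (auto simp: X_def)
      define a where "a = C + u x + l x x"
      define k where "k = s x + \<Delta> x"
      have xD: "x \<in> D" using True UD S.strictly_between_subset by blast
      \<comment> \<open>The inequality \<open>u \<le> C - l x\<close> is read at the point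
        \<open>x\<close> itself. As \<open>a\<close> is the fibre integral of \<open>H\<close>,
        which dominates the gap, this is the bound \<open>2C\<close> on the Jensen gap.\<close>
      have a2: "a \<le> 2 * C" using u_le[OF x xD] by (simp add: a_def)
      have "AE y in K x. 0 \<le> a + k * (y - x)"
        using AEG
      proof eventually_elim
        case (elim y)
        then show ?case using H0[OF True GD[OF elim]] fiber_eq[OF elim] by (simp add: a_def k_def)
      qed
      then have K_val: "(\<integral>\<^sup>+ y. ennreal (a + k * (y - x)) \<partial>K x) = ennreal a"
        using nn_integral_eq_integral[OF A.kernel_affine(1)] A.kernel_affine(2) elim(3) by simp
      have 1: "(\<integral>\<^sup>+ y. ennreal (H (x, y)) * ?I (x, y) \<partial>K x) = ennreal a"
        unfolding K_val[symmetric]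
      proof (rule nn_integral_cong_AE)
        show "AE y in K x. ennreal (H (x, y)) * ?I (x, y) = ennreal (a + k * (y - x))"
          using AEG
        proof eventually_elim
          case (elim y)
          then show ?case using fiber_eq[OF elim] GD[OF elim] True by (simp add: a_def k_def)
        qed
      qed
      have "ennreal a \<le> (\<integral>\<^sup>+ y. ennreal (a + k * (y - x)) \<partial>K' x)"
        using ennreal_integral_le_nn_integral[OF B.kernel_affine(1)[OF elim(4)]] B.kernel_affine(2)[OF elim(4)] by simp
      also have "\<dots> \<le> (\<integral>\<^sup>+ y. ennreal (H (x, y)) * ?I (x, y) \<partial>K' x)"
      proof (rule nn_integral_mono_AE)
        show "AE y in K' x. ennreal (a + k * (y - x)) \<le> ennreal (H (x, y)) * ?I (x, y)"
          using AED
        proof eventually_elim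
          case (elim y)
          then show ?case using fiber_le[OF x elim] True by (simp add: a_def k_def ennreal_leI)
        qed
      qed
      finally have 2: "ennreal a \<le> (\<integral>\<^sup>+ y. ennreal (H (x, y)) * ?I (x, y) \<partial>K' x)" .
      have "(\<integral>\<^sup>+ y. ennreal (S.gap (x, y)) * ?I (x, y) \<partial>K x) \<le> (\<integral>\<^sup>+ y. ennreal (H (x, y)) * ?I (x, y) \<partial>K x)"
        using gap_le by (intro nn_integral_mono) (auto simp: indicator_def intro!: ennreal_leI)
      then show ?thesis using 1 2 a2 ennreal_leI[OF a2] by (auto intro: order_trans)
    next
      case False
      then show ?thesis by simp
    qed
  qed
  have H_le: "(\<integral>\<^sup>+ z. ennreal (H z) * ?I z \<partial>\<pi>) \<le> (\<integral>\<^sup>+ z. ennreal (H z) * ?I z \<partial>\<pi>')"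
    unfolding A.disintegration_nn_integral[OF HI_borel] B.disintegration_nn_integral[OF HI_borel]
    using fiber by (intro nn_integral_mono_AE) (auto elim!: eventually_mono)
  have "(\<integral>\<^sup>+ z. ennreal (S.gap z) * ?I z \<partial>\<pi>) \<le> (\<integral>\<^sup>+ x. ennreal (2 * C) \<partial>\<mu>)"
    unfolding A.disintegration_nn_integral[OF gI_borel]
    using fiber by (intro nn_integral_mono_AE) (auto elim!: eventually_mono)
  also have "\<dots> < \<infinity>"
    using prob_space.emeasure_space_1[OF A.\<mu>(1)] by simp
  finally have gap_fin: "(\<integral>\<^sup>+ z. ennreal (S.gap z) * ?I z \<partial>\<pi>) < \<infinity>" .
  have gap_mono: "(\<integral>\<^sup>+ z. ennreal (S.gap z) * ?I z \<partial>\<pi>') \<le> (\<integral>\<^sup>+ z. ennreal (S.gap z) * ?I z \<partial>\<pi>)"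
    by (rule S.nn_integral_gap_le[OF plan plan' U(1) UD KD KD' snd_eq])
  define w where "w y = ennreal (u y - p y) * indicator D y" for y
  have w_borel: "w \<in> borel_measurable borel" unfolding w_def[abs_def] using D_borel by measurable
  have wI: "ennreal (u (snd z) - p (snd z)) * ?I z = indicator U (fst z) * w (snd z)" for z
    by (auto simp: w_def indicator_def mem_Times_iff)
  have w_eq: "(\<integral>\<^sup>+ z. ennreal (u (snd z) - p (snd z)) * ?I z \<partial>\<pi>) = (\<integral>\<^sup>+ z. ennreal (u (snd z) - p (snd z)) * ?I z \<partial>\<pi>')"
    unfolding wI nn_integral_second_marginal_on[OF A.\<pi> U(1) w_borel, symmetric]
      nn_integral_second_marginal_on[OF B.\<pi> U(1) w_borel, symmetric] snd_eq ..
  have "(\<integral>\<^sup>+ z. ennreal (u (snd z) - p (snd z)) * ?I z \<partial>\<pi>) \<le> (\<integral>\<^sup>+ z. ennreal (2 * C) \<partial>\<pi>)"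
  proof (rule nn_integral_mono)
    show "ennreal (u (snd z) - p (snd z)) * ?I z \<le> ennreal (2 * C)" for z
      using u_le_p[of "snd z"] by (auto simp: indicator_def intro!: ennreal_leI)
  qed
  also have "\<dots> < \<infinity>"
    using prob_space.emeasure_space_1[OF A.prob_space_plan] by simp
  finally have w_fin: "(\<integral>\<^sup>+ z. ennreal (u (snd z) - p (snd z)) * ?I z \<partial>\<pi>) < \<infinity>" .
  let ?c = "\<lambda>\<rho>. \<integral>\<^sup>+ z. ennreal (c z + C) * ?I z \<partial>\<rho>"
  let ?g = "\<lambda>\<rho>. \<integral>\<^sup>+ z. ennreal (S.gap z) * ?I z \<partial>\<rho>"
  let ?w = "\<lambda>\<rho>. \<integral>\<^sup>+ z. ennreal (u (snd z) - p (snd z)) * ?I z \<partial>\<rho>"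
  have add: "(\<integral>\<^sup>+ z. ennreal (H z) * ?I z \<partial>\<rho>) = ?c \<rho> + ?g \<rho> + ?w \<rho>" if "sets \<rho> = sets borel" for \<rho>
  proof -
    note m = cI_borel gI_borel wI_borel
    note m' = m[folded measurable_cong_sets[OF that refl]]
    show ?thesis
      unfolding H_split nn_integral_add[OF borel_measurable_add[OF m'(1,2)] m'(3)] nn_integral_add[OF m'(1,2)] ..
  qed
  \<comment> \<open>The gap integral of \<open>\<pi>'\<close> may be replaced by the larger one of
    \<open>\<pi>\<close>, and the integrals of \<open>u - p\<close> coincide; both are finite and
    cancel.\<close>
  have "?c \<pi> + ?g \<pi> + ?w \<pi> \<le> ?c \<pi>' + ?g \<pi>' + ?w \<pi>'"
    using H_le unfolding add[OF A.\<pi>] add[OF B.\<pi>] .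
  also have "\<dots> \<le> ?c \<pi>' + ?g \<pi> + ?w \<pi>"
    using gap_mono w_eq by (intro add_mono) auto
  finally have "?c \<pi> + (?g \<pi> + ?w \<pi>) \<le> ?c \<pi>' + (?g \<pi> + ?w \<pi>)" by (simp add: add.assoc)
  moreover have "?g \<pi> + ?w \<pi> < \<infinity>" using gap_fin w_fin by simp
  ultimately have c_le: "?c \<pi> \<le> ?c \<pi>'"
    unfolding add.commute[of _ "?g \<pi> + ?w \<pi>"] ennreal_add_left_cancel_le by (auto simp: less_top)
  have "(\<integral>\<^sup>+ z. ennreal (c z + C) * indicator U (fst z) \<partial>\<pi>) = ?c \<pi>"
  proof -
    from AE_D show ?thesis
      by (intro nn_integral_cong_AE) (auto simp: indicator_def mem_Times_iff elim!: eventually_mono)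
  qed
  also note c_le
  also have "?c \<pi>' \<le> (\<integral>\<^sup>+ z. ennreal (c z + C) * indicator U (fst z) \<partial>\<pi>')"
    by (intro nn_integral_mono) (auto simp: indicator_def mem_Times_iff)
  finally show ?thesis .
qed

section \<open>Points that no plan crosses\<close>

lemma mean_at_bound:
  fixes x :: real
  assumes "prob_space M" "has_bochner_integral M (\<lambda>y. y) x" and AE: "(AE y in M. x \<le> y) \<or> (AE y in M. y \<le> x)"
  shows "AE y in M. y = x"
proof -
  interpret prob_space M by fact
  have int: "integrable M (\<lambda>y. y)" "(\<integral>y. y \<partial>M) = x" using assms(2) by (auto simp: has_bochner_integral_iff)
  show ?thesis
    using AE
  proof
    assume A: "AE y in M. x \<le> y"
    have "(\<integral>y. y - x \<partial>M) = 0" using int prob_space by simp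
    then have "AE y in M. y - x = 0"
      using A int by (subst (asm) integral_nonneg_eq_0_iff_AE) auto
    then show ?thesis by simp
  next
    assume A: "AE y in M. y \<le> x"
    have "(\<integral>y. x - y \<partial>M) = 0" using int prob_space by simp
    then have "AE y in M. x - y = 0"
      using A int by (subst (asm) integral_nonneg_eq_0_iff_AE) auto
    then show ?thesis by (auto elim!: eventually_mono)
  qed
qed

lemma mean_between:
  fixes x :: real
  assumes M: "prob_space M" "has_bochner_integral M (\<lambda>y. y) x" and AE: "AE y in M. y \<in> S"
  shows "\<exists>y\<in>S. y \<le> x" "\<exists>y\<in>S. x \<le> y"
proof -
  interpret prob_space M by fact
  have *: False if "AE y in M. P y \<and> y \<noteq> x" "(AE y in M. x \<le> y) \<or> (AE y in M. y \<le> x)" for P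
  proof -
    have "AE y in M. False"
      using mean_at_bound[OF M that(2)] that(1) by eventually_elim simp
    then show False by simp
  qed
  show "\<exists>y\<in>S. y \<le> x"
  proof (rule ccontr)
    assume "\<not> (\<exists>y\<in>S. y \<le> x)"
    then have "\<And>y. y \<in> S \<Longrightarrow> x < y" by (meson not_le)
    then have "AE y in M. x < y" using AE by (auto elim!: eventually_mono)
    then show False
      by (intro *[of "\<lambda>y. x < y"] disjI1) (auto elim!: eventually_mono)
  qed
  show "\<exists>y\<in>S. x \<le> y"
  proof (rule ccontr)
    assume "\<not> (\<exists>y\<in>S. x \<le> y)"
    then have "\<And>y. y \<in> S \<Longrightarrow> y < x" by (meson not_le)
    then have "AE y in M. y < x" using AE by (auto elim!: eventually_mono)
    then show False
      by (intro *[of "\<lambda>y. y < x"] disjI2) (auto elim!: eventually_mono)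
  qed
qed

definition noncrossing :: "real \<Rightarrow> real \<times> real \<Rightarrow> bool" where
  "noncrossing t = (\<lambda>(x, y). (t < x \<longrightarrow> t \<le> y) \<and> (x < t \<longrightarrow> y \<le> t) \<and> (x = t \<longrightarrow> y = t))"

text \<open>The right-hand side is the gap of the convex function \<open>\<bar>y - t\<bar>\<close>
  at \<open>x\<close> for the subgradient \<open>sgn (x - t)\<close>. The value
  \<open>sgn 0 = 0\<close> is what forces \<open>y = t\<close> when \<open>x = t\<close>.\<close>

lemma noncrossing_iff: "noncrossing t (x, y) \<longleftrightarrow> \<bar>y - t\<bar> - \<bar>x - t\<bar> - sgn (x - t) * (y - x) = 0"
  by (auto simp: noncrossing_def sgn_real_def abs_if)

lemma noncrossing_nonneg: "0 \<le> \<bar>y - t\<bar> - \<bar>x - t\<bar> - sgn (x - t) * (y - x)" for x y t :: real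
  by (auto simp: sgn_real_def abs_if)

lemma noncrossing_borel: "{z. noncrossing t z} \<in> sets borel"
proof -
  have "{z. noncrossing t z} = {z. \<bar>snd z - t\<bar> - \<bar>fst z - t\<bar> - sgn (fst z - t) * (snd z - fst z) = 0}"
    using noncrossing_iff by auto
  also have "\<dots> \<in> sets borel"
    by measurable
  finally show ?thesis .
qed

context martingale_plan
begin

lemma integral_martingale:
  fixes g :: "real \<Rightarrow> real"
  assumes [measurable]: "g \<in> borel_measurable borel" and bound: "\<And>x. \<bar>g x\<bar> \<le> B"
  shows "integrable \<pi> (\<lambda>z. g (fst z) * (snd z - fst z))" "(\<integral>z. g (fst z) * (snd z - fst z) \<partial>\<pi>) = 0"
proof -
  have B: "0 \<le> B" using bound[of 0] by linarith
  have meas: "(\<lambda>z. g (fst z) * (snd z - fst z)) \<in> borel_measurable borel" by measurable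
  show int: "integrable \<pi> (\<lambda>z. g (fst z) * (snd z - fst z))"
  proof (rule Bochner_Integration.integrable_bound)
    show "integrable \<pi> (\<lambda>z. B * (snd z - fst z))" using integrable_snd integrable_fst by simp
    show "(\<lambda>z. g (fst z) * (snd z - fst z)) \<in> borel_measurable \<pi>" by (rule measurable_plan[OF meas])
    show "AE z in \<pi>. norm (g (fst z) * (snd z - fst z)) \<le> norm (B * (snd z - fst z))"
      using bound B by (auto simp: abs_mult intro!: mult_right_mono)
  qed
  have "AE x in \<mu>. (\<integral>y. g (fst (x, y)) * (snd (x, y) - fst (x, y)) \<partial>K x) = 0"
    using mean
  proof eventually_elim
    case (elim x)
    interpret K: prob_space "K x" by (rule prob_space_kernel)
    show ?case using elim K.prob_space by (simp add: has_bochner_integral_iff)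
  qed
  then have "(\<integral>x. \<integral>y. g (fst (x, y)) * (snd (x, y) - fst (x, y)) \<partial>K x \<partial>\<mu>) = (\<integral>x. 0 \<partial>\<mu>)"
    using measurable_kernel_integral[OF meas]
    by (intro integral_cong_AE) (auto simp: measurable_cong_sets[OF \<mu>(2) refl])
  then show "(\<integral>z. g (fst z) * (snd z - fst z) \<partial>\<pi>) = 0"
    using disintegration_integral(2)[OF meas int] by (simp add: has_bochner_integral_iff)
qed

text \<open>The nonnegative gap of \<open>\<bar>y - t\<bar>\<close> vanishes almost surely exactly
  if its integral does. The criterion sees only the marginals, which transfers noncrossing from one
  plan to every other.\<close>

lemma noncrossing_integral:
  assumes "distr \<pi> borel snd = \<nu>"
  shows "(AE z in \<pi>. noncrossing t z) \<longleftrightarrow> (\<integral>y. \<bar>y - t\<bar> \<partial>\<nu>) - (\<integral>x. \<bar>x - t\<bar> \<partial>\<mu>) = 0"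
proof -
  interpret \<pi>: prob_space \<pi> by (rule prob_space_plan)
  let ?g = "\<lambda>x. sgn (x - t)" 
  have g: "?g \<in> borel_measurable borel" by measurable
  have g1: "\<bar>?g x\<bar> \<le> 1" for x by (simp add: sgn_real_def)
  note g = g g1
  let ?f = "\<lambda>z. \<bar>snd z - t\<bar> - \<bar>fst z - t\<bar> - sgn (fst z - t) * (snd z - fst z)"
  have i1: "integrable \<pi> (\<lambda>z. \<bar>snd z - t\<bar>)" and i2: "integrable \<pi> (\<lambda>z. \<bar>fst z - t\<bar>)"
    using integrable_snd integrable_fst by simp_all
  have int: "integrable \<pi> ?f"
    using i1 i2 integral_martingale(1)[OF g] by simp
  have "(\<integral>z. ?f z \<partial>\<pi>) = (\<integral>z. \<bar>snd z - t\<bar> \<partial>\<pi>) - (\<integral>z. \<bar>fst z - t\<bar> \<partial>\<pi>)"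
    using i1 i2 integral_martingale[OF g] by simp
  also have "(\<integral>z. \<bar>snd z - t\<bar> \<partial>\<pi>) = (\<integral>y. \<bar>y - t\<bar> \<partial>\<nu>)"
    unfolding assms[symmetric] by (subst integral_distr) (auto intro!: measurable_plan)
  also have "(\<integral>z. \<bar>fst z - t\<bar> \<partial>\<pi>) = (\<integral>x. \<bar>x - t\<bar> \<partial>\<mu>)"
    unfolding fst_marginal[symmetric] by (subst integral_distr) (auto intro!: measurable_plan)
  finally have val: "(\<integral>z. ?f z \<partial>\<pi>) = (\<integral>y. \<bar>y - t\<bar> \<partial>\<nu>) - (\<integral>x. \<bar>x - t\<bar> \<partial>\<mu>)" .
  have "(AE z in \<pi>. noncrossing t z) \<longleftrightarrow> (AE z in \<pi>. ?f z = 0)"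
    using noncrossing_iff by (intro AE_cong) auto
  also have "\<dots> \<longleftrightarrow> (\<integral>z. ?f z \<partial>\<pi>) = 0"
    by (rule integral_nonneg_eq_0_iff_AE[symmetric, OF int]) (intro AE_I2 noncrossing_nonneg)
  finally show ?thesis unfolding val .
qed

text \<open>Mass starting in \<open>S\<close> stays there or lands on \<open>t\<close>, and
  \<open>S\<close> receives mass only from itself. Hence inside \<open>S\<close> the plan reproduces
  \<open>\<nu>\<close>, and the surplus of \<open>\<mu>\<close> over \<open>\<nu>\<close> on
  \<open>S\<close> sits at \<open>t\<close>: everything is determined by the marginals.\<close>

lemma measure_Times_side:
  assumes snd_marginal: "distr \<pi> borel snd = \<nu>" and S: "S \<in> sets borel" "t \<notin> S"
    and AE: "AE z in \<pi>. (fst z \<in> S \<longrightarrow> snd z \<in> S \<or> snd z = t) \<and> (snd z \<in> S \<longrightarrow> fst z \<in> S)"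
    and B: "B \<in> sets borel"
  shows "measure \<pi> (S \<times> B) = measure \<nu> (B \<inter> S) + (if t \<in> B then measure \<mu> S - measure \<nu> S else 0)"
proof -
  interpret \<pi>: prob_space \<pi> by (rule prob_space_plan)
  have [measurable]: "S \<in> sets borel" by fact
  have space: "space \<pi> = UNIV" using sets_eq_imp_space_eq[OF \<pi>] by simp
  have nu: "measure \<nu> A = measure \<pi> (UNIV \<times> A)" if "A \<in> sets borel" for A
    unfolding snd_marginal[symmetric] using that
    by (subst measure_distr) (auto intro!: measurable_plan arg_cong[where f="measure \<pi>"] simp: space)
  have mu: "measure \<mu> S = measure \<pi> (S \<times> UNIV)"
    unfolding fst_marginal[symmetric] using S
    by (subst measure_distr) (auto intro!: measurable_plan arg_cong[where f="measure \<pi>"] simp: space)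
  have sets: "A \<times> A' \<in> sets \<pi>" if "A \<in> sets borel" "A' \<in> sets borel" for A A'
    using Times_borel[OF that] by (simp add: \<pi>)
  have *: "measure \<pi> (S \<times> B) = measure \<nu> (B \<inter> S) + (if t \<in> B then measure \<pi> (S \<times> {t}) else 0)"
    if B: "B \<in> sets borel" for B
  proof -
    have "measure \<pi> (S \<times> B) = measure \<pi> (UNIV \<times> (B \<inter> S) \<union> S \<times> (B \<inter> {t}))"
    proof (rule \<pi>.finite_measure_eq_AE)
      show "AE z in \<pi>. z \<in> S \<times> B \<longleftrightarrow> z \<in> UNIV \<times> (B \<inter> S) \<union> S \<times> (B \<inter> {t})"
        using AE by eventually_elim (auto simp: mem_Times_iff)
      show "S \<times> B \<in> sets \<pi>" "UNIV \<times> (B \<inter> S) \<union> S \<times> (B \<inter> {t}) \<in> sets \<pi>"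
        using S B by (auto intro!: sets sets.Un)
    qed
    also have "\<dots> = measure \<pi> (UNIV \<times> (B \<inter> S)) + measure \<pi> (S \<times> (B \<inter> {t}))"
      using S B by (intro \<pi>.finite_measure_Union) (auto intro!: sets)
    also have "measure \<pi> (UNIV \<times> (B \<inter> S)) = measure \<nu> (B \<inter> S)"
      using S B by (intro nu[symmetric]) auto
    also have "measure \<pi> (S \<times> (B \<inter> {t})) = (if t \<in> B then measure \<pi> (S \<times> {t}) else 0)" by simp
    finally show ?thesis .
  qed
  have "measure \<mu> S = measure \<nu> S + measure \<pi> (S \<times> {t})" using *[of UNIV] mu by simp
  then show ?thesis using *[OF B] by simp
qed

end

lemma second_marginal_side:
  assumes plan: "martingale_plan \<mu> \<pi> K" and plan': "martingale_plan \<mu> \<pi>' K'"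
    and snd_marginal: "distr \<pi> borel snd = \<nu>" "distr \<pi>' borel snd = \<nu>"
    and t: "AE z in \<pi>. noncrossing t z" "AE z in \<pi>'. noncrossing t z"
    and S: "S = {t<..} \<or> S = {..<t}" and B: "B \<in> sets borel"
  shows "measure \<pi> (S \<times> B) = measure \<pi>' (S \<times> B)"
proof -
  have S': "S \<in> sets borel" "t \<notin> S" using S by auto
  have nc: "(fst z \<in> S \<longrightarrow> snd z \<in> S \<or> snd z = t) \<and> (snd z \<in> S \<longrightarrow> fst z \<in> S)" if "noncrossing t z" for z
    using that S by (cases z) (auto simp: noncrossing_def)
  have AE: "AE z in \<pi>. (fst z \<in> S \<longrightarrow> snd z \<in> S \<or> snd z = t) \<and> (snd z \<in> S \<longrightarrow> fst z \<in> S)"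
    using t(1) by eventually_elim (rule nc)
  have AE': "AE z in \<pi>'. (fst z \<in> S \<longrightarrow> snd z \<in> S \<or> snd z = t) \<and> (snd z \<in> S \<longrightarrow> fst z \<in> S)"
    using t(2) by eventually_elim (rule nc)
  show ?thesis
    using martingale_plan.measure_Times_side[OF plan snd_marginal(1) S' AE B]
      martingale_plan.measure_Times_side[OF plan' snd_marginal(2) S' AE' B] by simp
qed

text \<open>A component is the intersection of two half-lines that together cover the line. Each is
  the whole line or ends at a point outside \<open>W\<close>, where no mass crosses;
  inclusion-exclusion combines them.\<close>

lemma second_marginal_component:
  assumes plan: "martingale_plan \<mu> \<pi> K" and plan': "martingale_plan \<mu> \<pi>' K'"
    and snd_marginal: "distr \<pi> borel snd = \<nu>" "distr \<pi>' borel snd = \<nu>"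
    and t: "\<And>t. t \<notin> W \<Longrightarrow> AE z in \<pi>. noncrossing t z" "\<And>t. t \<notin> W \<Longrightarrow> AE z in \<pi>'. noncrossing t z"
    and W: "open W" and U: "U \<in> components W"
  shows "second_marginal_on U \<pi> = second_marginal_on U \<pi>'"
proof -
  interpret A: martingale_plan \<mu> \<pi> K by fact
  interpret B: martingale_plan \<mu> \<pi>' K' by fact
  interpret P: prob_space \<pi> by (rule A.prob_space_plan)
  interpret P': prob_space \<pi>' by (rule B.prob_space_plan)
  have U_open: "open U" using open_components[OF W U] .
  have U_ne: "U \<noteq> {}" using in_components_nonempty[OF U] .
  have U_int: "is_interval U" using in_components_connected[OF U] by (simp add: is_interval_connected_1)
  have U_borel: "U \<in> sets borel" using U_open by simp
  \<comment> \<open>If a limit point of \<open>U\<close> were in \<open>W\<close>, its own component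
    would be open and meet \<open>U\<close>, hence equal \<open>U\<close>.\<close>
  have boundary: "l \<notin> W" if l: "l \<notin> U" and near: "\<And>e. 0 < e \<Longrightarrow> \<exists>v\<in>U. \<bar>v - l\<bar> < e" for l
  proof
    assume "l \<in> W"
    then have "l \<in> \<Union>(components W)" by simp
    then obtain U' where U': "U' \<in> components W" "l \<in> U'" by blast
    then have "open U'" using open_components[OF W] by blast
    then obtain e where e: "0 < e" "\<And>v. dist v l < e \<Longrightarrow> v \<in> U'" using U'(2) unfolding open_dist by blast
    then obtain v where "v \<in> U" "\<bar>v - l\<bar> < e" using near by blast
    then have "v \<in> U \<inter> U'" using e by (simp add: dist_real_def)
    then have "U = U'" using components_eq[OF U U'(1)] by blast
    then show False using U' l by simp
  qed
  define R where "R = {x. \<exists>v\<in>U. v \<le> x}"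
  define L where "L = {x. \<exists>v\<in>U. x \<le> v}"
  have total: "measure \<pi> (UNIV \<times> B) = measure \<pi>' (UNIV \<times> B)" if "B \<in> sets borel" for B
  proof -
    have "measure \<nu> B = measure \<rho> (UNIV \<times> B)" if "sets \<rho> = sets borel" "distr \<rho> borel snd = \<nu>"
      for \<rho> :: "(real \<times> real) measure"
      unfolding that(2)[symmetric] using \<open>B \<in> sets borel\<close> sets_eq_imp_space_eq[OF that(1)] that(1)
      by (subst measure_distr)
         (auto simp: measurable_cong_sets[OF that(1) refl] intro!: arg_cong[where f="measure \<rho>"])
    then show ?thesis using snd_marginal A.\<pi> B.\<pi> by metis
  qed
  have R_cases: "R = UNIV \<or> (\<exists>l. l \<notin> W \<and> R = {l<..})"
  proof (cases "bdd_below U")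
    case False
    have "x \<in> R" for x
    proof -
      obtain v where "v \<in> U" "v < x" using False by (auto simp: bdd_below_def not_le)
      then show ?thesis unfolding R_def using less_imp_le by blast
    qed
    then show ?thesis by blast
  next
    case True
    define l where "l = Inf U"
    have le: "l \<le> v" if "v \<in> U" for v unfolding l_def using that True by (rule cInf_lower)
    have near: "\<exists>v\<in>U. v < x" if "l < x" for x
      using that unfolding l_def by (simp add: cInf_less_iff[OF U_ne True])
    have "l \<notin> U"
    proof
      assume "l \<in> U"
      then obtain e where e: "0 < e" "\<And>v. dist v l < e \<Longrightarrow> v \<in> U" using U_open unfolding open_dist by blast
      then have "l - e / 2 \<in> U" by (simp add: dist_real_def)
      then show False using le e(1) by fastforce
    qed
    moreover have "\<exists>v\<in>U. \<bar>v - l\<bar> < e" if "0 < e" for e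
      using near[of "l + e"] le that by force
    ultimately have "l \<notin> W" by (rule boundary)
    moreover have "R = {l<..}"
    proof (intro set_eqI iffI)
      fix x assume "x \<in> R"
      then obtain v where "v \<in> U" "v \<le> x" by (auto simp: R_def)
      then show "x \<in> {l<..}" using le[of v] \<open>l \<notin> U\<close> by (cases "v = l") auto
    next
      fix x assume "x \<in> {l<..}"
      then show "x \<in> R" using near[of x] unfolding R_def by (auto intro: less_imp_le)
    qed
    ultimately show ?thesis by blast
  qed
  have L_cases: "L = UNIV \<or> (\<exists>l. l \<notin> W \<and> L = {..<l})"
  proof (cases "bdd_above U")
    case False
    have "x \<in> L" for x
    proof -
      obtain v where "v \<in> U" "x < v" using False by (auto simp: bdd_above_def not_le)
      then show ?thesis unfolding L_def using less_imp_le by blast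
    qed
    then show ?thesis by blast
  next
    case True
    define l where "l = Sup U"
    have le: "v \<le> l" if "v \<in> U" for v unfolding l_def using that True by (rule cSup_upper)
    have near: "\<exists>v\<in>U. x < v" if "x < l" for x
      using that unfolding l_def by (simp add: less_cSup_iff[OF U_ne True])
    have "l \<notin> U"
    proof
      assume "l \<in> U"
      then obtain e where e: "0 < e" "\<And>v. dist v l < e \<Longrightarrow> v \<in> U" using U_open unfolding open_dist by blast
      then have "l + e / 2 \<in> U" by (simp add: dist_real_def)
      then show False using le e(1) by fastforce
    qed
    moreover have "\<exists>v\<in>U. \<bar>v - l\<bar> < e" if "0 < e" for e
      using near[of "l - e"] le that by force
    ultimately have "l \<notin> W" by (rule boundary)
    moreover have "L = {..<l}"
    proof (intro set_eqI iffI)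
      fix x assume "x \<in> L"
      then obtain v where "v \<in> U" "x \<le> v" by (auto simp: L_def)
      then show "x \<in> {..<l}" using le[of v] \<open>l \<notin> U\<close> by (cases "v = l") auto
    next
      fix x assume "x \<in> {..<l}"
      then show "x \<in> L" using near[of x] unfolding L_def by (auto intro: less_imp_le)
    qed
    ultimately show ?thesis by blast
  qed
  have UR: "U = R \<inter> L"
    using U_int unfolding is_interval_1 R_def L_def by blast
  have RL: "R \<union> L = UNIV"
    using U_ne unfolding R_def L_def by (auto) (metis linear)
  have R: "R \<in> sets borel" "\<And>B. B \<in> sets borel \<Longrightarrow> measure \<pi> (R \<times> B) = measure \<pi>' (R \<times> B)"
    using R_cases total second_marginal_side[OF plan plan' snd_marginal t] by auto
  have L: "L \<in> sets borel" "\<And>B. B \<in> sets borel \<Longrightarrow> measure \<pi> (L \<times> B) = measure \<pi>' (L \<times> B)"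
    using L_cases total second_marginal_side[OF plan plan' snd_marginal t] by auto
  have split: "measure \<rho> (U \<times> B) = measure \<rho> (R \<times> B) + measure \<rho> (L \<times> B) - measure \<rho> (UNIV \<times> B)"
    if "finite_measure \<rho>" "sets \<rho> = sets borel" and B: "B \<in> sets borel"
    for \<rho> :: "(real \<times> real) measure" and B
  proof -
    interpret finite_measure \<rho> by fact
    have sets: "R \<times> B \<in> sets \<rho>" "L \<times> B \<in> sets \<rho>"
      using Times_borel[OF R(1) B] Times_borel[OF L(1) B] that(2) by auto
    have "measure \<rho> (R \<times> B \<union> L \<times> B) = measure \<rho> (R \<times> B) + measure \<rho> (L \<times> B) - measure \<rho> ((R \<times> B) \<inter> (L \<times> B))"
      using sets by (intro measure_Un3) (auto simp: fmeasurable_eq_sets)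
    moreover have "R \<times> B \<union> L \<times> B = UNIV \<times> B" "(R \<times> B) \<inter> (L \<times> B) = U \<times> B"
      using RL UR by auto
    ultimately show ?thesis by simp
  qed
  have "measure \<pi> (U \<times> B) = measure \<pi>' (U \<times> B)" if "B \<in> sets borel" for B
    using split[OF P.finite_measure_axioms A.\<pi> that] split[OF P'.finite_measure_axioms B.\<pi> that]
      R(2)[OF that] L(2)[OF that] total[OF that] by simp
  then show ?thesis
    by (intro second_marginal_on_eqI A.\<pi> B.\<pi> U_borel) (simp add: P.emeasure_eq_measure P'.emeasure_eq_measure)
qed

section \<open>Decomposition into components\<close>

text \<open>Noncrossing holds almost surely for each single \<open>t\<close>, but \<open>F\<close>
  may be uncountable. A move away from a point of \<open>F\<close> passes a rational
  \<open>q\<close>, and already violates noncrossing at the point of \<open>F\<close> nearest to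
  \<open>q\<close> on the side of \<open>x\<close>. Thus countably many \<open>t\<close>
  suffice.\<close>

lemma noncrossing_boundary:
  assumes "closed F" "x \<in> F" "x \<noteq> y"
  shows "\<exists>q\<in>\<rat>. \<exists>t\<in>F. (t = Sup (F \<inter> {..q}) \<or> t = Inf (F \<inter> {q..})) \<and> \<not> noncrossing t (x, y)"
proof (cases "x < y")
  case True
  then obtain q where q: "q \<in> \<rat>" "x < q" "q < y" using Rats_dense_in_real by blast
  let ?t = "Sup (F \<inter> {..q})"
  have ne: "F \<inter> {..q} \<noteq> {}" "bdd_above (F \<inter> {..q})" using assms q by auto
  have "?t \<in> F \<inter> {..q}"
    using assms(1) by (intro closed_contains_Sup ne closed_Int) auto
  moreover have "x \<le> ?t" using assms q by (intro cSup_upper ne) auto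
  ultimately have "?t \<in> F" "\<not> noncrossing ?t (x, y)" using q by (auto simp: noncrossing_def)
  then show ?thesis using q by blast
next
  case False
  then obtain q where q: "q \<in> \<rat>" "y < q" "q < x" using Rats_dense_in_real assms(3) by (metis linorder_neqE)
  let ?t = "Inf (F \<inter> {q..})"
  have ne: "F \<inter> {q..} \<noteq> {}" "bdd_below (F \<inter> {q..})" using assms q by auto
  have "?t \<in> F \<inter> {q..}"
    using assms(1) by (intro closed_contains_Inf ne closed_Int) auto
  moreover have "?t \<le> x" using assms q by (intro cInf_lower ne) auto
  ultimately have "?t \<in> F" "\<not> noncrossing ?t (x, y)" using q by (auto simp: noncrossing_def)
  then show ?thesis using q by blast
qed

lemma AE_diagonal_off:
  assumes W: "open W" and nc: "\<And>t. t \<notin> W \<Longrightarrow> AE z in M. noncrossing t z"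
  shows "AE z in M. fst z \<notin> W \<longrightarrow> snd z = fst z"
proof -
  define T where "T = ((\<lambda>q. Sup (- W \<inter> {..q})) ` \<rat> \<union> (\<lambda>q. Inf (- W \<inter> {q..})) ` \<rat>) \<inter> - W"
  have "countable T" unfolding T_def using countable_rat by (intro countable_Int1 countable_Un countable_image) auto
  then have "AE z in M. \<forall>t\<in>T. noncrossing t z"
    using nc by (simp add: AE_ball_countable T_def)
  then show ?thesis
  proof eventually_elim
    case (elim z)
    show ?case
    proof (intro impI, rule ccontr)
      assume z: "fst z \<notin> W" "snd z \<noteq> fst z"
      have "closed (- W)" using W by (simp add: closed_Compl)
      from noncrossing_boundary[OF this, of "fst z" "snd z"] z
      obtain q t where qt: "q \<in> \<rat>" "t \<in> - W" "t = Sup (- W \<inter> {..q}) \<or> t = Inf (- W \<inter> {q..})"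
        "\<not> noncrossing t (fst z, snd z)" by auto
      then have "t \<in> T" by (auto simp: T_def)
      then show False using elim qt(4) by simp
    qed
  qed
qed

section \<open>Open intervals spanned by the contact sets\<close>

definition (in martingale_plan) good :: "(real \<times> real) set \<Rightarrow> real set" where
  "good \<Gamma> = {x. (AE y in K x. (x, y) \<in> \<Gamma>) \<and> has_bochner_integral (K x) (\<lambda>y. y) x}"

definition spread :: "(real \<times> real) set \<Rightarrow> real \<Rightarrow> real set" where
  "spread \<Gamma> x = strictly_between {y. (x, y) \<in> \<Gamma>}"

lemma spread_open: "open (spread \<Gamma> x)"
  unfolding spread_def by (rule open_strictly_between)

lemma spread_connected: "connected (spread \<Gamma> x)"
  unfolding spread_def strictly_between_def is_interval_connected_1[symmetric] is_interval_1
  by (auto intro: le_less_trans less_le_trans)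

context martingale_plan
begin

lemma good_between:
  assumes "x \<in> good \<Gamma>"
  obtains y z where "(x, y) \<in> \<Gamma>" "y \<le> x" "(x, z) \<in> \<Gamma>" "x \<le> z"
proof -
  have "AE y in K x. y \<in> {y. (x, y) \<in> \<Gamma>}" "has_bochner_integral (K x) (\<lambda>y. y) x"
    using assms by (auto simp: good_def)
  from mean_between[OF prob_space_kernel this(2,1)] show thesis using that by blast
qed

text \<open>If \<open>x\<close> is not strictly between two of its contact points, the kernel lives
  on one side of its mean and is a point mass.\<close>

lemma good_not_spread:
  assumes "x \<in> good \<Gamma>" "x \<notin> spread \<Gamma> x"
  shows "AE y in K x. y = x"
proof (rule mean_at_bound[OF prob_space_kernel])
  have AE: "AE y in K x. (x, y) \<in> \<Gamma>" and "has_bochner_integral (K x) (\<lambda>y. y) x"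
    using assms by (auto simp: good_def)
  then show "has_bochner_integral (K x) (\<lambda>y. y) x" by simp
  have "(\<forall>y. (x, y) \<in> \<Gamma> \<longrightarrow> x \<le> y) \<or> (\<forall>y. (x, y) \<in> \<Gamma> \<longrightarrow> y \<le> x)"
    using assms(2) by (force simp: spread_def strictly_between_def not_less)
  then show "(AE y in K x. x \<le> y) \<or> (AE y in K x. y \<le> x)"
  proof
    assume "\<forall>y. (x, y) \<in> \<Gamma> \<longrightarrow> x \<le> y"
    then have "AE y in K x. x \<le> y" using AE by (auto elim!: eventually_mono)
    then show ?thesis ..
  next
    assume "\<forall>y. (x, y) \<in> \<Gamma> \<longrightarrow> y \<le> x"
    then have "AE y in K x. y \<le> x" using AE by (auto elim!: eventually_mono)
    then show ?thesis ..
  qed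
qed

text \<open>Points outside their own spread are left out: \<open>\<Gamma>\<close> may span an
  interval over such an \<open>x\<close>, but the kernel there is the point mass at
  \<open>x\<close>.\<close>

definition spread_union :: "(real \<times> real) set \<Rightarrow> real set" where
  "spread_union \<Gamma> = (\<Union>x\<in>{x \<in> good \<Gamma>. x \<in> spread \<Gamma> x}. spread \<Gamma> x)"

lemma spread_union_open: "open (spread_union \<Gamma>)"
  unfolding spread_union_def by (intro open_UN ballI spread_open)

text \<open>A fibre that is a point mass at \<open>x\<close> crosses nothing. Otherwise the contact
  points surround \<open>x\<close> while \<open>t\<close> is not strictly between any two of them,
  so all of them lie weakly on the same side of \<open>t\<close> as \<open>x\<close>.\<close>

lemma good_noncrossing:
  assumes x: "x \<in> good \<Gamma>" and t: "t \<notin> spread_union \<Gamma>"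
  shows "AE y in K x. noncrossing t (x, y)"
proof (cases "x \<in> spread \<Gamma> x")
  case False
  then show ?thesis
    using good_not_spread[OF x] by (auto simp: noncrossing_def elim!: eventually_mono)
next
  case True
  then have t: "t \<notin> spread \<Gamma> x" using x t by (auto simp: spread_union_def)
  have "AE y in K x. (x, y) \<in> \<Gamma>" using x by (simp add: good_def)
  then show ?thesis
  proof eventually_elim
    case (elim y)
    obtain y1 y2 where y: "(x, y1) \<in> \<Gamma>" "(x, y2) \<in> \<Gamma>" "y1 < x" "x < y2"
      using True by (auto simp: spread_def strictly_between_def)
    have no: "\<not> (a < t \<and> t < b)" if "(x, a) \<in> \<Gamma>" "(x, b) \<in> \<Gamma>" for a b
      using t that by (auto simp: spread_def strictly_between_def)
    show ?case
      using no[OF elim y(2)] no[OF y(1) elim] no[OF y(1,2)] y(3,4) unfolding noncrossing_def by auto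
  qed
qed

lemma AE_good:
  assumes "\<Gamma> \<in> sets borel" "AE z in \<pi>. z \<in> \<Gamma>"
  shows "AE x in \<mu>. x \<in> good \<Gamma>"
proof -
  have "AE x in \<mu>. AE y in K x. (x, y) \<in> \<Gamma>"
    using assms by (intro disintegration_AE) simp_all
  then show ?thesis using mean by eventually_elim (simp add: good_def)
qed

lemma AE_noncrossing:
  assumes "\<Gamma> \<in> sets borel" "AE z in \<pi>. z \<in> \<Gamma>" "t \<notin> spread_union \<Gamma>"
  shows "AE z in \<pi>. noncrossing t z"
  using AE_good[OF assms(1,2)]
  by (intro disintegration_AE_I noncrossing_borel) (auto elim!: eventually_mono intro: good_noncrossing[OF _ assms(3)])

text \<open>Inside a component the contact sets overlap in a chain, which ties all the affine functions
  \<open>\<phi> x + \<Delta> x * y\<close> to that of one fixed point.\<close>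

lemma component_potentials:
  assumes opt: "finitely_optimal c \<Gamma>" and c: "c \<in> borel_measurable borel" "\<And>p. \<bar>c p\<bar> \<le> C"
    and U: "U \<in> components (spread_union \<Gamma>)"
  defines "G \<equiv> {p \<in> \<Gamma>. fst p \<in> good \<Gamma> \<inter> U}"
  shows "\<exists>\<phi> \<psi> \<Delta>. potentials c G \<phi> \<psi> \<Delta>" "U \<subseteq> strictly_between (real_hull (snd ` G))"
    "fst ` G = good \<Gamma> \<inter> U"
proof -
  \<comment> \<open>The points whose spreads generate the component; good points of \<open>U\<close>
    with a point mass as kernel are attached afterwards.\<close>
  define X where "X = {x \<in> good \<Gamma>. x \<in> spread \<Gamma> x} \<inter> U"
  have U_sub: "U \<subseteq> spread_union \<Gamma>" using in_components_subset[OF U] .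
  have cover: "\<exists>x\<in>X. t \<in> spread \<Gamma> x \<and> spread \<Gamma> x \<subseteq> U" if t: "t \<in> U" for t
  proof -
    obtain x where x: "x \<in> good \<Gamma>" "x \<in> spread \<Gamma> x" "t \<in> spread \<Gamma> x"
      using U_sub t by (auto simp: spread_union_def)
    have "spread \<Gamma> x \<subseteq> spread_union \<Gamma>" using x by (auto simp: spread_union_def)
    then have "spread \<Gamma> x \<subseteq> U"
      using components_maximal[OF U spread_connected] x t by blast
    then show ?thesis using x by (auto simp: X_def)
  qed
  have sub: "spread \<Gamma> x \<subseteq> U" if "x \<in> X" for x
  proof -
    have "spread \<Gamma> x \<subseteq> spread_union \<Gamma>" "x \<in> U" "x \<in> spread \<Gamma> x"
      using that by (auto simp: spread_union_def X_def)
    then show ?thesis using components_maximal[OF U spread_connected] by blast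
  qed
  have inG: "(x, y) \<in> G" if "x \<in> good \<Gamma> \<inter> U" "(x, y) \<in> \<Gamma>" for x y
    using that by (simp add: G_def)
  have overlap: "linked c G x x'" if x: "x \<in> X" "x' \<in> X" and t: "t \<in> spread \<Gamma> x" "t \<in> spread \<Gamma> x'" for x x' t
  proof -
    obtain y1 y2 z1 z2 where "(x, y1) \<in> \<Gamma>" "(x, y2) \<in> \<Gamma>" "y1 < t" "t < y2"
      "(x', z1) \<in> \<Gamma>" "(x', z2) \<in> \<Gamma>" "z1 < t" "t < z2"
      using t by (auto simp: spread_def strictly_between_def)
    then show ?thesis using x
      by (intro linked_overlap[OF c(2), of x y1 G y2 x' z1 z2]) (auto intro!: inG simp: X_def)
  qed
  obtain x0 where x0: "x0 \<in> X"
    using in_components_nonempty[OF U] cover by blast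
  \<comment> \<open>Connectedness replaces an explicit chain: spreads of points linked to
    \<open>x0\<close> and of points not linked to it never meet, so otherwise they would split
    \<open>U\<close> into two nonempty open sets.\<close>
  have X_linked: "linked c G x x0" if "x \<in> X" for x
  proof (rule ccontr)
    assume not: "\<not> linked c G x x0"
    define V1 where "V1 = (\<Union>x\<in>{x \<in> X. linked c G x x0}. spread \<Gamma> x)"
    define V2 where "V2 = (\<Union>x\<in>{x \<in> X. \<not> linked c G x x0}. spread \<Gamma> x)"
    have "open V1" "open V2" unfolding V1_def V2_def by (intro open_UN ballI spread_open)+
    moreover have "U \<subseteq> V1 \<union> V2"
      unfolding V1_def V2_def using cover by blast
    moreover have "V1 \<inter> V2 \<inter> U = {}"
    proof -
      have False if "a \<in> X" "linked c G a x0" "b \<in> X" "\<not> linked c G b x0" "t \<in> spread \<Gamma> a" "t \<in> spread \<Gamma> b" for a b t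
        using overlap[OF that(3,1,6,5)] that(2,4) linked_trans by blast
      then show ?thesis unfolding V1_def V2_def by blast
    qed
    moreover have "V1 \<inter> U \<noteq> {}"
      using x0 linked_refl[of c G x0] by (auto simp: V1_def X_def)
    moreover have "V2 \<inter> U \<noteq> {}"
      using \<open>x \<in> X\<close> not by (auto simp: V2_def X_def)
    ultimately show False
      using in_components_connected[OF U] unfolding connected_def by blast
  qed
  show fst_G: "fst ` G = good \<Gamma> \<inter> U"
  proof
    show "fst ` G \<subseteq> good \<Gamma> \<inter> U" by (auto simp: G_def)
    show "good \<Gamma> \<inter> U \<subseteq> fst ` G"
    proof
      fix x assume x: "x \<in> good \<Gamma> \<inter> U"
      then obtain y where "(x, y) \<in> \<Gamma>" using good_between by blast
      then show "x \<in> fst ` G" using inG[OF x] by force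
    qed
  qed
  \<comment> \<open>A good point need not lie strictly between its own contact points, but weak
    inequalities suffice when it lies strictly between those of some point of
    \<open>X\<close>.\<close>
  have linked: "linked c G x x0" if "x \<in> fst ` G" for x
  proof -
    have x: "x \<in> good \<Gamma>" "x \<in> U" using that fst_G by auto
    obtain x' where x': "x' \<in> X" "x \<in> spread \<Gamma> x'" using cover[OF x(2)] by blast
    obtain y1 y2 where y: "(x, y1) \<in> \<Gamma>" "y1 \<le> x" "(x, y2) \<in> \<Gamma>" "x \<le> y2" using good_between[OF x(1)] by blast
    obtain z1 z2 where z: "(x', z1) \<in> \<Gamma>" "z1 < x" "(x', z2) \<in> \<Gamma>" "x < z2"
      using x'(2) by (auto simp: spread_def strictly_between_def)
    have "linked c G x x'"
      using x x'(1) y z by (intro linked_overlap[OF c(2), of x y1 G y2 x' z1 z2]) (auto intro!: inG simp: X_def)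
    then show ?thesis using X_linked[OF x'(1)] by (rule linked_trans)
  qed
  show "\<exists>\<phi> \<psi> \<Delta>. potentials c G \<phi> \<psi> \<Delta>"
  proof (rule potentials_exist[OF _ linked])
    fix H assume "finite H" "H \<subseteq> G"
    then show "\<exists>\<phi> \<psi> \<Delta>. potentials c H \<phi> \<psi> \<Delta>"
      by (intro finitely_optimal_potentials[OF opt c(1)]) (auto simp: G_def)
  qed
  show "U \<subseteq> strictly_between (real_hull (snd ` G))"
  proof
    fix t assume "t \<in> U"
    then obtain x where x: "x \<in> X" "t \<in> spread \<Gamma> x" using cover by blast
    then obtain y1 y2 where y: "(x, y1) \<in> \<Gamma>" "(x, y2) \<in> \<Gamma>" "y1 < t" "t < y2"
      by (auto simp: spread_def strictly_between_def)
    then have "(x, y1) \<in> G" "(x, y2) \<in> G" using x by (auto intro!: inG simp: X_def)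
    then have "y1 \<in> real_hull (snd ` G)" "y2 \<in> real_hull (snd ` G)"
      using subset_real_hull[of "snd ` G"] by force+
    then show "t \<in> strictly_between (real_hull (snd ` G))"
      using y by (auto simp: strictly_between_def)
  qed
qed

end

text \<open>The line splits into the complement of \<open>W\<close> and the components of
  \<open>W\<close>, which are countably many because they are disjoint open sets. The costs are
  compared piece by piece and added.\<close>

lemma martingale_plan_le:
  fixes c :: "real \<times> real \<Rightarrow> real"
  assumes plan: "martingale_plan \<mu> \<pi> K" and plan': "martingale_plan \<mu> \<pi>' K'"
    and snd_marginal: "distr \<pi> borel snd = \<nu>" "distr \<pi>' borel snd = \<nu>"
    and c: "continuous_on UNIV c" "\<And>p. \<bar>c p\<bar> \<le> C"
    and opt: "finitely_optimal c \<Gamma>" and \<Gamma>: "\<Gamma> \<in> sets borel" "AE z in \<pi>. z \<in> \<Gamma>"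
  shows "(\<integral>\<^sup>+ z. ennreal (c z + C) \<partial>\<pi>) \<le> (\<integral>\<^sup>+ z. ennreal (c z + C) \<partial>\<pi>')"
proof -
  interpret A: martingale_plan \<mu> \<pi> K by fact
  interpret B: martingale_plan \<mu> \<pi>' K' by fact
  define W where "W = A.spread_union \<Gamma>"
  have W: "open W" unfolding W_def by (rule A.spread_union_open)
  have c_borel [measurable]: "c \<in> borel_measurable borel" using c(1) by (rule borel_measurable_continuous_onI)
  have nc: "AE z in \<pi>. noncrossing t z" if "t \<notin> W" for t
    using A.AE_noncrossing[OF \<Gamma>] that by (simp add: W_def)
  have nc': "AE z in \<pi>'. noncrossing t z" if "t \<notin> W" for t
    using nc[OF that] A.noncrossing_integral[OF snd_marginal(1)] B.noncrossing_integral[OF snd_marginal(2)] by simp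
  let ?P = "\<lambda>\<rho> A. \<integral>\<^sup>+ z. ennreal (c z + C) * indicator A (fst z) \<partial>\<rho>"
  \<comment> \<open>Over the complement of \<open>W\<close> both plans sit on the diagonal, so their
    costs there are the same integral over the first marginal.\<close>
  have diag: "?P \<rho> (- W) = (\<integral>\<^sup>+ x. ennreal (c (x, x) + C) * indicator (- W) x \<partial>\<mu>)"
    if "martingale_plan \<mu> \<rho> L" "\<And>t. t \<notin> W \<Longrightarrow> AE z in \<rho>. noncrossing t z" for \<rho> L
  proof -
    interpret R: martingale_plan \<mu> \<rho> L by fact
    have cd [measurable]: "(\<lambda>x. c (x, x)) \<in> borel_measurable borel"
      by (intro borel_measurable_continuous_onI continuous_on_compose2[OF c(1)]) (auto intro!: continuous_intros)
    have [measurable]: "W \<in> sets borel" using W by simp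
    have "?P \<rho> (- W) = (\<integral>\<^sup>+ z. ennreal (c (fst z, fst z) + C) * indicator (- W) (fst z) \<partial>\<rho>)"
    proof (rule nn_integral_cong_AE)
      have "AE z in \<rho>. fst z \<notin> W \<longrightarrow> snd z = fst z" by (rule AE_diagonal_off[OF W]) (rule that(2))
      then show "AE z in \<rho>. ennreal (c z + C) * indicator (- W) (fst z) =
          ennreal (c (fst z, fst z) + C) * indicator (- W) (fst z)"
      proof eventually_elim
        case (elim z)
        then show ?case by (cases z) (auto simp: indicator_def)
      qed
    qed
    also have "\<dots> = (\<integral>\<^sup>+ x. ennreal (c (x, x) + C) * indicator (- W) x \<partial>\<mu>)"
      unfolding R.fst_marginal[symmetric] by (subst nn_integral_distr) (auto intro!: R.measurable_plan)
    finally show ?thesis .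
  qed
  have piece: "?P \<pi> A \<le> ?P \<pi>' A" if "A \<in> insert (- W) (components W)" for A
  proof (cases "A = - W")
    case True
    then show ?thesis using diag[OF plan nc] diag[OF plan' nc'] by simp
  next
    case False
    then have U: "A \<in> components (A.spread_union \<Gamma>)" using that by (simp add: W_def)
    define G where "G = {p \<in> \<Gamma>. fst p \<in> A.good \<Gamma> \<inter> A}"
    note G = A.component_potentials[OF opt c_borel c(2) U, folded G_def]
    obtain \<phi> \<psi> \<Delta> where pot: "potentials c G \<phi> \<psi> \<Delta>" using G(1) by blast
    have A_borel: "A \<in> sets borel" using open_components[OF A.spread_union_open U] by simp
    have AE_G: "AE x in \<mu>. x \<in> A \<longrightarrow> x \<in> fst ` G \<and> (AE y in K x. (x, y) \<in> G)"
      using A.AE_good[OF \<Gamma>]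
    proof eventually_elim
      case (elim x)
      show ?case
      proof (intro impI conjI)
        assume "x \<in> A"
        then show "x \<in> fst ` G" using elim G(3) by simp
        have "AE y in K x. (x, y) \<in> \<Gamma>" using elim by (simp add: A.good_def)
        then show "AE y in K x. (x, y) \<in> G" by eventually_elim (simp add: G_def elim \<open>x \<in> A\<close>)
      qed
    qed
    have snd_eq: "second_marginal_on A \<pi> = second_marginal_on A \<pi>'"
      by (rule second_marginal_component[OF plan plan' snd_marginal nc nc' W]) (use U in \<open>simp_all add: W_def\<close>)
    show ?thesis
      by (rule component_le[OF plan plan' c pot A_borel G(2) AE_G snd_eq])
  qed
  \<comment> \<open>The shifted cost as a measure on the first coordinate, so that countable
    additivity adds up the pieces.\<close>
  define Q where "Q \<rho> = distr (density \<rho> (\<lambda>z. ennreal (c z + C))) borel fst" for \<rho> :: "(real \<times> real) measure"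
  have Q: "emeasure (Q \<rho>) A = ?P \<rho> A" if "sets \<rho> = sets borel" "A \<in> sets borel" for \<rho> A
  proof -
    have m: "fst \<in> borel_measurable \<rho>" "(\<lambda>z. ennreal (c z + C)) \<in> borel_measurable \<rho>"
      by (simp_all add: measurable_cong_sets[OF that(1) refl])
    have "fst -` A \<inter> space \<rho> \<in> sets \<rho>" using measurable_sets[OF m(1) that(2)] .
    then have "emeasure (Q \<rho>) A = (\<integral>\<^sup>+ z. ennreal (c z + C) * indicator (fst -` A \<inter> space \<rho>) z \<partial>\<rho>)"
      unfolding Q_def using m that by (subst emeasure_distr) (auto simp: emeasure_density)
    also have "\<dots> = ?P \<rho> A" by (intro nn_integral_cong) (auto simp: indicator_def)
    finally show ?thesis .
  qed
  have comp_sets: "A \<in> sets borel" if "A \<in> insert (- W) (components W)" for A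
    using that W open_components[OF W] by auto
  have countable: "countable (insert (- W) (components W))"
    using countable_disjoint_open_subsets[of "components W"] open_components[OF W] pairwise_disjoint_components[of W]
    by (simp add: pairwise_def disjnt_def)
  have disjoint: "disjoint_family_on id (insert (- W) (components W))"
    unfolding disjoint_family_on_def
    using components_nonoverlap[of _ W] in_components_subset[of _ W] by (auto; blast)
  have union: "(\<Union>(id ` insert (- W) (components W))) = UNIV" by auto
  have total: "(\<integral>\<^sup>+ z. ennreal (c z + C) \<partial>\<rho>) = (\<integral>\<^sup>+ A. ?P \<rho> A \<partial>count_space (insert (- W) (components W)))"
    if "sets \<rho> = sets borel" for \<rho>
  proof -
    have "(\<integral>\<^sup>+ z. ennreal (c z + C) \<partial>\<rho>) = emeasure (Q \<rho>) UNIV"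
      using Q[OF that, of UNIV] by simp
    also have "\<dots> = emeasure (Q \<rho>) (\<Union>A\<in>insert (- W) (components W). id A)"
      unfolding union ..
    also have "\<dots> = (\<integral>\<^sup>+ A. emeasure (Q \<rho>) (id A) \<partial>count_space (insert (- W) (components W)))"
      by (rule emeasure_UN_countable[OF _ countable disjoint]) (use comp_sets in \<open>auto simp: Q_def\<close>)
    also have "\<dots> = (\<integral>\<^sup>+ A. ?P \<rho> A \<partial>count_space (insert (- W) (components W)))"
      using comp_sets by (intro nn_integral_cong) (auto simp: Q[OF that])
    finally show ?thesis .
  qed
  show ?thesis
    unfolding total[OF A.\<pi>] total[OF B.\<pi>] using piece by (intro nn_integral_mono) simp
qed

theorem lemmaA2:
  fixes \<mu> \<nu> :: "real measure" and \<pi> :: "(real \<times> real) measure" and c :: "real \<times> real \<Rightarrow> real"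
  assumes "prob_space \<mu>" and "sets \<mu> = sets borel" and "integrable \<mu> (\<lambda>x. x)"
    and "prob_space \<nu>" and "sets \<nu> = sets borel" and "integrable \<nu> (\<lambda>y. y)"
    and "convex_order \<mu> \<nu>"
    and "continuous_on UNIV c" and "bounded (range c)"
    and "\<pi> \<in> martingale_plans \<mu> \<nu>"
    and "\<exists>\<Gamma>. \<Gamma> \<in> sets borel \<and> finitely_optimal c \<Gamma> \<and> emeasure \<pi> \<Gamma> = 1"
  shows "optimal_martingale_plan c \<mu> \<nu> \<pi>"
  unfolding optimal_martingale_plan_def
proof (intro conjI ballI)
  show "\<pi> \<in> martingale_plans \<mu> \<nu>" by fact
  obtain \<Gamma> where \<Gamma>: "\<Gamma> \<in> sets borel" "finitely_optimal c \<Gamma>" "emeasure \<pi> \<Gamma> = 1"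
    using assms(11) by blast
  obtain C where C: "\<And>p. \<bar>c p\<bar> \<le> C"
    using assms(9) unfolding bounded_iff by (auto simp: image_iff)
  have plan: "\<exists>K. martingale_plan \<mu> \<rho> K" if \<rho>_plan: "\<rho> \<in> martingale_plans \<mu> \<nu>" for \<rho>
  proof -
    obtain K where K: "disintegration \<rho> \<mu> K" "AE x in \<mu>. has_bochner_integral (K x) (\<lambda>y. y) x"
      and \<rho>: "sets \<rho> = sets borel" "distr \<rho> borel fst = \<mu>" "distr \<rho> borel snd = \<nu>"
      using \<rho>_plan unfolding martingale_plans_def by blast
    have m: "snd \<in> borel_measurable \<rho>" by (simp add: measurable_cong_sets[OF \<rho>(1) refl])
    have "integrable (distr \<rho> borel snd) (\<lambda>y. y)" unfolding \<rho>(3) by (rule assms(6))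
    then have int: "integrable \<rho> snd"
      by (subst (asm) integrable_distr_eq[OF m]) auto
    have "martingale_plan \<mu> \<rho> K"
      unfolding martingale_plan_def disintegrated_def martingale_plan_axioms_def
      by (intro conjI) (fact assms \<rho> K int)+
    then show ?thesis by blast
  qed
  fix \<pi>' assume \<pi>': "\<pi>' \<in> martingale_plans \<mu> \<nu>"
  obtain K K' where K: "martingale_plan \<mu> \<pi> K" "martingale_plan \<mu> \<pi>' K'"
    using plan[OF assms(10)] plan[OF \<pi>'] by blast
  interpret A: martingale_plan \<mu> \<pi> K by (rule K)
  interpret B: martingale_plan \<mu> \<pi>' K' by (rule K)
  interpret P: prob_space \<pi> by (rule A.prob_space_plan)
  interpret P': prob_space \<pi>' by (rule B.prob_space_plan)
  have AE: "AE z in \<pi>. z \<in> \<Gamma>"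
    by (rule P.AE_prob_1) (simp add: measure_def \<Gamma>(3))
  have snd_marginal: "distr \<pi> borel snd = \<nu>" "distr \<pi>' borel snd = \<nu>"
    using assms(10) \<pi>' unfolding martingale_plans_def by blast+
  have le: "(\<integral>\<^sup>+ z. ennreal (c z + C) \<partial>\<pi>) \<le> (\<integral>\<^sup>+ z. ennreal (c z + C) \<partial>\<pi>')"
    by (rule martingale_plan_le[OF K snd_marginal assms(8) C \<Gamma>(2,1) AE])
  have c_borel: "c \<in> borel_measurable borel" using assms(8) by (rule borel_measurable_continuous_onI)
  have int: "integrable \<rho> c" if "prob_space \<rho>" "sets \<rho> = sets borel" for \<rho>
  proof -
    interpret prob_space \<rho> by fact
    show ?thesis
      using C c_borel by (intro integrable_const_bound[where B=C]) (auto simp: measurable_cong_sets[OF that(2) refl])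
  qed
  \<comment> \<open>On probability measures the shift adds the same constant \<open>C\<close> to
    both costs.\<close>
  have eq: "(\<integral>\<^sup>+ z. ennreal (c z + C) \<partial>\<rho>) = ennreal ((\<integral>z. c z \<partial>\<rho>) + C)" "0 \<le> (\<integral>z. c z \<partial>\<rho>) + C"
    if \<rho>: "prob_space \<rho>" "sets \<rho> = sets borel" for \<rho>
  proof -
    interpret prob_space \<rho> by fact
    have nonneg: "0 \<le> c z + C" for z using C[of z] by linarith
    have val: "(\<integral>z. c z + C \<partial>\<rho>) = (\<integral>z. c z \<partial>\<rho>) + C" using int[OF \<rho>] prob_space by simp
    show "(\<integral>\<^sup>+ z. ennreal (c z + C) \<partial>\<rho>) = ennreal ((\<integral>z. c z \<partial>\<rho>) + C)"
      unfolding val[symmetric] using int[OF \<rho>] nonneg by (intro nn_integral_eq_integral) auto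
    show "0 \<le> (\<integral>z. c z \<partial>\<rho>) + C" unfolding val[symmetric] using nonneg by simp
  qed
  show "(\<integral>z. c z \<partial>\<pi>) \<le> (\<integral>z. c z \<partial>\<pi>')"
    using le eq[OF P.prob_space_axioms A.\<pi>] eq[OF P'.prob_space_axioms B.\<pi>] by simp
qed

end
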